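(* Fix $\lambda\in(0,1)$ and $\alpha\in(0,1)$. There exist $s_0>0$ and a $C^1$-curve $s\mapsto(\gamma(s),\eta(s))\in\mathbb{R}\times C^{2,\alpha}(\partial B_1)$, $s\in(-s_0,s_0)$, such that for each $s$ the pair $(\gamma(s),\eta(s))$ is a solution of the overdetermined problem $$\Delta\psi=\gamma \text{ in }\Omega_\eta\setminus\overline{B_\lambda},\qquad \psi=0\text{ on }\partial\Omega_\eta,\qquad \psi=1\text{ on }\partial B_\lambda,\qquad |\nabla\psi|^2=Q>0\text{ on }\partial\Omega_\eta$$ (with $Q$ a constant), and: (1) At $s=0$, $(\gamma(0),\eta(0))=(\gamma^*,0)$, where $$\gamma^*=\frac{4}{\lambda^2-2\lambda^2\ln\lambda-1},$$ and the admissible domain $\Omega_{\eta(0)}\setminus B_\lambda$ is the standard annulus $B_1\setminus B_\lambda$. (2) For all $s\ne0$ sufficiently small, the admissible domain $\Omega_{\eta(s)}\setminus B_\lambda$ is not an annulus. It is given by $$\Omega_{\eta(s)}\setminus B_\lambda=\{x\in\mathbb{R}^2:\ \lambda<|x|<1+\eta(s)(x/|x|)\},$$ where, in terms of the polar angle $\theta$ of $x/|x|$, $$\eta(s)=s\,\alpha_1\cos\theta+o(s)\quad (s\to0),\qquad \alpha_1\neq0 \text{ a constant}.$$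
   Context: $B_r\subset\mathbb{R}^2$ denotes the open disk of radius $r$ centered at the origin. For small $\eta\in C^{2,\alpha}(\partial B_1)$, $\Omega_\eta$ is the bounded domain with boundary $\partial\Omega_\eta=\{x+\eta(x)\nu(x):x\in\partial B_1\}$, where $\nu$ is the outward unit normal of $\partial B_1$; $\eta$ is small enough that this is well defined and $\overline{B_\lambda}\subset\Omega_\eta$. Functions on $\partial B_1$ are identified with functions of the polar angle $\theta$. A pair $(\gamma,\eta)$ is called a solution of the overdetermined problem if there exist a constant $Q>0$ and a function $\psi$ of class $C^{2,\alpha}$ up to the boundary of $\Omega_\eta\setminus\overline{B_\lambda}$ satisfying all four conditions (the constant $Q$ may depend on the pair); the domain $\Omega_\eta\setminus B_\lambda$ is then called an admissible domain. The remainder $o(s)$ is understood in $C^{2,\alpha}(\partial B_1)$. An annulus is a region bounded by two concentric circles.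
   Formalization: In (2) the set identity is proved with the closed disk removed, i.e. for Ω_{η(s)} minus the closure of B_λ; with the open disk B_λ, as printed, it fails on the circle |x|=λ. *)

theory Defs
  imports "HOL-Analysis.Analysis" "HOL-Library.Landau_Symbols"
begin

section \<open>Hoelder functions on the unit circle\<close>

definition unit_vec :: "real \<Rightarrow> real^2" where
  "unit_vec \<theta> = vector [cos \<theta>, sin \<theta>]"

text \<open>A function on the unit circle is represented by a function on the plane, whose values off
  the circle play no role; \<open>angular\<close> is the identification with a function of the polar angle.\<close>

definition angular :: "(real^2 \<Rightarrow> real) \<Rightarrow> real \<Rightarrow> real" where
  "angular f = (\<lambda>\<theta>. f (unit_vec \<theta>))"

definition holder_on :: "real \<Rightarrow> 'a::metric_space set \<Rightarrow> ('a \<Rightarrow> 'b::metric_space) \<Rightarrow> bool" where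
  "holder_on \<alpha> D f \<longleftrightarrow> (\<exists>C. \<forall>x\<in>D. \<forall>y\<in>D. dist (f x) (f y) \<le> C * dist x y powr \<alpha>)"

text \<open>The space \<open>C\<^sup>2\<^sup>,\<^sup>\<alpha>\<close> of the circle, in terms of the polar angle. Continuity of the second
  derivative follows from the Hoelder condition (for \<open>\<alpha> > 0\<close>). By periodicity the Hoelder condition,
  and the seminorm below, are the same over all pairs of angles as over pairs of points at
  their arc distance.\<close>

definition C2_circle :: "real \<Rightarrow> (real \<Rightarrow> real) set" where
  "C2_circle \<alpha> = {g. (\<forall>\<theta>. g (\<theta> + 2 * pi) = g \<theta>) \<and>
     (\<forall>\<theta>. g differentiable (at \<theta>)) \<and> (\<forall>\<theta>. deriv g differentiable (at \<theta>)) \<and>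
     holder_on \<alpha> UNIV (deriv (deriv g))}"

text \<open>The suprema are meaningful for members of \<open>C2_circle \<alpha>\<close>, where they are finite.\<close>

definition C2_norm :: "real \<Rightarrow> (real \<Rightarrow> real) \<Rightarrow> real" where
  "C2_norm \<alpha> g =
     (SUP \<theta>. \<bar>g \<theta>\<bar>) + (SUP \<theta>. \<bar>deriv g \<theta>\<bar>) + (SUP \<theta>. \<bar>deriv (deriv g) \<theta>\<bar>) +
     Sup {\<bar>deriv (deriv g) \<theta> - deriv (deriv g) \<phi>\<bar> / \<bar>\<theta> - \<phi>\<bar> powr \<alpha> | \<theta> \<phi>. \<theta> \<noteq> \<phi>}"

text \<open>Continuously (Frechet) differentiable curves \<open>u : S \<rightarrow> C\<^sup>2\<^sup>,\<^sup>\<alpha>\<close> for an open set \<open>S\<close> of parameters;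
  \<open>v\<close> is the derivative of the curve.\<close>

definition C1_curve :: "real \<Rightarrow> real set \<Rightarrow> (real \<Rightarrow> real \<Rightarrow> real) \<Rightarrow> bool" where
  "C1_curve \<alpha> S u \<longleftrightarrow> (\<forall>s\<in>S. u s \<in> C2_circle \<alpha>) \<and>
     (\<exists>v. \<forall>s\<in>S. v s \<in> C2_circle \<alpha> \<and>
        ((\<lambda>h. C2_norm \<alpha> (\<lambda>\<theta>. (u (s + h) \<theta> - u s \<theta>) / h - v s \<theta>)) \<longlongrightarrow> 0) (at 0) \<and>
        ((\<lambda>t. C2_norm \<alpha> (\<lambda>\<theta>. v t \<theta> - v s \<theta>)) \<longlongrightarrow> 0) (at s))"

section \<open>The domains\<close>

text \<open>The outward unit normal of the unit disk at a boundary point \<open>x\<close> is \<open>x\<close> itself.\<close>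

definition perturbed_circle :: "(real^2 \<Rightarrow> real) \<Rightarrow> (real^2) set" where
  "perturbed_circle \<eta> = {x + \<eta> x *\<^sub>R x | x. x \<in> sphere 0 1}"

definition bounded_domain_with_boundary :: "(real^2) set \<Rightarrow> (real^2) set \<Rightarrow> bool" where
  "bounded_domain_with_boundary \<Gamma> \<Omega> \<longleftrightarrow>
     open \<Omega> \<and> connected \<Omega> \<and> bounded \<Omega> \<and> \<Omega> \<noteq> {} \<and> frontier \<Omega> = \<Gamma>"

definition Omega :: "(real^2 \<Rightarrow> real) \<Rightarrow> (real^2) set" where
  "Omega \<eta> = (THE \<Omega>. bounded_domain_with_boundary (perturbed_circle \<eta>) \<Omega>)"

text \<open>The smallness requirement on \<open>\<eta>\<close>: the perturbed circle is a graph over the unit circle,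
  \<open>Omega \<eta>\<close> is well defined, and it contains the closed hole.\<close>

definition admissible_perturbation :: "real \<Rightarrow> real \<Rightarrow> (real^2 \<Rightarrow> real) \<Rightarrow> bool" where
  "admissible_perturbation lam \<alpha> \<eta> \<longleftrightarrow>
     angular \<eta> \<in> C2_circle \<alpha> \<and> (\<forall>x\<in>sphere 0 1. -1 < \<eta> x) \<and>
     (\<exists>!\<Omega>. bounded_domain_with_boundary (perturbed_circle \<eta>) \<Omega>) \<and>
     cball 0 lam \<subseteq> Omega \<eta>"

definition admissible_domain :: "real \<Rightarrow> (real^2 \<Rightarrow> real) \<Rightarrow> (real^2) set" where
  "admissible_domain lam \<eta> = Omega \<eta> - ball 0 lam"

text \<open>A region bounded by two concentric circles, whichever parts of the circles are included.\<close>

definition annulus :: "(real^2) set \<Rightarrow> bool" where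
  "annulus A \<longleftrightarrow> (\<exists>c r R. 0 < r \<and> r < R \<and>
     {x. r < dist c x \<and> dist c x < R} \<subseteq> A \<and> A \<subseteq> {x. r \<le> dist c x \<and> dist c x \<le> R})"

section \<open>The overdetermined problem\<close>

text \<open>\<open>\<psi>\<close> is of class \<open>C\<^sup>2\<^sup>,\<^sup>\<alpha>\<close> up to the boundary of the bounded open set \<open>D\<close>. Here \<open>G\<close> and \<open>H\<close> are the
  gradient and the Hessian matrix of \<open>\<psi>\<close> in \<open>D\<close>, together with their continuous extensions
  to \<open>closure D\<close> (which are unique). In particular \<open>G\<close> gives the meaning of the gradient at points of
  \<open>frontier D\<close>.\<close>

definition C2_up_to_boundary ::
  "real \<Rightarrow> (real^2) set \<Rightarrow> (real^2 \<Rightarrow> real) \<Rightarrow> (real^2 \<Rightarrow> real^2) \<Rightarrow> (real^2 \<Rightarrow> real^2^2) \<Rightarrow> bool" where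
  "C2_up_to_boundary \<alpha> D \<psi> G H \<longleftrightarrow>
     continuous_on (closure D) \<psi> \<and> continuous_on (closure D) G \<and> continuous_on (closure D) H \<and>
     (\<forall>x\<in>D. GDERIV \<psi> x :> G x) \<and>
     (\<forall>x\<in>D. (G has_derivative (\<lambda>h. H x *v h)) (at x)) \<and>
     holder_on \<alpha> D H"

text \<open>The Laplacian of \<open>\<psi>\<close> is the trace of its Hessian matrix.\<close>

definition overdetermined_solution :: "real \<Rightarrow> real \<Rightarrow> real \<Rightarrow> (real^2 \<Rightarrow> real) \<Rightarrow> bool" where
  "overdetermined_solution lam \<alpha> \<gamma> \<eta> \<longleftrightarrow> admissible_perturbation lam \<alpha> \<eta> \<and>
     (\<exists>Q>0. \<exists>\<psi> G H. C2_up_to_boundary \<alpha> (Omega \<eta> - cball 0 lam) \<psi> G H \<and>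
        (\<forall>x \<in> Omega \<eta> - cball 0 lam. trace (H x) = \<gamma>) \<and>
        (\<forall>x \<in> frontier (Omega \<eta>). \<psi> x = 0) \<and>
        (\<forall>x \<in> frontier (ball 0 lam). \<psi> x = 1) \<and>
        (\<forall>x \<in> frontier (Omega \<eta>). (norm (G x))\<^sup>2 = Q))"

end

theory Submission
  imports Defs "HOL-Complex_Analysis.Complex_Analysis" "HOL-Real_Asymp.Real_Asymp"
begin

text \<open>Parametrise the domain by a conformal map \<open>f \<zeta> = \<zeta> exp (g \<zeta>)\<close> of the annulus \<open>lam < |\<zeta>| < 1\<close> (whose
  modulus can be kept fixed along the curve) with \<open>|f| = lam\<close> on the inner circle. The Dirichlet problem
  is then solved by a Fourier series, and \<open>|grad \<psi>|\<^sup>2 = Q\<close> becomes an equation on the circle for \<open>T = ln |f|\<close>: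
  with \<open>E = exp (2 T)\<close>, \<open>B\<close> the angular derivative of \<open>T\<close> and \<open>M\<close> the Dirichlet-to-Neumann multiplier
  divided by the derivative,
  \<open>(E + E M B - M (E B) - 1 + \<omega>)\<^sup>2 = \<mu> E ((1 + M B)\<^sup>2 - B\<^sup>2)\<close>
  with constants \<open>\<omega>\<close> and \<open>\<mu>\<close> equivalent to \<open>\<gamma>\<close> and \<open>Q\<close>. Only bounded operators occur, and the kernel of
  the linearisation at \<open>\<gamma>\<^sup>*\<close> is spanned by \<open>cos y\<close>. All unknowns are sought as power series in
  \<open>s e\<^sup>i\<^sup>y\<close> and \<open>s e\<^sup>-\<^sup>i\<^sup>y\<close> with absolutely summable coefficients, a Banach algebra in which multipliers
  act diagonally. One contraction there yields the curve together with its smoothness in \<open>s\<close> and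
  its analyticity in \<open>y\<close>; a second one inverts
  the angle \<open>y \<mapsto> arg f (e\<^sup>i\<^sup>y)\<close> and so writes the outer boundary as a graph over the unit circle.\<close>

section \<open>The algebra of absolutely convergent double power series\<close>

text \<open>A number depending on \<open>s\<close> but not on \<open>y\<close> is a diagonal series,
  since the product of the two variables is \<open>s\<close> squared. So \<open>\<omega>\<close> and
  \<open>\<mu>\<close> live in the same algebra as \<open>T\<close>. Put q = lam^2 and kappa_k = k
  (1 + q^k) / (1 - q^k). At wave number k the linearisation at constant \<open>\<omega>\<close>,
  with \<mu> = \<omega>^2, is 4 \<omega> - 2 \<omega>^2 (1 + kappa_k). It vanishes for k = 1 at
  \<omega> = 1 - q, which is the critical \<open>\<gamma>\<close> in disguise: the Dirichlet data
  give \<gamma> = 4 / (lam^2 - 2 (1 - \<omega>) ln lam - mean of \<open>E\<close>). For k at least 2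
  it is nonzero and grows linearly in k, so the inverse gains a derivative and both \<open>T\<close>
  and \<open>B\<close> are bounded functions of the unknown. At k = 1 its derivative in
  \<open>\<omega>\<close> is 4 - 4 (1 - q) (1 + kappa_1) = -4; this is the transversality condition.
  Wave number 0 is absorbed by \<open>\<mu>\<close>, and \<open>T\<close> is normalised to have no
  diagonal coefficients. The contraction takes its smallness from a fixed amplitude e in T = e (p +
  m + ...), where p and m are the two variables. It is solved once for the whole series, and
  \<open>s\<close> enters only by evaluation.\<close>

typedef dps = "{f :: nat \<times> nat \<Rightarrow> real. (\<lambda>i. \<bar>f i\<bar>) summable_on UNIV}"
  morphisms dcoeff Dps
  by (rule exI[of _ "\<lambda>_. 0"]) simp

lemma abs_summable_dcoeff [simp]: "(\<lambda>i. \<bar>dcoeff a i\<bar>) summable_on UNIV"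
  using dcoeff[of a] by simp

lemma dcoeff_Dps: "(\<lambda>i. \<bar>f i\<bar>) summable_on UNIV \<Longrightarrow> dcoeff (Dps f) = f"
  by (simp add: Dps_inverse)

lemma dps_eqI: "(\<And>i. dcoeff a i = dcoeff b i) \<Longrightarrow> a = b"
  by (metis dcoeff_inject ext)

lemma summable_on_dominated:
  fixes f :: "'a \<Rightarrow> 'b::banach" and g :: "'a \<Rightarrow> real"
  assumes "g summable_on A" "\<And>x. x \<in> A \<Longrightarrow> norm (f x) \<le> g x"
  shows "f summable_on A" "(\<lambda>x. norm (f x)) summable_on A"
    "norm (infsum f A) \<le> infsum g A"
proof -
  have n: "(\<lambda>x. norm (f x)) summable_on A"
    using Infinite_Sum.abs_summable_on_comparison_test'[OF assms] by simp
  show "(\<lambda>x. norm (f x)) summable_on A" by (rule n)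
  show s: "f summable_on A" using abs_summable_summable[OF n] .
  show "norm (infsum f A) \<le> infsum g A"
    by (rule norm_infsum_le[OF has_sum_infsum[OF s] has_sum_infsum[OF assms(1)] assms(2)])
qed

lemma infsum_diff:
  fixes f g :: "'a \<Rightarrow> 'b::{topological_ab_group_add,t2_space}"
  assumes "f summable_on A" "g summable_on A"
  shows "(\<lambda>x. f x - g x) summable_on A" "infsum (\<lambda>x. f x - g x) A = infsum f A - infsum g A"
  using infsum_add[OF assms(1), of "\<lambda>x. - g x"] summable_on_add[OF assms(1), of "\<lambda>x. - g x"] assms(2)
  by (simp_all add: infsum_uminus summable_on_uminus)

text \<open>Absolute convergence allows the pairs of indices to be regrouped by their sum, and the
  fibres of the sum are finite boxes. This Cauchy product in two variables serves both the norm of a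
  product and the multiplicativity of evaluation.\<close>

lemma has_sum_convolution:
  fixes F :: "(nat \<times> nat) \<times> (nat \<times> nat) \<Rightarrow> 'b::banach"
  assumes "(\<lambda>x. norm (F x)) summable_on UNIV"
  shows "((\<lambda>(m,n). \<Sum>i=0..m. \<Sum>j=0..n. F ((i,j),(m-i,n-j))) has_sum infsum F UNIV) UNIV"
proof -
  define fib where "fib = (\<lambda>(m,n). {0..m::nat} \<times> {0..n::nat})"
  define h where "h = (\<lambda>((m,n),(i,j)). ((i,j),(m-i::nat,n-j::nat)))"
  have bij: "bij_betw h (Sigma UNIV fib) UNIV"
    by (rule bij_betw_byWitness[where f' = "\<lambda>((i,j),(k,l)). ((i+k,j+l),(i,j))"])
       (auto simp: h_def fib_def)
  have "(F has_sum infsum F UNIV) UNIV"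
    using abs_summable_summable[OF assms] by simp
  then have "((\<lambda>x. F (h x)) has_sum infsum F UNIV) (Sigma UNIV fib)"
    using has_sum_reindex_bij_betw[OF bij, of F] by simp
  then have "((\<lambda>(c,p). F (h (c,p))) has_sum infsum F UNIV) (Sigma UNIV fib)"
    by (simp add: case_prod_unfold)
  then have "((\<lambda>c. \<Sum>p\<in>fib c. F (h (c,p))) has_sum infsum F UNIV) UNIV"
    by (rule has_sum_SigmaD) (auto simp: fib_def split: prod.splits intro!: has_sum_finiteI)
  moreover have "(\<Sum>p\<in>fib c. F (h (c,p))) = (\<lambda>(m,n). \<Sum>i=0..m. \<Sum>j=0..n. F ((i,j),(m-i,n-j))) c" for c
    by (auto simp: fib_def h_def sum.cartesian_product split: prod.splits intro!: sum.cong)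
  ultimately show ?thesis by simp
qed

lemma abs_summable_times_dcoeff:
  "(\<lambda>(i,j). \<bar>dcoeff a i\<bar> * \<bar>dcoeff b j\<bar>) summable_on UNIV"
  "(\<Sum>\<^sub>\<infinity>(i,j). \<bar>dcoeff a i\<bar> * \<bar>dcoeff b j\<bar>) = (\<Sum>\<^sub>\<infinity>i. \<bar>dcoeff a i\<bar>) * (\<Sum>\<^sub>\<infinity>j. \<bar>dcoeff b j\<bar>)"
proof -
  let ?f = "\<lambda>i. \<bar>dcoeff a i\<bar>" let ?g = "\<lambda>i. \<bar>dcoeff b i\<bar>"
  have "((\<lambda>(i,j). ?f i * ?g j) has_sum (infsum ?f UNIV * infsum ?g UNIV)) (Sigma UNIV (\<lambda>_. UNIV))"
  proof (rule has_sum_SigmaI)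
    show "((\<lambda>j. (case (i, j) of (i, j) \<Rightarrow> ?f i * ?g j)) has_sum (?f i * infsum ?g UNIV)) UNIV" for i
      by (auto intro!: has_sum_cmult_right)
    show "((\<lambda>i. ?f i * infsum ?g UNIV) has_sum infsum ?f UNIV * infsum ?g UNIV) UNIV"
      by (auto intro!: has_sum_cmult_left)
    show "(\<lambda>(i, j). ?f i * ?g j) summable_on UNIV \<times> UNIV"
    proof (rule summable_on_SigmaI)
      show "((\<lambda>j. (case (i, j) of (i, j) \<Rightarrow> ?f i * ?g j)) has_sum (?f i * infsum ?g UNIV)) UNIV" for i
        by (auto intro!: has_sum_cmult_right)
    qed (auto intro!: summable_on_cmult_left)
  qed
  then show "(\<lambda>(i,j). ?f i * ?g j) summable_on UNIV"
    "(\<Sum>\<^sub>\<infinity>(i,j). ?f i * ?g j) = infsum ?f UNIV * infsum ?g UNIV"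
    by (auto dest: has_sum_imp_summable infsumI)
qed

abbreviation fps2_nth :: "real fps fps \<Rightarrow> nat \<Rightarrow> nat \<Rightarrow> real" where
  "fps2_nth F m n \<equiv> fps_nth (fps_nth F m) n"

text \<open>An injective multiplicative embedding into formal power series over formal power series.
  The ring laws of \<open>dps\<close> are inherited through it, without any rearrangement of
  infinite sums.\<close>

definition fps_of_dps :: "dps \<Rightarrow> real fps fps" where
  "fps_of_dps a = Abs_fps (\<lambda>m. Abs_fps (\<lambda>n. dcoeff a (m,n)))"

lemma fps_of_dps_nth [simp]: "fps2_nth (fps_of_dps a) m n = dcoeff a (m,n)"
  by (simp add: fps_of_dps_def)

lemma fps_of_dps_inject: "fps_of_dps a = fps_of_dps b \<Longrightarrow> a = b"
  by (metis dps_eqI fps_of_dps_nth surj_pair)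

lemma fps2_mult_nth:
  "fps2_nth (F * G) m n = (\<Sum>i=0..m. \<Sum>j=0..n. fps2_nth F i j * fps2_nth G (m-i) (n-j))"
  by (simp add: fps_mult_nth fps_sum_nth)

instantiation dps :: comm_ring_1
begin

definition zero_dps where "0 = Dps (\<lambda>_. 0)"
definition one_dps where "1 = Dps (\<lambda>i. if i = (0,0) then 1 else 0)"
definition plus_dps where "a + b = Dps (\<lambda>i. dcoeff a i + dcoeff b i)"
definition uminus_dps where "- a = Dps (\<lambda>i. - dcoeff a i)"
definition minus_dps where "a - b = Dps (\<lambda>i. dcoeff a i - dcoeff b i)"
definition times_dps where "a * b = Dps (\<lambda>(m,n). fps2_nth (fps_of_dps a * fps_of_dps b) m n)"

lemma dcoeff_zero [simp]: "dcoeff 0 i = 0"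
  by (simp add: zero_dps_def dcoeff_Dps)

lemma dcoeff_one: "dcoeff 1 i = (if i = (0,0) then 1 else 0)"
proof -
  have "(\<lambda>i::nat\<times>nat. \<bar>if i = (0,0) then 1 else 0 :: real\<bar>) summable_on UNIV"
    by (rule finite_nonzero_values_imp_summable_on) simp
  then show ?thesis by (simp add: one_dps_def dcoeff_Dps)
qed

lemma dcoeff_add [simp]: "dcoeff (a + b) i = dcoeff a i + dcoeff b i"
proof -
  have "(\<lambda>i. \<bar>dcoeff a i + dcoeff b i\<bar>) summable_on UNIV"
    using summable_on_dominated(2)[OF summable_on_add[OF abs_summable_dcoeff[of a] abs_summable_dcoeff[of b]],
        of "\<lambda>i. dcoeff a i + dcoeff b i"] by (simp add: abs_triangle_ineq)
  then show ?thesis by (simp add: plus_dps_def dcoeff_Dps)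
qed

lemma dcoeff_uminus [simp]: "dcoeff (- a) i = - dcoeff a i"
  by (simp add: uminus_dps_def dcoeff_Dps)

lemma dcoeff_diff [simp]: "dcoeff (a - b) i = dcoeff a i - dcoeff b i"
proof -
  have "a - b = a + - b" by (simp add: minus_dps_def plus_dps_def)
  then show ?thesis by simp
qed

lemma times_dps_aux:
  "(\<lambda>(m,n). \<bar>fps2_nth (fps_of_dps a * fps_of_dps b) m n\<bar>) summable_on UNIV" (is ?S)
  "(\<Sum>\<^sub>\<infinity>(m,n). \<bar>fps2_nth (fps_of_dps a * fps_of_dps b) m n\<bar>)
     \<le> (\<Sum>\<^sub>\<infinity>i. \<bar>dcoeff a i\<bar>) * (\<Sum>\<^sub>\<infinity>j. \<bar>dcoeff b j\<bar>)" (is ?N)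
proof -
  let ?F = "\<lambda>(i,j). \<bar>dcoeff a i\<bar> * \<bar>dcoeff b j\<bar>"
  let ?c = "\<lambda>(m,n). \<Sum>i=0..m. \<Sum>j=0..n. ?F ((i,j),(m-i,n-j))"
  have "(\<lambda>x. norm (?F x)) summable_on UNIV"
    using abs_summable_times_dcoeff(1)[of a b] by (simp add: case_prod_unfold)
  from has_sum_convolution[OF this]
  have c: "(?c has_sum infsum ?F UNIV) UNIV" .
  have le: "norm \<bar>fps2_nth (fps_of_dps a * fps_of_dps b) (fst x) (snd x)\<bar> \<le> ?c x" for x
    unfolding fps2_mult_nth real_norm_def abs_idempotent case_prod_unfold fst_conv snd_conv
    by (rule order_trans[OF sum_abs sum_mono], rule order_trans[OF sum_abs sum_mono]) (simp add: abs_mult)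
  show ?S
    using summable_on_dominated(1)[OF has_sum_imp_summable[OF c] le] by (simp add: case_prod_unfold)
  show ?N
    using summable_on_dominated(3)[OF has_sum_imp_summable[OF c] le] infsumI[OF c]
      abs_summable_times_dcoeff(2)[of a b] abs_le_D1 by (fastforce simp: case_prod_unfold)
qed

lemma dcoeff_mult: "dcoeff (a * b) (m,n) = (\<Sum>i=0..m. \<Sum>j=0..n. dcoeff a (i,j) * dcoeff b (m-i,n-j))"
  using times_dps_aux(1)[of a b]
  by (simp add: times_dps_def dcoeff_Dps case_prod_unfold fps2_mult_nth)

lemma fps_of_dps_hom:
  "fps_of_dps (a * b) = fps_of_dps a * fps_of_dps b"
  "fps_of_dps (a + b) = fps_of_dps a + fps_of_dps b"
  "fps_of_dps 1 = 1" "fps_of_dps 0 = 0"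
  by (auto simp: fps_eq_iff fps2_mult_nth dcoeff_mult dcoeff_one)

instance
proof
  fix a b c :: dps
  show "a * b * c = a * (b * c)" "a * b = b * a" "1 * a = a" "(a + b) * c = a * c + b * c"
    by (rule fps_of_dps_inject, simp add: fps_of_dps_hom algebra_simps)+
  show "(0::dps) \<noteq> 1"
  proof
    assume "(0::dps) = 1"
    then have "dcoeff 0 (0,0) = dcoeff 1 (0,0)" by simp
    then show False by (simp add: dcoeff_one)
  qed
qed (rule dps_eqI, simp)+

end

instantiation dps :: real_normed_algebra_1
begin

definition scaleR_dps where "c *\<^sub>R a = Dps (\<lambda>i. c * dcoeff a i)"
definition norm_dps where "norm a = (\<Sum>\<^sub>\<infinity>i. \<bar>dcoeff a i\<bar>)"
definition dist_dps where "dist (a::dps) b = norm (a - b)"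
definition sgn_dps where "sgn (a::dps) = scaleR (inverse (norm a)) a"
definition uniformity_dps :: "(dps \<times> dps) filter" where
  "uniformity_dps = (INF e\<in>{0 <..}. principal {(x, y). dist x y < e})"
definition open_dps :: "dps set \<Rightarrow> bool" where
  "open_dps U \<longleftrightarrow> (\<forall>x\<in>U. eventually (\<lambda>(x', y). x' = x \<longrightarrow> y \<in> U) uniformity)"

lemma dcoeff_scaleR [simp]: "dcoeff (c *\<^sub>R a) i = c * dcoeff a i"
proof -
  have "(\<lambda>i. \<bar>c * dcoeff a i\<bar>) summable_on UNIV"
    unfolding abs_mult by (intro summable_on_cmult_right) simp
  then show ?thesis by (simp add: scaleR_dps_def dcoeff_Dps)
qed

lemma abs_dcoeff_le: "\<bar>dcoeff a i\<bar> \<le> norm a"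
proof -
  have "sum (\<lambda>i. \<bar>dcoeff a i\<bar>) {i} \<le> (\<Sum>\<^sub>\<infinity>i. \<bar>dcoeff a i\<bar>)"
    by (rule finite_sum_le_infsum) auto
  then show ?thesis by (simp add: norm_dps_def)
qed

lemma norm_dps_bound:
  assumes "g summable_on UNIV" "\<And>i. \<bar>dcoeff a i\<bar> \<le> g i"
  shows "norm a \<le> infsum g UNIV"
  unfolding norm_dps_def by (rule infsum_mono) (use assms in auto)

instance
proof
  fix a b :: dps and c d :: real
  show "norm a = 0 \<longleftrightarrow> a = 0"
  proof
    assume "norm a = 0"
    then have "\<bar>dcoeff a i\<bar> \<le> 0" for i using abs_dcoeff_le[of a i] by simp
    then show "a = 0" by (intro dps_eqI) simp
  qed (simp add: norm_dps_def)
  show "norm (a + b) \<le> norm a + norm b"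
  proof -
    have "norm (a + b) \<le> (\<Sum>\<^sub>\<infinity>i. \<bar>dcoeff a i\<bar> + \<bar>dcoeff b i\<bar>)"
      by (rule norm_dps_bound) (auto intro!: summable_on_add simp: abs_triangle_ineq)
    also have "\<dots> = norm a + norm b"
      unfolding norm_dps_def by (rule infsum_add) simp_all
    finally show ?thesis .
  qed
  show "norm (c *\<^sub>R a) = \<bar>c\<bar> * norm a"
    by (simp add: norm_dps_def abs_mult infsum_cmult_right')
  show "norm (a * b) \<le> norm a * norm b"
    using times_dps_aux(2)[of a b] times_dps_aux(1)[of a b]
    by (simp add: norm_dps_def times_dps_def dcoeff_Dps case_prod_unfold)
  show "norm (1::dps) = 1"
  proof -
    have "(\<Sum>\<^sub>\<infinity>i. \<bar>dcoeff 1 i\<bar>) = (\<Sum>\<^sub>\<infinity>i\<in>{(0,0)}. \<bar>dcoeff 1 i\<bar>)"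
      by (rule infsum_cong_neutral) (auto simp: dcoeff_one)
    then show ?thesis by (simp add: norm_dps_def dcoeff_one)
  qed
qed (simp_all add: dist_dps_def sgn_dps_def uniformity_dps_def open_dps_def,
     (rule dps_eqI, rename_tac i, case_tac i,
       simp add: dcoeff_mult sum_distrib_left mult.assoc mult.left_commute distrib_left distrib_right)+)

end


lemma bounded_linear_dcoeff: "bounded_linear (\<lambda>a. dcoeff a i)"
  by (rule bounded_linear_intro[where K=1]) (auto simp: abs_dcoeff_le)

lemma norm_dps_finite_bound:
  assumes "\<And>F. finite F \<Longrightarrow> (\<Sum>i\<in>F. \<bar>dcoeff a i\<bar>) \<le> C"
  shows "norm a \<le> C"
  unfolding norm_dps_def by (rule infsum_le_finite_sums) (use assms in auto)

lemma sum_abs_dcoeff_le: "finite F \<Longrightarrow> (\<Sum>i\<in>F. \<bar>dcoeff a i\<bar>) \<le> norm a"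
  unfolding norm_dps_def by (rule finite_sum_le_infsum) auto

instance dps :: banach
proof
  fix X :: "nat \<Rightarrow> dps"
  assume C: "Cauchy X"
  have "Cauchy (\<lambda>n. dcoeff (X n) i)" for i
    using bounded_linear.Cauchy[OF bounded_linear_dcoeff C] .
  then have "\<exists>l. (\<lambda>n. dcoeff (X n) i) \<longlonglongrightarrow> l" for i
    using Cauchy_convergent_iff convergent_def by blast
  then obtain f where f: "\<And>i. (\<lambda>n. dcoeff (X n) i) \<longlonglongrightarrow> f i" by metis
  \<comment> \<open>The bound is uniform in the finite set, so it survives the coefficientwise limit
    and then bounds the full norm.\<close>
  have bound: "\<exists>N. \<forall>n\<ge>N. \<forall>F. finite F \<longrightarrow> (\<Sum>i\<in>F. \<bar>dcoeff (X n) i - f i\<bar>) \<le> e" if "e > 0" for e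
  proof -
    obtain N where N: "\<And>m n. m \<ge> N \<Longrightarrow> n \<ge> N \<Longrightarrow> norm (X m - X n) < e"
      using CauchyD[OF C \<open>e > 0\<close>] by blast
    show ?thesis
    proof (intro exI allI impI)
      fix n F assume n: "n \<ge> N" and F: "finite (F :: (nat \<times> nat) set)"
      have "(\<lambda>m. \<Sum>i\<in>F. \<bar>dcoeff (X n) i - dcoeff (X m) i\<bar>) \<longlonglongrightarrow> (\<Sum>i\<in>F. \<bar>dcoeff (X n) i - f i\<bar>)"
        by (intro tendsto_sum tendsto_rabs tendsto_diff tendsto_const f)
      moreover have "(\<Sum>i\<in>F. \<bar>dcoeff (X n) i - dcoeff (X m) i\<bar>) \<le> e" if "m \<ge> N" for m
        using sum_abs_dcoeff_le[OF F, of "X n - X m"] N[OF n that] by simp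
      ultimately show "(\<Sum>i\<in>F. \<bar>dcoeff (X n) i - f i\<bar>) \<le> e"
        using LIMSEQ_le_const2 by blast
    qed
  qed
  obtain N where N: "\<And>F. finite F \<Longrightarrow> (\<Sum>i\<in>F. \<bar>dcoeff (X N) i - f i\<bar>) \<le> 1"
    using bound[of 1] by auto
  have "(\<lambda>i. \<bar>f i\<bar>) summable_on UNIV"
  proof (rule nonneg_bdd_above_summable_on)
    show "bdd_above (sum (\<lambda>i. \<bar>f i\<bar>) ` {F. F \<subseteq> UNIV \<and> finite F})"
    proof (rule bdd_aboveI2)
      fix F assume "F \<in> {F :: (nat \<times> nat) set. F \<subseteq> UNIV \<and> finite F}"
      then have F: "finite F" by simp
      have "(\<Sum>i\<in>F. \<bar>f i\<bar>) \<le> (\<Sum>i\<in>F. \<bar>dcoeff (X N) i - f i\<bar> + \<bar>dcoeff (X N) i\<bar>)"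
        by (rule sum_mono) linarith
      also have "\<dots> \<le> 1 + norm (X N)"
        using N[OF F] sum_abs_dcoeff_le[OF F, of "X N"] by (simp add: sum.distrib)
      finally show "(\<Sum>i\<in>F. \<bar>f i\<bar>) \<le> 1 + norm (X N)" .
    qed
  qed simp
  then have cf: "dcoeff (Dps f) = f" by (rule dcoeff_Dps)
  have "X \<longlonglongrightarrow> Dps f"
  proof (rule LIMSEQ_I)
    fix r :: real assume "r > 0"
    then obtain N where N: "\<And>n F. n \<ge> N \<Longrightarrow> finite F \<Longrightarrow> (\<Sum>i\<in>F. \<bar>dcoeff (X n) i - f i\<bar>) \<le> r / 2"
      using bound[of "r/2"] by auto
    have "norm (X n - Dps f) \<le> r / 2" if "n \<ge> N" for n
      by (rule norm_dps_finite_bound) (use N[OF that] in \<open>simp add: cf del: le_divide_eq_numeral1\<close>)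
    then show "\<exists>no. \<forall>n\<ge>no. norm (X n - Dps f) < r"
      using \<open>r > 0\<close> by (intro exI[of _ N]) (force intro: le_less_trans)
  qed
  then show "convergent X" by (auto simp: convergent_def)
qed

section \<open>Operators on double power series\<close>

lemma power_mult_le_one:
  fixes P M :: "'b::{real_normed_algebra_1}"
  assumes "norm P \<le> 1" "norm M \<le> 1"
  shows "norm (P ^ m * M ^ n) \<le> 1"
proof -
  have "norm (P ^ m * M ^ n) \<le> norm P ^ m * norm M ^ n"
    by (rule order_trans[OF norm_mult_ineq]) (auto intro!: mult_mono norm_power_ineq)
  also have "\<dots> \<le> 1 * 1"
    by (intro mult_mono power_le_one) (use assms in auto)
  finally show ?thesis by simp
qed

text \<open>The arguments range over any commutative Banach algebra. Complex arguments give
  functions on the circle, real ones give constants depending on the parameter, and arguments in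
  \<open>dps\<close> give composition of series.\<close>

definition ev :: "'b::{real_normed_algebra_1,banach,comm_ring_1} \<Rightarrow> 'b \<Rightarrow> dps \<Rightarrow> 'b" where
  "ev P M a = (\<Sum>\<^sub>\<infinity>i. dcoeff a i *\<^sub>R (P ^ fst i * M ^ snd i))"

context
  fixes P M :: "'b::{real_normed_algebra_1,banach,comm_ring_1}"
  assumes PM: "norm P \<le> 1" "norm M \<le> 1"
begin

lemma ev_norm_term: "norm (dcoeff a i *\<^sub>R (P ^ fst i * M ^ snd i)) \<le> \<bar>dcoeff a i\<bar>"
  using mult_left_mono[OF power_mult_le_one[OF PM], of "\<bar>dcoeff a i\<bar>"] by simp

lemma summable_ev: "(\<lambda>i. dcoeff a i *\<^sub>R (P ^ fst i * M ^ snd i)) summable_on UNIV"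
  by (rule summable_on_dominated(1)[OF abs_summable_dcoeff[of a] ev_norm_term])

lemma norm_ev_le: "norm (ev P M a) \<le> norm a"
  unfolding ev_def norm_dps_def
  by (rule summable_on_dominated(3)[OF abs_summable_dcoeff[of a] ev_norm_term])

lemma bounded_linear_ev: "bounded_linear (ev P M)"
proof (rule bounded_linear_intro[where K=1])
  show "ev P M (a + b) = ev P M a + ev P M b" for a b
    unfolding ev_def by (simp add: scaleR_add_left infsum_add summable_ev)
  show "ev P M (c *\<^sub>R a) = c *\<^sub>R ev P M a" for c a
    unfolding ev_def by (simp add: infsum_scaleR_right flip: scaleR_scaleR)
qed (simp add: norm_ev_le)

lemma ev_one [simp]: "ev P M 1 = 1"
proof -
  have "ev P M 1 = (\<Sum>\<^sub>\<infinity>i\<in>{(0,0)}. dcoeff 1 i *\<^sub>R (P ^ fst i * M ^ snd i))"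
    unfolding ev_def by (rule infsum_cong_neutral) (auto simp: dcoeff_one)
  then show ?thesis by (simp add: dcoeff_one)
qed

text \<open>Both sides are regroupings of a single absolutely summable family indexed by pairs of
  indices.\<close>

lemma ev_mult: "ev P M (a * b) = ev P M a * ev P M b"
proof -
  define c where "c = (\<lambda>i. P ^ fst i * M ^ snd i)"
  define F where "F = (\<lambda>(i,j). (dcoeff a i *\<^sub>R c i) * (dcoeff b j *\<^sub>R c j))"
  have bF: "norm (F x) \<le> (\<lambda>(i,j). \<bar>dcoeff a i\<bar> * \<bar>dcoeff b j\<bar>) x" for x
    unfolding F_def c_def case_prod_unfold
    by (rule order_trans[OF norm_mult_ineq]) (intro mult_mono ev_norm_term, auto)
  note F = summable_on_dominated[OF abs_summable_times_dcoeff(1) bF]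
  have "infsum F UNIV = (\<Sum>\<^sub>\<infinity>i. \<Sum>\<^sub>\<infinity>j. F (i,j))"
    using infsum_Sigma_banach[of F UNIV "\<lambda>_. UNIV"] F(1) by simp
  also have "\<dots> = (\<Sum>\<^sub>\<infinity>i. (dcoeff a i *\<^sub>R c i) * ev P M b)"
    unfolding F_def ev_def c_def case_prod_conv
    by (intro infsum_cong infsum_cmult_right) (rule summable_ev)
  also have "\<dots> = ev P M a * ev P M b"
    unfolding ev_def c_def by (intro infsum_cmult_left) (rule summable_ev)
  finally have 1: "infsum F UNIV = ev P M a * ev P M b" .
  have "(\<Sum>i=0..m. \<Sum>j=0..n. F ((i,j),(m-i,n-j))) = dcoeff (a * b) (m,n) *\<^sub>R c (m,n)" for m n
  proof -
    have "c (i,j) * c (m-i,n-j) = c (m,n)" if "i \<le> m" "j \<le> n" for i j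
    proof -
      have "c (i,j) * c (m-i,n-j) = (P ^ i * P ^ (m-i)) * (M ^ j * M ^ (n-j))"
        by (simp add: c_def algebra_simps)
      also have "\<dots> = c (m,n)" using that by (simp add: c_def flip: power_add)
      finally show ?thesis .
    qed
    then show ?thesis
      by (auto simp: F_def dcoeff_mult scaleR_sum_left intro!: sum.cong)
  qed
  then have "((\<lambda>(m,n). dcoeff (a * b) (m,n) *\<^sub>R c (m,n)) has_sum infsum F UNIV) UNIV"
    using has_sum_convolution[OF F(2)] by simp
  then have "ev P M (a * b) = infsum F UNIV"
    unfolding ev_def c_def by (intro infsumI) (simp add: case_prod_unfold)
  with 1 show ?thesis by simp
qed

end

text \<open>A bounded unital homomorphism acts term by term on the exponential series. It is applied
  to evaluations and to the swap of the two variables.\<close>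

lemma exp_hom:
  fixes h :: "'a::{real_normed_algebra_1,banach} \<Rightarrow> 'b::{real_normed_algebra_1,banach}"
  assumes h: "bounded_linear h" and m: "\<And>a b. h (a * b) = h a * h b" and 1: "h 1 = 1"
  shows "h (exp x) = exp (h x)"
proof -
  have p: "h (x ^ n) = h x ^ n" for n by (induction n) (auto simp: m 1)
  have "(\<lambda>n. h (x ^ n /\<^sub>R fact n)) sums h (exp x)"
    by (rule bounded_linear.sums[OF h exp_converges])
  then have "(\<lambda>n. h x ^ n /\<^sub>R fact n) sums h (exp x)"
    by (simp add: p linear_simps(5)[OF h])
  then show ?thesis using exp_converges sums_unique2 by blast
qed

lemma ev_exp:
  fixes P M :: "'b::{real_normed_algebra_1,banach,comm_ring_1}"
  assumes "norm P \<le> 1" "norm M \<le> 1"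
  shows "ev P M (exp a) = exp (ev P M a)"
  by (rule exp_hom[OF bounded_linear_ev ev_mult ev_one]) (use assms in auto)

text \<open>On the ball of radius 1/2 the m-th power has Lipschitz constant at most m (1/2)^(m-1),
  hence at most 1. No factor m appears, and the unweighted norm of \<open>a\<close>
  suffices.\<close>

lemma ev_Lipschitz:
  fixes P M :: "'b::{real_normed_algebra_1,banach,comm_ring_1}"
  assumes "norm P \<le> 1/2" "norm M \<le> 1/2" "norm P' \<le> 1/2" "norm M' \<le> 1/2"
  shows "norm (ev P M a - ev P' M' a) \<le> norm a * (norm (P - P') + norm (M - M'))"
proof -
  let ?L = "norm (P - P') + norm (M - M')"
  have pd: "norm (x ^ m - y ^ m) \<le> norm (x - y)" if "norm x \<le> 1/2" "norm y \<le> 1/2" for x y :: 'b and m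
  proof (induction m)
    case (Suc m)
    show ?case
    proof (cases m)
      case (Suc k)
      have "x ^ Suc m - y ^ Suc m = x * (x ^ m - y ^ m) + (x - y) * y ^ m"
        by (simp add: algebra_simps)
      also have "norm \<dots> \<le> norm x * norm (x ^ m - y ^ m) + norm (x - y) * norm (y ^ m)"
        by (rule order_trans[OF norm_triangle_ineq]) (intro add_mono norm_mult_ineq)
      also have "norm (y ^ m) \<le> 1/2"
      proof -
        have "norm (y ^ m) \<le> norm y ^ m" by (rule norm_power_ineq)
        also have "\<dots> = norm y * norm y ^ k" using Suc by simp
        also have "\<dots> \<le> 1/2 * 1" by (intro mult_mono power_le_one) (use that in auto)
        finally show ?thesis by simp
      qed
      then have "norm x * norm (x ^ m - y ^ m) + norm (x - y) * norm (y ^ m)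
          \<le> 1/2 * norm (x - y) + norm (x - y) * (1/2)"
        by (intro add_mono mult_mono Suc.IH) (use that in auto)
      finally show ?thesis by simp
    qed simp
  qed simp
  have le1: "norm (x ^ m) \<le> 1" if "norm x \<le> 1/2" for x :: 'b and m
    using order_trans[OF norm_power_ineq power_le_one[OF norm_ge_zero]] that by force
  have "norm (dcoeff a i *\<^sub>R (P ^ fst i * M ^ snd i) - dcoeff a i *\<^sub>R (P' ^ fst i * M' ^ snd i)) \<le> \<bar>dcoeff a i\<bar> * ?L" for i
  proof -
    obtain m n where i: "i = (m,n)" by force
    have "norm (P ^ m * M ^ n - P' ^ m * M' ^ n) = norm ((P ^ m - P' ^ m) * M ^ n + P' ^ m * (M ^ n - M' ^ n))"
      by (simp add: algebra_simps)
    also have "\<dots> \<le> norm (P ^ m - P' ^ m) * norm (M ^ n) + norm (P' ^ m) * norm (M ^ n - M' ^ n)"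
      by (rule order_trans[OF norm_triangle_ineq]) (intro add_mono norm_mult_ineq)
    also have "\<dots> \<le> norm (P - P') * 1 + 1 * norm (M - M')"
      by (intro add_mono mult_mono pd le1 assms) auto
    finally have "norm (P ^ m * M ^ n - P' ^ m * M' ^ n) \<le> ?L" by simp
    from mult_left_mono[OF this, of "\<bar>dcoeff a i\<bar>"] show ?thesis
      by (simp add: i flip: scaleR_diff_right)
  qed
  note d = summable_on_dominated(3)[OF summable_on_cmult_left[OF abs_summable_dcoeff[of a]] this]
  have "ev P M a - ev P' M' a = (\<Sum>\<^sub>\<infinity>i. dcoeff a i *\<^sub>R (P ^ fst i * M ^ snd i) - dcoeff a i *\<^sub>R (P' ^ fst i * M' ^ snd i))"
    unfolding ev_def by (rule infsum_diff(2)[symmetric]; rule summable_ev) (use assms in auto)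
  also have "norm \<dots> \<le> norm a * ?L"
    using d by (simp add: norm_dps_def infsum_cmult_left)
  finally show ?thesis .
qed

lemma ev_zero_zero: "ev (0::'b::{real_normed_algebra_1,banach,comm_ring_1}) 0 a = of_real (dcoeff a (0,0))"
proof -
  have "ev (0::'b) 0 a = (\<Sum>\<^sub>\<infinity>i\<in>{(0,0)}. dcoeff a i *\<^sub>R (0 ^ fst i * 0 ^ snd i))"
    unfolding ev_def by (rule infsum_cong_neutral) (auto simp: power_0_left split: if_splits)
  then show ?thesis by (simp add: of_real_def)
qed

subsection \<open>The exponential remainder\<close>

text \<open>The entire function (exp x - 1 - x) / x^2, as a series because x need not be invertible.
  It exposes the quadratic part of the exponential as a factor from which the amplitude can be
  divided out.\<close>

definition exp_rem :: "'a::{real_normed_algebra_1,banach} \<Rightarrow> 'a" where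
  "exp_rem x = (\<Sum>n. x ^ n /\<^sub>R fact (n + 2))"

lemma summable_inverse_fact: "summable (\<lambda>n. inverse (fact n) :: real)"
  using summable_exp[of "1::real"] by simp

lemma inverse_fact_le: "inverse (fact (n + k) :: real) \<le> inverse (fact n)"
  by (intro le_imp_inverse_le fact_mono) auto

lemma summable_exp_rem:
  fixes x :: "'a::{real_normed_algebra_1,banach}"
  shows "summable (\<lambda>n. x ^ n /\<^sub>R fact (n + 2))"
proof (rule summable_comparison_test')
  show "summable (\<lambda>n. norm x ^ n /\<^sub>R fact n)" using summable_exp_generic[of "norm x"] .
  show "norm (x ^ n /\<^sub>R fact (n + 2)) \<le> norm x ^ n /\<^sub>R fact n" for n
    using mult_mono[OF inverse_fact_le[of n 2] norm_power_ineq[of x n]] by simp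
qed

lemma exp_conv_exp_rem:
  fixes x :: "'a::{real_normed_algebra_1,banach}"
  shows "exp x = 1 + x + x ^ 2 * exp_rem x"
proof -
  have "exp x = (\<Sum>n. x ^ (n + 2) /\<^sub>R fact (n + 2)) + (\<Sum>n<2. x ^ n /\<^sub>R fact n)"
    unfolding exp_def by (rule suminf_split_initial_segment[OF summable_exp_generic])
  also have "(\<lambda>n. x ^ (n + 2) /\<^sub>R fact (n + 2)) = (\<lambda>n. x ^ 2 * (x ^ n /\<^sub>R fact (n + 2)))"
    by (simp only: power_add mult_scaleR_right power_commutes[symmetric] add.commute[of _ 2])
  also have "suminf \<dots> = x ^ 2 * exp_rem x"
    unfolding exp_rem_def by (rule suminf_mult[OF summable_exp_rem])
  finally show ?thesis by (simp add: numeral_2_eq_2 algebra_simps)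
qed

lemma power_diff_le_one:
  fixes x y :: "'a::{real_normed_algebra_1}"
  assumes "norm x \<le> 1" "norm y \<le> 1"
  shows "norm (x ^ n - y ^ n) \<le> real n * norm (x - y)"
proof (induction n)
  case (Suc n)
  have "x ^ Suc n - y ^ Suc n = x * (x ^ n - y ^ n) + (x - y) * y ^ n"
    by (simp add: algebra_simps)
  also have "norm \<dots> \<le> norm x * norm (x ^ n - y ^ n) + norm (x - y) * norm (y ^ n)"
    by (rule order_trans[OF norm_triangle_ineq]) (intro add_mono norm_mult_ineq)
  also have "\<dots> \<le> 1 * (real n * norm (x - y)) + norm (x - y) * 1"
    by (intro add_mono mult_mono Suc.IH)
       (use assms order_trans[OF norm_power_ineq power_le_one[OF norm_ge_zero]] in auto)
  finally show ?case by (simp add: algebra_simps)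
qed simp

lemma real_div_fact_le: "real n * inverse (fact (n + 2)) \<le> inverse (fact n)"
proof -
  have "real n * fact n \<le> fact (Suc n)" by (simp add: algebra_simps)
  also have "\<dots> \<le> fact (n + 2)" by (intro fact_mono) simp
  finally show ?thesis
    by (simp add: divide_simps del: fact_Suc add_2_eq_Suc')
qed

lemma exp_rem_bounds:
  fixes x y :: "'a::{real_normed_algebra_1,banach}"
  assumes "norm x \<le> 1" "norm y \<le> 1"
  shows "norm (exp_rem x) \<le> exp 1" "norm (exp_rem x - exp_rem y) \<le> exp 1 * norm (x - y)"
proof -
  have e: "exp (1::real) = (\<Sum>n. inverse (fact n))" by (simp add: exp_def)
  show "norm (exp_rem x) \<le> exp 1"
    unfolding exp_rem_def e
  proof (rule norm_suminf_le[OF _ summable_inverse_fact])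
    fix n
    have "norm (x ^ n) \<le> 1"
      using order_trans[OF norm_power_ineq power_le_one[OF norm_ge_zero]] assms by auto
    with inverse_fact_le[of n 2] show "norm (x ^ n /\<^sub>R fact (n + 2)) \<le> inverse (fact n)"
      using mult_mono[of "inverse (fact (n + 2))" "inverse (fact n)" "norm (x ^ n)" 1] by simp
  qed
  have "exp_rem x - exp_rem y = (\<Sum>n. x ^ n /\<^sub>R fact (n + 2) - y ^ n /\<^sub>R fact (n + 2))"
    unfolding exp_rem_def by (rule suminf_diff[OF summable_exp_rem summable_exp_rem])
  also have "norm \<dots> \<le> (\<Sum>n. inverse (fact n) * norm (x - y))"
  proof (rule norm_suminf_le[OF _ summable_mult2[OF summable_inverse_fact]])
    fix n
    have "norm (x ^ n /\<^sub>R fact (n + 2) - y ^ n /\<^sub>R fact (n + 2)) = inverse (fact (n + 2)) * norm (x ^ n - y ^ n)"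
      by (simp flip: scaleR_diff_right)
    also have "\<dots> \<le> inverse (fact (n + 2)) * (real n * norm (x - y))"
      by (intro mult_left_mono power_diff_le_one assms) auto
    also have "\<dots> \<le> inverse (fact n) * norm (x - y)"
      using mult_right_mono[OF real_div_fact_le[of n], of "norm (x - y)"] by (simp add: algebra_simps)
    finally show "norm (x ^ n /\<^sub>R fact (n + 2) - y ^ n /\<^sub>R fact (n + 2)) \<le> inverse (fact n) * norm (x - y)" .
  qed
  also have "\<dots> = exp 1 * norm (x - y)"
    unfolding e by (rule suminf_mult2[OF summable_inverse_fact, symmetric])
  finally show "norm (exp_rem x - exp_rem y) \<le> exp 1 * norm (x - y)" .
qed

subsection \<open>Coefficient operators\<close>

text \<open>A factor depending only on m - n is a Fourier multiplier in the angle, acting on all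
  powers of \<open>s\<close> at once.\<close>

definition dmul :: "(nat \<times> nat \<Rightarrow> real) \<Rightarrow> dps \<Rightarrow> dps" where
  "dmul \<phi> a = Dps (\<lambda>i. \<phi> i * dcoeff a i)"

lemma
  assumes "\<And>i. \<bar>\<phi> i\<bar> \<le> C"
  shows dcoeff_dmul: "dcoeff (dmul \<phi> a) i = \<phi> i * dcoeff a i"
    and bounded_linear_dmul: "bounded_linear (dmul \<phi>)"
proof -
  have s: "(\<lambda>i. C * \<bar>dcoeff a i\<bar>) summable_on UNIV" for a
    by (intro summable_on_cmult_right) simp
  have le: "norm \<bar>\<phi> i * dcoeff a i\<bar> \<le> C * \<bar>dcoeff a i\<bar>" for i a
    using mult_right_mono[OF assms[of i], of "\<bar>dcoeff a i\<bar>"] by (simp add: abs_mult)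
  have c: "dcoeff (dmul \<phi> a) i = \<phi> i * dcoeff a i" for i a
    unfolding dmul_def by (subst dcoeff_Dps[OF summable_on_dominated(1)[OF s le]]) simp
  then show "dcoeff (dmul \<phi> a) i = \<phi> i * dcoeff a i" .
  show "bounded_linear (dmul \<phi>)"
  proof (rule bounded_linear_intro[where K=C])
    show "norm (dmul \<phi> a) \<le> norm a * C" for a
      using norm_dps_bound[OF s[of a], of "dmul \<phi> a"] le[of _ a]
      by (simp add: c norm_dps_def infsum_cmult_right mult.commute)
  qed (rule dps_eqI, simp add: c algebra_simps)+
qed

lemma summable_on_reindex_inj:
  assumes "inj f"
  shows "(\<lambda>i. \<bar>dcoeff a (f i)\<bar>) summable_on UNIV" "(\<Sum>\<^sub>\<infinity>i. \<bar>dcoeff a (f i)\<bar>) \<le> norm a"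
proof -
  have s: "(\<lambda>i. \<bar>dcoeff a i\<bar>) summable_on range f"
    by (rule summable_on_subset_banach[OF abs_summable_dcoeff]) simp
  show "(\<lambda>i. \<bar>dcoeff a (f i)\<bar>) summable_on UNIV"
    using s summable_on_reindex[OF assms, of "\<lambda>i. \<bar>dcoeff a i\<bar>"] by (simp add: o_def)
  have "(\<Sum>\<^sub>\<infinity>i. \<bar>dcoeff a (f i)\<bar>) = infsum (\<lambda>i. \<bar>dcoeff a i\<bar>) (range f)"
    using infsum_reindex[OF assms, of "\<lambda>i. \<bar>dcoeff a i\<bar>"] by (simp add: o_def)
  also have "\<dots> \<le> norm a"
    unfolding norm_dps_def by (rule infsum_mono2) (use s in auto)
  finally show "(\<Sum>\<^sub>\<infinity>i. \<bar>dcoeff a (f i)\<bar>) \<le> norm a" .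
qed

definition dreindex :: "(nat \<times> nat \<Rightarrow> nat \<times> nat) \<Rightarrow> dps \<Rightarrow> dps" where
  "dreindex f a = Dps (\<lambda>i. dcoeff a (f i))"

lemma
  assumes "inj f"
  shows dcoeff_dreindex: "dcoeff (dreindex f a) i = dcoeff a (f i)"
    and bounded_linear_dreindex: "bounded_linear (dreindex f)"
proof -
  have c: "dcoeff (dreindex f a) i = dcoeff a (f i)" for a i
    unfolding dreindex_def by (subst dcoeff_Dps[OF summable_on_reindex_inj(1)[OF assms]]) simp
  then show "dcoeff (dreindex f a) i = dcoeff a (f i)" .
  show "bounded_linear (dreindex f)"
  proof (rule bounded_linear_intro[where K=1])
    show "norm (dreindex f a) \<le> norm a * 1" for a
      using summable_on_reindex_inj(2)[OF assms, of a] by (simp add: c norm_dps_def)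
  qed (rule dps_eqI, simp add: c)+
qed

text \<open>Reflection of the angle. Since coefficients are real, it is also complex conjugation
  when the second argument of an evaluation is the conjugate of the first: invariant series are then
  real valued, antisymmetric ones imaginary.\<close>

definition dswap :: "dps \<Rightarrow> dps" where "dswap = dreindex prod.swap"

lemma dcoeff_dswap [simp]: "dcoeff (dswap a) (m,n) = dcoeff a (n,m)"
  unfolding dswap_def by (simp add: dcoeff_dreindex)

lemma bounded_linear_dswap: "bounded_linear dswap"
  unfolding dswap_def by (rule bounded_linear_dreindex) simp

lemma dps_eqI2: "(\<And>m n. dcoeff a (m,n) = dcoeff b (m,n)) \<Longrightarrow> a = b"
  by (rule dps_eqI) force

lemma dswap_mult: "dswap (a * b) = dswap a * dswap b"
  by (rule dps_eqI2) (simp add: dcoeff_mult, rule sum.swap)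

lemma dswap_one [simp]: "dswap 1 = 1"
  by (rule dps_eqI2) (simp add: dcoeff_one)

lemma dswap_exp: "dswap (exp a) = exp (dswap a)"
  by (rule exp_hom[OF bounded_linear_dswap dswap_mult dswap_one])

lemma dswap_simps [simp]:
  "dswap (a + b) = dswap a + dswap b" "dswap (a - b) = dswap a - dswap b" "dswap (- a) = - dswap a"
  "dswap (c *\<^sub>R a) = c *\<^sub>R dswap a" "dswap 0 = 0"
  by (rule dps_eqI2, simp)+

subsection \<open>The angular derivative\<close>

text \<open>The coefficient with index \<open>(m,n)\<close> is that of \<open>s\<^sup>m\<^sup>+\<^sup>n e\<^sup>i\<^sup>(\<^sup>m\<^sup>-\<^sup>n\<^sup>)\<^sup>y\<close>. As the derivation is unbounded, it is
  treated as a relation.\<close>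

definition has_angular_deriv :: "dps \<Rightarrow> dps \<Rightarrow> bool" where
  "has_angular_deriv a a' \<longleftrightarrow> (\<forall>m n. dcoeff a' (m,n) = (real m - real n) * dcoeff a (m,n))"

lemma has_angular_deriv_mult:
  assumes "has_angular_deriv a a'" "has_angular_deriv b b'"
  shows "has_angular_deriv (a * b) (a' * b + a * b')"
  unfolding has_angular_deriv_def
proof (intro allI)
  fix m n
  have "dcoeff (a' * b + a * b') (m, n) = (\<Sum>i=0..m. \<Sum>j=0..n.
      ((real i - real j) + (real (m - i) - real (n - j))) * (dcoeff a (i,j) * dcoeff b (m-i,n-j)))"
  proof -
    have d: "dcoeff a' (i,j) = (real i - real j) * dcoeff a (i,j)" 
      "dcoeff b' (i,j) = (real i - real j) * dcoeff b (i,j)" for i j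
      using assms by (auto simp: has_angular_deriv_def)
    show ?thesis
      unfolding dcoeff_add dcoeff_mult sum.distrib[symmetric] d by (simp only: algebra_simps)
  qed
  also have "\<dots> = (\<Sum>i=0..m. \<Sum>j=0..n. (real m - real n) * (dcoeff a (i,j) * dcoeff b (m-i,n-j)))"
    by (intro sum.cong refl) (simp add: of_nat_diff)
  also have "\<dots> = (real m - real n) * dcoeff (a * b) (m, n)"
    by (simp add: dcoeff_mult sum_distrib_left)
  finally show "dcoeff (a' * b + a * b') (m, n) = (real m - real n) * dcoeff (a * b) (m, n)" .
qed

lemma has_angular_deriv_power:
  assumes "has_angular_deriv a a'"
  shows "has_angular_deriv (a ^ Suc n) (of_nat (Suc n) * a ^ n * a')"
proof (induction n)
  case (Suc n)
  from has_angular_deriv_mult[OF assms Suc] show ?case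
    by (simp add: algebra_simps)
qed (use assms in simp)

text \<open>The chain rule is checked one coefficient at a time. A coefficient is a bounded
  functional, so the power rule may be summed over the exponential series although the derivation
  itself is unbounded.\<close>

lemma has_angular_deriv_exp:
  assumes "has_angular_deriv a a'"
  shows "has_angular_deriv (exp a) (exp a * a')"
  unfolding has_angular_deriv_def
proof (intro allI)
  fix m n
  let ?k = "real m - real n"
  note bl = bounded_linear_dcoeff[of "(m,n)"]
  have k1: "?k * dcoeff 1 (m,n) = 0" by (simp add: dcoeff_one)
  have step: "dcoeff ((a ^ j /\<^sub>R fact j) * a') (m,n) = ?k * dcoeff (a ^ Suc j /\<^sub>R fact (Suc j)) (m,n)" for j
  proof -
    have "?k * dcoeff (a ^ Suc j) (m,n) = dcoeff (of_nat (Suc j) * a ^ j * a') (m,n)"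
      using has_angular_deriv_power[OF assms, of j] by (simp add: has_angular_deriv_def)
    also have "of_nat (Suc j) * a ^ j * a' = real (Suc j) *\<^sub>R (a ^ j * a')"
      by (simp add: scaleR_conv_of_real mult.assoc)
    finally have fin: "?k * dcoeff (a ^ Suc j) (m,n) = real (Suc j) * dcoeff (a ^ j * a') (m,n)"
      by simp
    have i: "inverse (fact j) = inverse (fact (Suc j)) * real (Suc j)"
      by (simp add: inverse_mult_distrib del: of_nat_Suc)
    have "dcoeff ((a ^ j /\<^sub>R fact j) * a') (m,n) = inverse (fact j) * dcoeff (a ^ j * a') (m,n)"
      by simp
    also have "\<dots> = inverse (fact (Suc j)) * (?k * dcoeff (a ^ Suc j) (m,n))"
      unfolding i fin by (simp only: mult.assoc)
    also have "\<dots> = ?k * dcoeff (a ^ Suc j /\<^sub>R fact (Suc j)) (m,n)"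
      unfolding dcoeff_scaleR by (simp only: mult.left_commute)
    finally show ?thesis .
  qed
  have "(\<lambda>j. dcoeff ((a ^ j /\<^sub>R fact j) * a') (m,n)) sums dcoeff (exp a * a') (m,n)"
    by (intro bounded_linear.sums[OF bl] sums_mult2 exp_converges)
  moreover have "(\<lambda>j. ?k * dcoeff (a ^ Suc j /\<^sub>R fact (Suc j)) (m,n)) sums (?k * dcoeff (exp a) (m,n))"
  proof -
    have "(\<lambda>j. ?k * dcoeff (a ^ j /\<^sub>R fact j) (m,n)) sums (?k * dcoeff (exp a) (m,n))"
      by (intro sums_mult bounded_linear.sums[OF bl] exp_converges)
    from sums_split_initial_segment[OF this, of 1] k1 show ?thesis by simp
  qed
  ultimately show "dcoeff (exp a * a') (m,n) = ?k * dcoeff (exp a) (m,n)"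
    unfolding step using sums_unique2 by blast
qed

section \<open>A contraction principle\<close>

text \<open>One radius bounds both the parameter and the unknown. Quantifying it by a filter lets
  finitely many such bounds be combined on a common ball that is never named.\<close>

definition near_bound :: "(real \<Rightarrow> 'a::real_normed_vector \<Rightarrow> 'b::real_normed_vector) \<Rightarrow> real \<Rightarrow> bool" where
  "near_bound f C \<longleftrightarrow> (\<forall>\<^sub>F r in at_right 0. \<forall>e X. \<bar>e\<bar> \<le> r \<longrightarrow> norm X \<le> r \<longrightarrow> norm (f e X) \<le> C)"

definition near_lip :: "(real \<Rightarrow> 'a::real_normed_vector \<Rightarrow> 'b::real_normed_vector) \<Rightarrow> real \<Rightarrow> bool" where
  "near_lip f C \<longleftrightarrow> (\<forall>\<^sub>F r in at_right 0. \<forall>e X Y. \<bar>e\<bar> \<le> r \<longrightarrow> norm X \<le> r \<longrightarrow> norm Y \<le> r \<longrightarrow>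
     norm (f e X - f e Y) \<le> C * norm (X - Y))"

text \<open>Three grades of behaviour near (0, 0): \<open>loc_lip\<close> is bounded and Lipschitz,
  \<open>loc_null\<close> moreover tends to 0, and \<open>loc_small\<close> has a Lipschitz constant
  tending to 0 as well. Null times null, small times Lipschitz and parameter times Lipschitz are
  small, so contraction can be read off the shape of an expression.\<close>

definition loc_lip :: "(real \<Rightarrow> 'a::real_normed_vector \<Rightarrow> 'b::real_normed_vector) \<Rightarrow> bool" where
  "loc_lip f \<longleftrightarrow> (\<exists>C\<ge>0. near_bound f C \<and> near_lip f C)"

definition loc_null :: "(real \<Rightarrow> 'a::real_normed_vector \<Rightarrow> 'b::real_normed_vector) \<Rightarrow> bool" where
  "loc_null f \<longleftrightarrow> loc_lip f \<and> (\<forall>\<eta>>0. near_bound f \<eta>)"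

definition loc_small :: "(real \<Rightarrow> 'a::real_normed_vector \<Rightarrow> 'b::real_normed_vector) \<Rightarrow> bool" where
  "loc_small f \<longleftrightarrow> (\<forall>\<eta>>0. near_bound f \<eta> \<and> near_lip f \<eta>)"

lemma near_bound_mono: "near_bound f C \<Longrightarrow> C \<le> D \<Longrightarrow> near_bound f D"
  unfolding near_bound_def by (elim eventually_mono) (meson order_trans)

lemma near_lip_mono: "near_lip f C \<Longrightarrow> C \<le> D \<Longrightarrow> near_lip f D"
  unfolding near_lip_def
  by (elim eventually_mono) (meson order_trans mult_right_mono norm_ge_zero)

lemma loc_small_imp_null: "loc_small f \<Longrightarrow> loc_null f"
  unfolding loc_small_def loc_null_def loc_lip_def by (auto intro!: exI[of _ "1::real"])

lemma loc_null_imp_lip: "loc_null f \<Longrightarrow> loc_lip f"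
  by (simp add: loc_null_def)

lemma loc_small_imp_lip: "loc_small f \<Longrightarrow> loc_lip f"
  by (simp add: loc_small_imp_null loc_null_imp_lip)

lemma near_add:
  assumes "near_bound f C" "near_bound g D" shows "near_bound (\<lambda>e X. f e X + g e X) (C + D)"
  using assms unfolding near_bound_def
  by eventually_elim (meson norm_triangle_mono)

lemma near_lip_add:
  assumes "near_lip f C" "near_lip g D" shows "near_lip (\<lambda>e X. f e X + g e X) (C + D)"
  using assms unfolding near_lip_def
proof eventually_elim
  case (elim r)
  show ?case
  proof (intro allI impI)
    fix e and X Y :: 'a assume "\<bar>e\<bar> \<le> r" "norm X \<le> r" "norm (Y::'a) \<le> r"
    then have "norm ((f e X - f e Y) + (g e X - g e Y)) \<le> C * norm (X - Y) + D * norm (X - Y)"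
      using elim by (intro norm_triangle_mono) auto
    then show "norm (f e X + g e X - (f e Y + g e Y)) \<le> (C + D) * norm (X - Y)"
      by (simp add: algebra_simps)
  qed
qed

lemma near_linear:
  assumes L: "bounded_linear L" and K: "\<And>x. norm (L x) \<le> norm x * K" "K > 0"
  shows "near_bound f C \<Longrightarrow> near_bound (\<lambda>e X. L (f e X)) (K * C)"
    and "near_lip f C \<Longrightarrow> near_lip (\<lambda>e X. L (f e X)) (K * C)"
proof -
  have le: "norm (L x) \<le> K * c" if "norm x \<le> c" for x c
    using K(1)[of x] mult_left_mono[OF that less_imp_le[OF K(2)]] by (simp add: mult.commute)
  show "near_bound (\<lambda>e X. L (f e X)) (K * C)" if "near_bound f C"
    using that unfolding near_bound_def by eventually_elim (simp add: le)
  show "near_lip (\<lambda>e X. L (f e X)) (K * C)" if "near_lip f C"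
    using that unfolding near_lip_def
    by eventually_elim (simp add: le mult.assoc flip: linear_diff[OF bounded_linear.linear[OF L]])
qed

lemma near_mult:
  fixes f g :: "real \<Rightarrow> 'a::real_normed_vector \<Rightarrow> 'b::real_normed_algebra"
  assumes "near_bound f C" "near_bound g D"
  shows "near_bound (\<lambda>e X. f e X * g e X) (C * D)"
  using assms unfolding near_bound_def
proof eventually_elim
  case (elim r)
  show ?case
  proof (intro allI impI)
    fix e and X :: 'a assume "\<bar>e\<bar> \<le> r" "norm (X::'a) \<le> r"
    then have "norm (f e X) * norm (g e X) \<le> C * D"
      using elim by (intro mult_mono') auto
    then show "norm (f e X * g e X) \<le> C * D"
      by (rule order_trans[OF norm_mult_ineq])
  qed
qed

lemma near_lip_mult:
  fixes f g :: "real \<Rightarrow> 'a::real_normed_vector \<Rightarrow> 'b::real_normed_algebra"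
  assumes "near_bound f C" "near_bound g D" "near_lip f C'" "near_lip g D'"
  shows "near_lip (\<lambda>e X. f e X * g e X) (C' * D + C * D')"
  using assms unfolding near_bound_def near_lip_def
proof eventually_elim
  case (elim r)
  show ?case
  proof (intro allI impI)
    fix e and X Y :: 'a assume *: "\<bar>e\<bar> \<le> r" "norm X \<le> r" "norm (Y::'a) \<le> r"
    have "f e X * g e X - f e Y * g e Y = (f e X - f e Y) * g e X + f e Y * (g e X - g e Y)"
      by (simp add: algebra_simps)
    also have "norm \<dots> \<le> norm (f e X - f e Y) * norm (g e X) + norm (f e Y) * norm (g e X - g e Y)"
      by (intro norm_triangle_mono norm_mult_ineq)
    also have "\<dots> \<le> (C' * norm (X - Y)) * D + C * (D' * norm (X - Y))"
      using elim * by (intro add_mono mult_mono') auto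
    finally show "norm (f e X * g e X - f e Y * g e Y) \<le> (C' * D + C * D') * norm (X - Y)"
      by (simp add: algebra_simps)
  qed
qed

lemma loc_lip_add: "loc_lip f \<Longrightarrow> loc_lip g \<Longrightarrow> loc_lip (\<lambda>e X. f e X + g e X)"
proof -
  assume "loc_lip f" "loc_lip g"
  then obtain C D where "C \<ge> 0" "near_bound f C" "near_lip f C" "D \<ge> 0" "near_bound g D" "near_lip g D"
    by (auto simp: loc_lip_def)
  then show ?thesis
    unfolding loc_lip_def by (intro exI[of _ "C + D"]) (simp add: near_add near_lip_add)
qed

lemma loc_small_add: 
  assumes "loc_small f" "loc_small g" shows "loc_small (\<lambda>e X. f e X + g e X)"
  unfolding loc_small_def
proof (intro allI impI)
  fix \<eta> :: real assume "\<eta> > 0"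
  then have "near_bound f (\<eta>/2)" "near_lip f (\<eta>/2)" "near_bound g (\<eta>/2)" "near_lip g (\<eta>/2)"
    using assms by (auto simp: loc_small_def)
  from near_add[OF this(1,3)] near_lip_add[OF this(2,4)]
  show "near_bound (\<lambda>e X. f e X + g e X) \<eta> \<and> near_lip (\<lambda>e X. f e X + g e X) \<eta>" by simp
qed

lemma loc_lip_linear: "bounded_linear L \<Longrightarrow> loc_lip f \<Longrightarrow> loc_lip (\<lambda>e X. L (f e X))"
proof -
  assume L: "bounded_linear L" and "loc_lip f"
  then obtain C where C: "C \<ge> 0" "near_bound f C" "near_lip f C" by (auto simp: loc_lip_def)
  obtain K where K0: "K > 0" "\<And>x. norm (L x) \<le> norm x * K"
    using bounded_linear.pos_bounded[OF L] by blast
  note K = K0(1) near_linear[OF L K0(2,1), of f]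
  show ?thesis
    unfolding loc_lip_def using K C by (intro exI[of _ "K * C"]) auto
qed

lemma loc_null_linear:
  assumes "bounded_linear L" "loc_null f" shows "loc_null (\<lambda>e X. L (f e X))"
  unfolding loc_null_def
proof (intro conjI allI impI)
  show "loc_lip (\<lambda>e X. L (f e X))" using assms loc_lip_linear loc_null_imp_lip by blast
  fix \<eta> :: real assume "\<eta> > 0"
  obtain K where K0: "K > 0" "\<And>x. norm (L x) \<le> norm x * K"
    using bounded_linear.pos_bounded[OF assms(1)] by blast
  note K = K0(1) near_linear[OF assms(1) K0(2,1), of f]
  show "near_bound (\<lambda>e X. L (f e X)) \<eta>"
    using K(2)[of "\<eta>/K"] K(1) \<open>\<eta> > 0\<close> assms(2) by (auto simp: loc_null_def)
qed

lemma loc_lip_uminus: "loc_lip f \<Longrightarrow> loc_lip (\<lambda>e X. - f e X)"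
  and loc_small_uminus: "loc_small f \<Longrightarrow> loc_small (\<lambda>e X. - f e X)"
  by (auto simp: loc_lip_def loc_small_def near_bound_def near_lip_def norm_minus_commute)

lemma loc_lip_diff: "loc_lip f \<Longrightarrow> loc_lip g \<Longrightarrow> loc_lip (\<lambda>e X. f e X - g e X)"
  and loc_small_diff: "loc_small f \<Longrightarrow> loc_small g \<Longrightarrow> loc_small (\<lambda>e X. f e X - g e X)"
  using loc_lip_add[OF _ loc_lip_uminus, of f g] loc_small_add[OF _ loc_small_uminus, of f g] by auto

lemma loc_lip_const: "loc_lip (\<lambda>e X. c)"
  unfolding loc_lip_def near_bound_def near_lip_def
  by (intro exI[of _ "norm c"]) auto

lemma loc_null_ident: "loc_null (\<lambda>e X. X)"
  unfolding loc_null_def loc_lip_def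
proof (intro conjI allI impI exI[of _ "1::real"])
  show nb: "near_bound (\<lambda>e X::'a. X) \<eta>" if "\<eta> > 0" for \<eta>
    unfolding near_bound_def using eventually_at_right_less[of 0]
      eventually_at_right[of 0 1 "\<lambda>r. r \<le> \<eta>"] that
    by (auto intro!: eventually_mono[OF eventually_at_right_real[OF that]])
  show "near_bound (\<lambda>e X::'a. X) 1" by (rule nb) simp
qed (auto simp: near_lip_def)

lemma loc_lip_mult:
  fixes f g :: "real \<Rightarrow> 'a::real_normed_vector \<Rightarrow> 'b::real_normed_algebra"
  assumes "loc_lip f" "loc_lip g" shows "loc_lip (\<lambda>e X. f e X * g e X)"
proof -
  obtain C D where C: "C \<ge> 0" "near_bound f C" "near_lip f C" and D: "D \<ge> 0" "near_bound g D" "near_lip g D"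
    using assms by (auto simp: loc_lip_def)
  have "near_bound (\<lambda>e X. f e X * g e X) (C * D + C * D)"
    by (rule near_bound_mono[OF near_mult[OF C(2) D(2)]]) (use C D in simp)
  moreover have "near_lip (\<lambda>e X. f e X * g e X) (C * D + C * D)"
    by (rule near_lip_mult[OF C(2) D(2) C(3) D(3)])
  ultimately show ?thesis
    unfolding loc_lip_def using C D by (intro exI[of _ "C * D + C * D"]) auto
qed

text \<open>By the product rule each of the two terms in the Lipschitz estimate keeps one
  undifferentiated factor, and that factor tends to 0.\<close>

lemma loc_small_mult_null:
  fixes f g :: "real \<Rightarrow> 'a::real_normed_vector \<Rightarrow> 'b::real_normed_algebra"
  assumes "loc_null f" "loc_null g" shows "loc_small (\<lambda>e X. f e X * g e X)"
proof -
  obtain C D where C: "C \<ge> 0" "near_bound f C" "near_lip f C" and D: "D \<ge> 0" "near_bound g D" "near_lip g D"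
    using assms by (auto simp: loc_lip_def loc_null_def)
  show ?thesis
    unfolding loc_small_def
  proof (intro allI impI)
    fix \<eta> :: real assume \<eta>: "\<eta> > 0"
    define \<delta> where "\<delta> = \<eta> / (C + D + 1)"
    have \<delta>: "\<delta> > 0" using \<eta> C D by (simp add: \<delta>_def)
    have e: "\<delta> * (C + D + 1) = \<eta>" using C D by (simp add: \<delta>_def)
    have f: "near_bound f \<delta>" and g: "near_bound g \<delta>" using assms \<delta> by (auto simp: loc_null_def)
    have "\<delta> * D \<le> \<eta>" unfolding e[symmetric] using \<delta> C by (intro mult_left_mono) auto
    then have "near_bound (\<lambda>e X. f e X * g e X) \<eta>"
      by (rule near_bound_mono[OF near_mult[OF f D(2)]])
    moreover have "C * \<delta> + \<delta> * D \<le> \<eta>" unfolding e[symmetric] using \<delta> by (simp add: algebra_simps)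
    then have "near_lip (\<lambda>e X. f e X * g e X) \<eta>"
      by (rule near_lip_mono[OF near_lip_mult[OF f g C(3) D(3)]])
    ultimately show "near_bound (\<lambda>e X. f e X * g e X) \<eta> \<and> near_lip (\<lambda>e X. f e X * g e X) \<eta>" ..
  qed
qed

lemma loc_small_mult_lip:
  fixes f g :: "real \<Rightarrow> 'a::real_normed_vector \<Rightarrow> 'b::real_normed_algebra"
  assumes "loc_small f" "loc_lip g" shows "loc_small (\<lambda>e X. f e X * g e X)"
proof -
  obtain D where D: "D \<ge> 0" "near_bound g D" "near_lip g D"
    using assms by (auto simp: loc_lip_def)
  show ?thesis
    unfolding loc_small_def
  proof (intro allI impI)
    fix \<eta> :: real assume \<eta>: "\<eta> > 0"
    define \<delta> where "\<delta> = \<eta> / (D + D + 1)"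
    have \<delta>: "\<delta> > 0" using \<eta> D by (simp add: \<delta>_def)
    have e: "\<delta> * (D + D + 1) = \<eta>" using D by (simp add: \<delta>_def)
    have f: "near_bound f \<delta>" "near_lip f \<delta>" using assms \<delta> by (auto simp: loc_small_def)
    have "\<delta> * D \<le> \<eta>" unfolding e[symmetric] using \<delta> D by (intro mult_left_mono) auto
    then have "near_bound (\<lambda>e X. f e X * g e X) \<eta>"
      by (rule near_bound_mono[OF near_mult[OF f(1) D(2)]])
    moreover have "\<delta> * D + \<delta> * D \<le> \<eta>" unfolding e[symmetric] using \<delta> by (simp add: algebra_simps)
    then have "near_lip (\<lambda>e X. f e X * g e X) \<eta>"
      by (rule near_lip_mono[OF near_lip_mult[OF f(1) D(2) f(2) D(3)]])
    ultimately show "near_bound (\<lambda>e X. f e X * g e X) \<eta> \<and> near_lip (\<lambda>e X. f e X * g e X) \<eta>" ..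
  qed
qed

lemma loc_small_param:
  assumes "loc_lip f" shows "loc_small (\<lambda>e X. e *\<^sub>R f e X)"
proof -
  obtain D where D: "D \<ge> 0" "near_bound f D" "near_lip f D"
    using assms by (auto simp: loc_lip_def)
  show ?thesis
    unfolding loc_small_def
  proof (intro allI impI)
    fix \<eta> :: real assume \<eta>: "\<eta> > 0"
    define \<delta> where "\<delta> = \<eta> / (D + 1)"
    have \<delta>: "\<delta> > 0" using \<eta> D by (simp add: \<delta>_def)
    have "\<delta> * (D + 1) = \<eta>" using D by (simp add: \<delta>_def)
    then have e: "\<delta> * D \<le> \<eta>" using \<delta> by (simp add: algebra_simps)
    have r: "\<forall>\<^sub>F r in at_right 0. r < \<delta>"
      using eventually_at_right_real[OF \<delta>] by eventually_elim simp
    have "near_bound (\<lambda>e X. e *\<^sub>R f e X) \<eta>"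
      using D(2) r unfolding near_bound_def
    proof eventually_elim
      case (elim r)
      show ?case
      proof (intro allI impI)
        fix e and X :: 'a assume *: "\<bar>e\<bar> \<le> r" "norm (X::'a) \<le> r"
        then have "norm (e *\<^sub>R f e X) \<le> \<delta> * D"
          using elim \<delta> unfolding norm_scaleR by (intro mult_mono) auto
        with e show "norm (e *\<^sub>R f e X) \<le> \<eta>" by simp
      qed
    qed
    moreover have "near_lip (\<lambda>e X. e *\<^sub>R f e X) \<eta>"
      using D(3) r unfolding near_lip_def
    proof eventually_elim
      case (elim r)
      show ?case
      proof (intro allI impI)
        fix e and X Y :: 'a assume *: "\<bar>e\<bar> \<le> r" "norm X \<le> r" "norm (Y::'a) \<le> r"
        then have "norm (e *\<^sub>R (f e X - f e Y)) \<le> \<delta> * (D * norm (X - Y))"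
          using elim \<delta> unfolding norm_scaleR by (intro mult_mono) auto
        also have "\<dots> \<le> \<eta> * norm (X - Y)"
          using mult_right_mono[OF e, of "norm (X - Y)"] by (simp add: mult.assoc)
        finally show "norm (e *\<^sub>R f e X - e *\<^sub>R f e Y) \<le> \<eta> * norm (X - Y)"
          by (simp add: scaleR_diff_right)
      qed
    qed
    ultimately show "near_bound (\<lambda>e X. e *\<^sub>R f e X) \<eta> \<and> near_lip (\<lambda>e X. e *\<^sub>R f e X) \<eta>" ..
  qed
qed

lemma loc_lip_param: "loc_lip f \<Longrightarrow> loc_lip (\<lambda>e X. e *\<^sub>R f e X)"
  by (rule loc_small_imp_lip, erule loc_small_param)

lemma loc_lip_exp_rem:
  fixes f :: "real \<Rightarrow> 'a::real_normed_vector \<Rightarrow> 'b::{real_normed_algebra_1,banach}"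
  assumes "loc_null f" shows "loc_lip (\<lambda>e X. exp_rem (f e X))"
proof -
  obtain D where D: "D \<ge> 0" "near_bound f D" "near_lip f D"
    using assms by (auto simp: loc_lip_def loc_null_def)
  have 1: "near_bound f 1" using assms by (auto simp: loc_null_def)
  define C where "C = exp 1 * (D + 1)"
  have C: "exp 1 \<le> C" "exp 1 * D \<le> C" using D(1) by (auto simp: C_def algebra_simps)
  have "near_bound (\<lambda>e X. exp_rem (f e X)) C"
    using 1 unfolding near_bound_def
    by eventually_elim (meson order_trans[OF exp_rem_bounds(1) C(1)])
  moreover have "near_lip (\<lambda>e X. exp_rem (f e X)) C"
    using 1 D(3) unfolding near_lip_def near_bound_def
  proof eventually_elim
    case (elim r)
    show ?case
    proof (intro allI impI)
      fix e and X Y :: 'a assume *: "\<bar>e\<bar> \<le> r" "norm X \<le> r" "norm (Y::'a) \<le> r"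
      have "norm (exp_rem (f e X) - exp_rem (f e Y)) \<le> exp 1 * norm (f e X - f e Y)"
        by (rule exp_rem_bounds(2)) (use elim * in auto)
      also have "\<dots> \<le> exp 1 * (D * norm (X - Y))"
        using elim * by (intro mult_left_mono) auto
      also have "\<dots> \<le> C * norm (X - Y)"
        using mult_right_mono[OF C(2), of "norm (X - Y)"] by (simp add: mult.assoc)
      finally show "norm (exp_rem (f e X) - exp_rem (f e Y)) \<le> C * norm (X - Y)" .
    qed
  qed
  moreover have "C \<ge> 0" using D(1) by (simp add: C_def)
  ultimately show ?thesis unfolding loc_lip_def by blast
qed

text \<open>The radius \<open>r\<close> on which the map contracts is fixed first. Only then is the
  parameter made so small that the image of 0 has norm at most \<open>r / 2\<close>, which makes the
  ball invariant. The closed set \<open>S\<close> carries side conditions over to the fixed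
  point.\<close>

lemma loc_small_fixed_point:
  fixes \<Phi> :: "real \<Rightarrow> 'a::banach \<Rightarrow> 'a"
  assumes small: "loc_small \<Phi>" and S: "closed S" "0 \<in> S" and inv: "\<And>e X. X \<in> S \<Longrightarrow> \<Phi> e X \<in> S"
    and \<delta>: "\<delta> > 0"
  obtains e X where "0 < e" "e \<le> \<delta>" "norm X \<le> \<delta>" "X \<in> S" "\<Phi> e X = X"
proof -
  have "near_lip \<Phi> (1/2)" using small by (simp add: loc_small_def)
  from eventually_happens'[OF _ eventually_conj[OF this[unfolded near_lip_def] eventually_at_right_real[OF \<delta>]]]
  obtain r where r: "r > 0" "r \<le> \<delta>" "\<And>e X Y. \<bar>e\<bar> \<le> r \<Longrightarrow> norm X \<le> r \<Longrightarrow> norm Y \<le> r \<Longrightarrow>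
      norm (\<Phi> e X - \<Phi> e Y) \<le> 1/2 * norm (X - Y)" by auto
  have "near_bound \<Phi> (r/2)" using small r(1) by (simp add: loc_small_def)
  from eventually_happens'[OF _ eventually_conj[OF this[unfolded near_bound_def] eventually_at_right_less]]
  obtain r' where r': "r' > 0" "\<And>e X. \<bar>e\<bar> \<le> r' \<Longrightarrow> norm X \<le> r' \<Longrightarrow> norm (\<Phi> e X) \<le> r/2" by auto
  define e where "e = min r r'"
  have e: "e > 0" "\<bar>e\<bar> \<le> r" "\<bar>e\<bar> \<le> r'" "e \<le> \<delta>" using r r' by (auto simp: e_def)
  have "\<exists>!X\<in>S \<inter> cball 0 r. \<Phi> e X = X"
  proof (rule Banach_fix[where c = "1/2"])
    show "complete (S \<inter> cball 0 r)" using S by (simp add: complete_eq_closed closed_Int)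
    show "S \<inter> cball 0 r \<noteq> {}" using S(2) r(1) by auto
    show "\<Phi> e ` (S \<inter> cball 0 r) \<subseteq> S \<inter> cball 0 r"
    proof
      fix Y assume "Y \<in> \<Phi> e ` (S \<inter> cball 0 r)"
      then obtain X where X: "X \<in> S" "norm X \<le> r" "Y = \<Phi> e X" by auto
      have "norm (\<Phi> e X) \<le> norm (\<Phi> e X - \<Phi> e 0) + norm (\<Phi> e 0)"
        using norm_triangle_ineq[of "\<Phi> e X - \<Phi> e 0" "\<Phi> e 0"] by simp
      also have "\<dots> \<le> 1/2 * norm (X - 0) + r/2"
        by (intro add_mono r(3) r'(2)) (use X e r(1) r'(1) in auto)
      also have "\<dots> \<le> r" using X(2) by simp
      finally show "Y \<in> S \<inter> cball 0 r" using X inv by simp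
    qed
    show "dist (\<Phi> e X) (\<Phi> e Y) \<le> 1/2 * dist X Y" if "X \<in> S \<inter> cball 0 r" "Y \<in> S \<inter> cball 0 r" for X Y
      using r(3)[OF e(2), of X Y] that by (simp add: dist_norm)
  qed auto
  then obtain X where "X \<in> S" "norm X \<le> r" "\<Phi> e X = X" by auto
  then show thesis using e(1,4) r(2) that[of e X] by auto
qed

lemma loc_lip_exp:
  fixes f :: "real \<Rightarrow> 'a::real_normed_vector \<Rightarrow> 'b::{real_normed_algebra_1,banach}"
  assumes "loc_null f" shows "loc_lip (\<lambda>e X. exp (f e X))"
  unfolding exp_conv_exp_rem power2_eq_square
  by (intro loc_lip_add loc_lip_mult loc_lip_const loc_lip_exp_rem assms loc_null_imp_lip[OF assms])

text \<open>Without a constant term the value at (0, 0) is 0, and \<open>ev_Lipschitz\<close> makes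
  both the bound and the Lipschitz constant linear in those of \<open>P\<close> and
  \<open>M\<close>.\<close>

lemma loc_small_ev:
  fixes P M :: "real \<Rightarrow> 'a::real_normed_vector \<Rightarrow> 'b::{real_normed_algebra_1,banach,comm_ring_1}"
  assumes P: "loc_small P" and M: "loc_small M" and h: "dcoeff h (0,0) = 0"
  shows "loc_small (\<lambda>e X. ev (P e X) (M e X) h)"
  unfolding loc_small_def
proof (intro allI impI)
  fix \<eta> :: real assume \<eta>: "\<eta> > 0"
  define \<delta> where "\<delta> = \<eta> / (2 * (norm h + 1))"
  have d0: "norm h + 1 > 0" by (simp add: add_nonneg_pos)
  have \<delta>: "\<delta> > 0" using \<eta> d0 by (simp add: \<delta>_def)
  have "\<delta> * (2 * (norm h + 1)) = \<eta>" unfolding \<delta>_def using d0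
    by (intro nonzero_eq_divide_eq[THEN iffD1] refl) simp
  then have le: "norm h * (\<delta> + \<delta>) \<le> \<eta>" using \<delta> by (simp add: algebra_simps)
  have b: "near_bound P (min \<delta> (1/2))" "near_bound M (min \<delta> (1/2))" "near_lip P \<delta>" "near_lip M \<delta>"
    using P M \<delta> by (auto simp: loc_small_def)
  have "near_bound (\<lambda>e X. ev (P e X) (M e X) h) \<eta>"
    using b(1,2) unfolding near_bound_def
  proof eventually_elim
    case (elim r)
    show ?case
    proof (intro allI impI)
      fix e and X :: 'a assume "\<bar>e\<bar> \<le> r" "norm X \<le> r"
      then have *: "norm (P e X) \<le> min \<delta> (1/2)" "norm (M e X) \<le> min \<delta> (1/2)" using elim by auto
      have "norm (ev (P e X) (M e X) h - ev 0 0 h) \<le> norm h * (norm (P e X - 0) + norm (M e X - 0))"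
        by (rule ev_Lipschitz) (use * in auto)
      also have "\<dots> \<le> norm h * (\<delta> + \<delta>)" using * by (intro mult_left_mono add_mono) auto
      finally show "norm (ev (P e X) (M e X) h) \<le> \<eta>" using le by (simp add: ev_zero_zero h)
    qed
  qed
  moreover have "near_lip (\<lambda>e X. ev (P e X) (M e X) h) \<eta>"
    using b unfolding near_bound_def near_lip_def
  proof eventually_elim
    case (elim r)
    show ?case
    proof (intro allI impI)
      fix e and X Y :: 'a assume *: "\<bar>e\<bar> \<le> r" "norm X \<le> r" "norm Y \<le> r"
      have "norm (ev (P e X) (M e X) h - ev (P e Y) (M e Y) h)
          \<le> norm h * (norm (P e X - P e Y) + norm (M e X - M e Y))"
        by (rule ev_Lipschitz) (use * elim in auto)
      also have "\<dots> \<le> norm h * (\<delta> * norm (X - Y) + \<delta> * norm (X - Y))"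
        using * elim by (intro mult_left_mono add_mono) auto
      also have "\<dots> \<le> \<eta> * norm (X - Y)"
        using mult_right_mono[OF le, of "norm (X - Y)"] by (simp add: algebra_simps)
      finally show "norm (ev (P e X) (M e X) h - ev (P e Y) (M e Y) h) \<le> \<eta> * norm (X - Y)" .
    qed
  qed
  ultimately show "near_bound (\<lambda>e X. ev (P e X) (M e X) h) \<eta> \<and> near_lip (\<lambda>e X. ev (P e X) (M e X) h) \<eta>" ..
qed

section \<open>The boundary equation\<close>

definition angfreq :: "nat \<times> nat \<Rightarrow> real" where "angfreq i = real (fst i) - real (snd i)"

definition wavenum :: "nat \<times> nat \<Rightarrow> nat" where "wavenum i = nat \<bar>int (fst i) - int (snd i)\<bar>"

lemma abs_angfreq: "\<bar>angfreq i\<bar> = real (wavenum i)"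
  by (simp add: angfreq_def wavenum_def)

lemma wavenum_simps [simp]: "wavenum (m, m) = 0" "wavenum (Suc m, m) = 1" "wavenum (m, Suc m) = 1"
  by (auto simp: wavenum_def)

text \<open>The radial factor r^k - q^k r^(-k) vanishes at r^2 = q, and its derivative at r = 1 is
  this multiple of its value there: the Dirichlet-to-Neumann symbol of the annulus.\<close>

definition kappa :: "real \<Rightarrow> nat \<Rightarrow> real" where "kappa q k = real k * (1 + q ^ k) / (1 - q ^ k)"

lemma kappa_ge:
  assumes "0 \<le> q" "q < 1" shows "real k \<le> kappa q k"
proof (cases "k = 0")
  case False
  then have "q ^ k < 1" using assms by (simp add: power_less_one_iff)
  moreover have "0 \<le> q ^ k" using assms by simp
  ultimately show ?thesis
    by (simp add: kappa_def field_simps)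
qed (simp add: kappa_def)

text \<open>After cancelling 1 - q the claim reads (1 + q) (1 + q + ... + q^(k-1)) < k (1 + q^k).
  Pairing q^i with q^(k-i) proves it, because 1 + q^k exceeds their sum by (1 - q^i) (1 - q^(k-i)),
  which is positive at i = 1.\<close>

lemma kappa_gt:
  assumes q: "0 < q" "q < 1" and k: "2 \<le> k" shows "kappa q 1 < kappa q k"
proof -
  define S where "S = (\<Sum>i<k. q ^ i)"
  have "S > 0" unfolding S_def
    by (rule sum_pos) (use q k lessThan_iff[of 0 k] in \<open>auto simp del: lessThan_iff\<close>)
  have qk: "1 - q ^ k = (1 - q) * S" unfolding S_def by (rule one_diff_power_eq)
  have "q * S = (\<Sum>i<k. q ^ Suc i)" unfolding S_def by (simp add: sum_distrib_left)
  also have "\<dots> = (\<Sum>i<k. q ^ (k - i))"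
    by (subst sum.nat_diff_reindex[symmetric]) (auto intro!: sum.cong simp: Suc_diff_Suc)
  finally have "(1 + q) * S = (\<Sum>i<k. q ^ i + q ^ (k - i))"
    by (simp add: S_def sum.distrib algebra_simps)
  also have "\<dots> < (\<Sum>i<k. 1 + q ^ k)"
  proof (rule sum_strict_mono_ex1)
    have e: "(1 + q ^ k) - (q ^ i + q ^ (k - i)) = (1 - q ^ i) * (1 - q ^ (k - i))" if "i < k" for i
      using that by (simp add: algebra_simps flip: power_add)
    show "\<forall>i\<in>{..<k}. q ^ i + q ^ (k - i) \<le> 1 + q ^ k"
    proof
      fix i assume "i \<in> {..<k}"
      then have "0 \<le> (1 + q ^ k) - (q ^ i + q ^ (k - i))"
        using q by (subst e) (auto intro!: mult_nonneg_nonneg power_le_one)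
      then show "q ^ i + q ^ (k - i) \<le> 1 + q ^ k" by simp
    qed
    have "0 < (1 - q ^ 1) * (1 - q ^ (k - 1))"
      using q k by (intro mult_pos_pos) (auto simp: power_less_one_iff)
    then have "q ^ 1 + q ^ (k - 1) < 1 + q ^ k"
      using e[of 1] k by simp
    then show "\<exists>i\<in>{..<k}. q ^ i + q ^ (k - i) < 1 + q ^ k"
      using k by (intro bexI[of _ 1]) auto
  qed simp
  finally have "(1 + q) * S < real k * (1 + q ^ k)" by simp
  then have "(1 + q) / (1 - q) * ((1 - q) * S) < real k * (1 + q ^ k)" using q by simp
  then show ?thesis
    unfolding kappa_def qk using q \<open>S > 0\<close> by (subst pos_less_divide_eq) auto
qed

text \<open>Beyond \<open>K\<close> the bound kappa_k >= k leaves a gap of at least k / 2. The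
  finitely many remaining gaps are positive, so a minimum of slopes works.\<close>

lemma kappa_gap:
  assumes q: "0 < q" "q < 1"
  obtains c where "c > 0" "\<And>k. 2 \<le> k \<Longrightarrow> c * real k \<le> kappa q k - kappa q 1"
proof -
  obtain K where K: "2 * kappa q 1 < real K" using reals_Archimedean2 by blast
  define f where "f = (\<lambda>k. (kappa q k - kappa q 1) / real k)"
  define c where "c = Min (insert (1/2) (f ` {2..K}))"
  have "c > 0"
    unfolding c_def using kappa_gt[OF q] by (subst Min_gr_iff) (auto simp: f_def intro!: divide_pos_pos)
  moreover have "c * real k \<le> kappa q k - kappa q 1" if k: "2 \<le> k" for k
  proof (cases "k \<le> K")
    case True
    then have "c \<le> f k" using k unfolding c_def by (intro Min_le) auto
    then show ?thesis using k by (simp add: f_def field_simps)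
  next
    case False
    have "c \<le> 1/2" unfolding c_def by (intro Min_le) auto
    then have "c * real k \<le> 1/2 * real k" by (intro mult_right_mono) auto
    also have "\<dots> \<le> real k - kappa q 1" using False K by simp
    also have "\<dots> \<le> kappa q k - kappa q 1" using kappa_ge[of q k] q by simp
    finally show ?thesis .
  qed
  ultimately show thesis using that by blast
qed

definition dmono :: "nat \<times> nat \<Rightarrow> dps" where "dmono i = Dps (\<lambda>j. if j = i then 1 else 0)"

lemma dcoeff_dmono: "dcoeff (dmono i) j = (if j = i then 1 else 0)"
proof -
  have "(\<lambda>j. \<bar>if j = i then 1 else 0 :: real\<bar>) summable_on UNIV"
    by (rule finite_nonzero_values_imp_summable_on) simp
  then show ?thesis by (simp add: dmono_def dcoeff_Dps)
qed

lemma dcoeff_mult_dmono10: "dcoeff (a * dmono (Suc 0,0)) (m,n) = (if m = 0 then 0 else dcoeff a (m - 1, n))"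
proof -
  have "dcoeff (a * dmono (Suc 0,0)) (m,n) = (\<Sum>i=0..m. \<Sum>j=0..n. if j = n then if Suc i = m then dcoeff a (i,j) else 0 else 0)"
    unfolding dcoeff_mult by (intro sum.cong refl) (auto simp: dcoeff_dmono)
  also have "\<dots> = (\<Sum>i=0..m. if Suc i = m then dcoeff a (i,n) else 0)"
    by (simp add: sum.delta)
  also have "\<dots> = (if m = 0 then 0 else dcoeff a (m - 1, n))"
  proof (cases m)
    case (Suc k)
    then show ?thesis by (simp add: sum.delta cong: if_cong)
  qed simp
  finally show ?thesis .
qed

lemma dcoeff_mult_dmono01: "dcoeff (a * dmono (0,Suc 0)) (m,n) = (if n = 0 then 0 else dcoeff a (m, n - 1))"
proof -
  have s: "dswap (dmono (Suc 0,0)) = dmono (0,Suc 0)" by (rule dps_eqI2) (auto simp: dcoeff_dmono)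
  have "dcoeff (a * dmono (0,Suc 0)) (m,n) = dcoeff (dswap (dswap a * dmono (Suc 0,0))) (m,n)"
    by (simp add: dswap_mult s) (metis dcoeff_dswap dps_eqI2)
  then show ?thesis by (simp only: dcoeff_dswap dcoeff_mult_dmono10)
qed

text \<open>\<open>dn_symbol\<close> is the ratio of normal to tangential derivative of the harmonic functions vanishing on
  the inner circle; \<open>inv_symbol\<close> inverts the linearised operator on the wave numbers \<open>\<ge> 2\<close>.\<close>

definition dn_symbol :: "real \<Rightarrow> nat \<times> nat \<Rightarrow> real" where
  "dn_symbol q i = sgn (angfreq i) * ((1 + q ^ wavenum i) / (1 - q ^ wavenum i))"

text \<open>The linearised symbol 4 \<omega> - 2 \<omega>^2 (1 + kappa_k) at \<omega> = 1 - q,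
  rewritten with 1 + kappa_1 = 2 / (1 - q) so that its zero at k = 1 is visible.\<close>

definition den :: "real \<Rightarrow> nat \<Rightarrow> real" where
  "den q k = 2 * (1 - q)\<^sup>2 * (kappa q 1 - kappa q k)"

definition inv_symbol :: "real \<Rightarrow> nat \<times> nat \<Rightarrow> real" where
  "inv_symbol q i = (if 2 \<le> wavenum i then 1 / den q (wavenum i) else 0)"

definition diag :: "nat \<times> nat \<Rightarrow> real" where "diag i = (if fst i = snd i then 1 else 0)"

text \<open>In a symmetric series the part of wave number 1 is d (p + m), with p and m the two
  variables and d a diagonal series. This operator extracts d.\<close>

definition shift :: "dps \<Rightarrow> dps" where
  "shift a = dmul diag (dreindex (\<lambda>i. (Suc (fst i), snd i)) a)"

definition ord1 :: "dps \<Rightarrow> bool" where "ord1 a \<longleftrightarrow> dcoeff a (0,0) = 0"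

text \<open>No terms of total degree below 2. Imposed on the unknown, this fixes the tangent of the
  curve, and it makes the corrections to \<open>\<omega>\<close> and \<open>\<mu>\<close> vanish at
  s = 0.\<close>

definition ord2 :: "dps \<Rightarrow> bool" where
  "ord2 a \<longleftrightarrow> dcoeff a (0,0) = 0 \<and> dcoeff a (Suc 0,0) = 0 \<and> dcoeff a (0,Suc 0) = 0"

lemma ord_rules:
  "ord2 a \<Longrightarrow> ord1 a" "ord1 a \<Longrightarrow> ord1 b \<Longrightarrow> ord2 (a * b)" "ord2 a \<Longrightarrow> ord2 (a * c)" "ord2 a \<Longrightarrow> ord2 (c * a)"
  "ord1 a \<Longrightarrow> ord1 (a * c)" "ord1 a \<Longrightarrow> ord1 (c * a)"
  "ord1 a \<Longrightarrow> ord1 b \<Longrightarrow> ord1 (a + b)" "ord2 a \<Longrightarrow> ord2 b \<Longrightarrow> ord2 (a + b)"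
  "ord1 a \<Longrightarrow> ord1 b \<Longrightarrow> ord1 (a - b)" "ord2 a \<Longrightarrow> ord2 b \<Longrightarrow> ord2 (a - b)"
  "ord1 a \<Longrightarrow> ord1 (r *\<^sub>R a)" "ord2 a \<Longrightarrow> ord2 (r *\<^sub>R a)" "ord2 a \<Longrightarrow> ord2 (- a)" "ord2 0"
  by (auto simp: ord1_def ord2_def dcoeff_mult)

lemma exp_rem_hom:
  fixes h :: "'a::{real_normed_algebra_1,banach} \<Rightarrow> 'b::{real_normed_algebra_1,banach}"
  assumes h: "bounded_linear h" and m: "\<And>a b. h (a * b) = h a * h b" and 1: "h 1 = 1"
  shows "h (exp_rem x) = exp_rem (h x)"
proof -
  have p: "h (x ^ n) = h x ^ n" for n by (induction n) (auto simp: m 1)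
  have "(\<lambda>n. h (x ^ n /\<^sub>R fact (n + 2))) sums h (exp_rem x)"
    unfolding exp_rem_def by (rule bounded_linear.sums[OF h summable_sums[OF summable_exp_rem]])
  then have "(\<lambda>n. h x ^ n /\<^sub>R fact (n + 2)) sums h (exp_rem x)"
    by (simp only: p linear_simps(5)[OF h])
  then show ?thesis unfolding exp_rem_def by (simp add: sums_iff)
qed

locale annular =
  fixes q :: real
  assumes q: "0 < q" "q < 1"
begin

lemma q_pow: "1 - q ^ k \<ge> 1 - q" if "1 \<le> k"
  using power_decreasing[OF that, of q] q by simp

lemma abs_dn_symbol_le: "\<bar>dn_symbol q i\<bar> \<le> 2 / (1 - q)"
proof (cases "wavenum i = 0")
  case True
  then show ?thesis using q abs_angfreq[of i] by (simp add: dn_symbol_def)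
next
  case False
  have "q ^ wavenum i \<le> 1" "0 \<le> q ^ wavenum i" using q by (auto intro: power_le_one)
  moreover have "1 - q ^ wavenum i \<ge> 1 - q" using False by (intro q_pow) auto
  ultimately have "(1 + q ^ wavenum i) / (1 - q ^ wavenum i) \<le> 2 / (1 - q)" "0 \<le> (1 + q ^ wavenum i) / (1 - q ^ wavenum i)"
    using q by (auto intro!: frac_le)
  moreover have "\<bar>sgn (angfreq i)\<bar> \<le> 1" by (simp add: abs_sgn_eq)
  ultimately have "\<bar>sgn (angfreq i)\<bar> * \<bar>(1 + q ^ wavenum i) / (1 - q ^ wavenum i)\<bar> \<le> 1 * (2 / (1 - q))"
    by (intro mult_mono) (simp_all del: abs_divide)
  then show ?thesis by (simp only: dn_symbol_def abs_mult mult_1)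
qed

text \<open>The gap grows linearly in the wave number, so the inverse gains one derivative. The
  second bound therefore makes the angular derivative of \<open>V X\<close> a bounded function of
  \<open>X\<close>.\<close>

lemma inv_symbol_bounds:
  obtains C where "\<And>i. \<bar>inv_symbol q i\<bar> \<le> C" "\<And>i. \<bar>angfreq i * inv_symbol q i\<bar> \<le> C"
proof -
  obtain c where c: "c > 0" "\<And>k. 2 \<le> k \<Longrightarrow> c * real k \<le> kappa q k - kappa q 1"
    using kappa_gap[OF q] by blast
  define C where "C = 1 / (2 * (1 - q)\<^sup>2 * c)"
  have C: "0 < C" using q c by (simp add: C_def)
  have V: "real (wavenum i) * \<bar>inv_symbol q i\<bar> \<le> C" if "2 \<le> wavenum i" for i
  proof -
    have *: "2 * (1 - q)\<^sup>2 * (c * real (wavenum i)) \<le> - den q (wavenum i)"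
      unfolding den_def using mult_left_mono[OF c(2)[OF that], of "2 * (1 - q)\<^sup>2"] by (simp add: algebra_simps)
    moreover have p: "0 < 2 * (1 - q)\<^sup>2 * (c * real (wavenum i))" using c q that by simp
    ultimately have "1 / (- den q (wavenum i)) \<le> 1 / (2 * (1 - q)\<^sup>2 * (c * real (wavenum i)))"
      by (intro frac_le) auto
    moreover have "den q (wavenum i) < 0" using * p by linarith
    then have "\<bar>inv_symbol q i\<bar> = 1 / (- den q (wavenum i))" using that by (simp add: inv_symbol_def abs_divide)
    ultimately have "\<bar>inv_symbol q i\<bar> \<le> 1 / (2 * (1 - q)\<^sup>2 * (c * real (wavenum i)))" by simp
    then have "real (wavenum i) * \<bar>inv_symbol q i\<bar> \<le> real (wavenum i) * (1 / (2 * (1 - q)\<^sup>2 * (c * real (wavenum i))))"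
      by (intro mult_left_mono) auto
    also have "\<dots> = C" using that by (simp add: C_def)
    finally show ?thesis .
  qed
  show thesis
  proof (rule that[of C])
    show "\<bar>angfreq i * inv_symbol q i\<bar> \<le> C" for i
      using V[of i] C by (cases "2 \<le> wavenum i") (auto simp: abs_mult abs_angfreq inv_symbol_def)
    show "\<bar>inv_symbol q i\<bar> \<le> C" for i
    proof (cases "2 \<le> wavenum i")
      case True
      then have "1 * \<bar>inv_symbol q i\<bar> \<le> real (wavenum i) * \<bar>inv_symbol q i\<bar>" by (intro mult_right_mono) auto
      with V[OF True] show ?thesis by simp
    qed (use C in \<open>simp add: inv_symbol_def\<close>)
  qed
qed

abbreviation "M \<equiv> dmul (dn_symbol q)"
abbreviation "V \<equiv> dmul (inv_symbol q)"
abbreviation "DV \<equiv> dmul (\<lambda>i. angfreq i * inv_symbol q i)"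

lemma blin: "bounded_linear M" "bounded_linear V" "bounded_linear DV" "bounded_linear (dmul diag)" "bounded_linear shift"
  and dcoeff_ops: "dcoeff (M a) i = dn_symbol q i * dcoeff a i" "dcoeff (V a) i = inv_symbol q i * dcoeff a i"
    "dcoeff (DV a) i = angfreq i * inv_symbol q i * dcoeff a i" "dcoeff (dmul diag a) i = diag i * dcoeff a i"
    "dcoeff (shift a) i = diag i * dcoeff a (Suc (fst i), snd i)"
proof -
  obtain C where C: "\<And>i. \<bar>inv_symbol q i\<bar> \<le> C" "\<And>i. \<bar>angfreq i * inv_symbol q i\<bar> \<le> C" using inv_symbol_bounds by blast
  have d: "\<bar>diag i\<bar> \<le> 1" for i by (simp add: diag_def)
  have s: "inj (\<lambda>i::nat\<times>nat. (Suc (fst i), snd i))" by (auto simp: inj_on_def)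
  show "bounded_linear M" by (rule bounded_linear_dmul[OF abs_dn_symbol_le])
  show "dcoeff (M a) i = dn_symbol q i * dcoeff a i" by (rule dcoeff_dmul[OF abs_dn_symbol_le])
  show "bounded_linear V" by (rule bounded_linear_dmul[OF C(1)])
  show "dcoeff (V a) i = inv_symbol q i * dcoeff a i" by (rule dcoeff_dmul[OF C(1)])
  show "bounded_linear DV" by (rule bounded_linear_dmul[OF C(2)])
  show "dcoeff (DV a) i = angfreq i * inv_symbol q i * dcoeff a i" by (rule dcoeff_dmul[OF C(2)])
  show bd: "bounded_linear (dmul diag)" by (rule bounded_linear_dmul[OF d])
  show "dcoeff (dmul diag a) i = diag i * dcoeff a i" by (rule dcoeff_dmul[OF d])
  show "bounded_linear shift" unfolding shift_def by (rule bounded_linear_compose[OF bd bounded_linear_dreindex[OF s]])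
  show "dcoeff (shift a) i = diag i * dcoeff a (Suc (fst i), snd i)"
    unfolding shift_def dcoeff_dmul[OF d] dcoeff_dreindex[OF s] ..
qed

text \<open>Write \<open>\<omega> = om X\<close>, \<open>b = bb X\<close>, and \<open>T = e tt X\<close> for the logarithm of the modulus of the conformal map on the
  unit circle. Then \<open>exp (2 T) = 1 + e e1\<close>, and \<open>N1\<close>, \<open>N2\<close> are the quadratic parts of the two sides of the
  boundary equation. The unknown \<open>X\<close> is the linearisation itself: its modes \<open>\<ge> 2\<close> determine \<open>tt X\<close>, its mode
  \<open>0\<close> the constant in the Neumann condition, and its modes \<open>\<plusminus>1\<close> the bifurcation parameter \<open>\<omega>\<close>. Division by
  \<open>e\<close> turns the equation into \<open>X = Phi e X\<close>.\<close>

abbreviation "p1 \<equiv> dmono (Suc 0,0)"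
abbreviation "m1 \<equiv> dmono (0,Suc 0)"

definition tt where "tt X = p1 + m1 + V X"
definition bb where "bb X = p1 - m1 + DV X"
definition mb where "mb X = M (bb X)"
text \<open>The factor -1/4 inverts the derivative -4 of the linearised symbol with respect to
  \<open>\<omega>\<close> at wave number 1.\<close>

definition ww where "ww X = (- 1/4) *\<^sub>R shift X"
definition nn where "nn X = - dmul diag X"
definition rr where "rr e X = 4 * (tt X * tt X) * exp_rem (e *\<^sub>R (2 * tt X))"
definition e1 where "e1 e X = 2 * tt X + e *\<^sub>R rr e X"
definition N1 where "N1 e X = rr e X + e1 e X * mb X - M (e1 e X * bb X)"
definition N2 where "N2 e X = rr e X + mb X * mb X - bb X * bb X
  + e1 e X * (2 * mb X + e *\<^sub>R (mb X * mb X - bb X * bb X))"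
definition om where "om X = of_real (1 - q) + ww X"
text \<open>The remainders left by the linearisation at \<omega> = 1 - q: \<open>rem1\<close>
  collects products of the correction \<open>ww\<close> with \<open>V X\<close>, \<open>rem2\<close>
  the terms with the square of \<open>ww\<close> or with the correction to \<open>\<mu>\<close>, and
  \<open>rem3\<close> everything carrying a further power of the amplitude.\<close>

definition rem1 where "rem1 X = 4 * (ww X * V X) - (4 * of_real (1 - q)) * (ww X * (V X + M (DV X)))"
definition rem2 where "rem2 e X = (ww X * ww X + e *\<^sub>R nn X) * (2 * (tt X + mb X))"
definition rem3 where "rem3 e X = 2 * om X * N1 e X + (2 * tt X + e *\<^sub>R N1 e X) * (2 * tt X + e *\<^sub>R N1 e X)
  - (om X * om X + e *\<^sub>R nn X) * N2 e X"
definition Phi where "Phi e X = - (rem1 X - rem2 e X + e *\<^sub>R rem3 e X)"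

lemma Phi_small: "loc_small Phi"
proof -
  note i = loc_null_ident[where 'a = dps]
  have V: "loc_null (\<lambda>e. V)" and DV: "loc_null (\<lambda>e. DV)" and d: "loc_null (\<lambda>e. dmul diag)" and s: "loc_null (\<lambda>e. shift)"
    by (intro loc_null_linear[OF _ i] blin)+
  have n: "loc_lip (\<lambda>e. nn)" unfolding nn_def by (intro loc_lip_uminus loc_null_imp_lip d)
  have w: "loc_null (\<lambda>e. ww)" unfolding ww_def by (intro loc_null_linear[OF _ s] bounded_linear_scaleR_right)
  have t: "loc_lip (\<lambda>e. tt)" unfolding tt_def by (intro loc_lip_add loc_lip_const loc_null_imp_lip V)
  have b: "loc_lip (\<lambda>e. bb)" unfolding bb_def by (intro loc_lip_add loc_lip_const loc_null_imp_lip DV)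
  have mb: "loc_lip (\<lambda>e. mb)" unfolding mb_def by (intro loc_lip_linear[OF _ b] blin)
  have r: "loc_lip rr" unfolding rr_def
    by (intro loc_lip_mult loc_lip_const t loc_lip_exp_rem loc_small_imp_null loc_small_param)
  have e1: "loc_lip e1" unfolding e1_def
    by (intro loc_lip_add loc_lip_mult loc_lip_const t loc_lip_param r)
  have N1: "loc_lip N1" unfolding N1_def
    by (intro loc_lip_diff loc_lip_add loc_lip_mult loc_lip_linear[OF blin(1)] b mb e1 r)
  have N2: "loc_lip N2" unfolding N2_def
    by (intro loc_lip_diff loc_lip_add loc_lip_mult loc_lip_param loc_lip_const b mb e1 r)
  have om: "loc_lip (\<lambda>e. om)" unfolding om_def by (intro loc_lip_add loc_lip_const loc_null_imp_lip w)
  have cs: "loc_small (\<lambda>e X. c * f e X)" if "loc_small f" for c :: dps and f :: "real \<Rightarrow> dps \<Rightarrow> dps"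
    using loc_small_mult_lip[OF that loc_lip_const[of c]] by (simp add: mult.commute)
  have V': "loc_null (\<lambda>e X. V X + M (DV X))"
  proof -
    have "bounded_linear (\<lambda>X. V X + M (DV X))"
      by (intro bounded_linear_add bounded_linear_compose[OF blin(1)] blin)
    from loc_null_linear[OF this i] show ?thesis .
  qed
  have 1: "loc_small (\<lambda>e. rem1)" unfolding rem1_def
    by (intro loc_small_diff cs loc_small_mult_null w V V')
  have 2: "loc_small rem2" unfolding rem2_def
    by (intro loc_small_mult_lip loc_small_add loc_small_mult_null loc_small_param loc_lip_mult loc_lip_add loc_lip_const w n t mb)
  have 3: "loc_lip rem3" unfolding rem3_def
    by (intro loc_lip_diff loc_lip_add loc_lip_mult loc_lip_param loc_lip_const N1 N2 om t n)
  show ?thesis unfolding Phi_def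
    by (intro loc_small_uminus loc_small_add loc_small_diff 1 2 loc_small_param 3)
qed

definition inv_set :: "dps set" where "inv_set = {X. dswap X = X \<and> ord2 X}"

lemma closed_inv_set: "closed inv_set"
proof -
  have c: "continuous_on UNIV (\<lambda>X. dcoeff X i)" for i
    by (rule linear_continuous_on[OF bounded_linear_dcoeff])
  have "continuous_on UNIV dswap" by (rule linear_continuous_on[OF bounded_linear_dswap])
  then show ?thesis
    unfolding inv_set_def ord2_def
    by (intro closed_Collect_conj closed_Collect_eq c continuous_on_const continuous_on_id)
qed

lemma angfreq_flip: "angfreq (n,m) = - angfreq (m,n)" and wavenum_flip: "wavenum (n,m) = wavenum (m,n)"
  by (auto simp: angfreq_def wavenum_def)

lemma dswap_ops: "dswap (M a) = - M (dswap a)" "dswap (V a) = V (dswap a)" "dswap (DV a) = - DV (dswap a)"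
  "dswap (dmul diag a) = dmul diag a" "dswap (shift a) = shift a"
proof -
  have *: "dn_symbol q (n,m) = - dn_symbol q (m,n)" "inv_symbol q (n,m) = inv_symbol q (m,n)" "angfreq (n,m) = - angfreq (m,n)" for m n
    using angfreq_flip[of n m] wavenum_flip[of n m] by (simp_all add: dn_symbol_def inv_symbol_def sgn_minus)
  show "dswap (M a) = - M (dswap a)" "dswap (V a) = V (dswap a)" "dswap (DV a) = - DV (dswap a)"
    by (rule dps_eqI2, rename_tac m n, cut_tac m = m and n = n in *(1), cut_tac m = m and n = n in *(2),
        cut_tac m = m and n = n in *(3), simp add: dcoeff_ops)+
  show "dswap (dmul diag a) = dmul diag a" "dswap (shift a) = shift a"
    by (rule dps_eqI2, auto simp: dcoeff_ops diag_def)+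
qed

lemma dswap_of_real: "dswap (of_real r) = of_real r"
  by (simp add: of_real_def)

lemma dswap_numeral: "dswap (numeral k) = numeral k" 
  using dswap_of_real[of "numeral k"] by simp

lemma dswap_dmono: "dswap p1 = m1" "dswap m1 = p1"
  by (rule dps_eqI2; auto simp: dcoeff_dmono)+

lemma dswap_exp_rem: "dswap (exp_rem a) = exp_rem (dswap a)"
  by (rule exp_rem_hom[OF bounded_linear_dswap dswap_mult dswap_one])

text \<open>The symbol of \<open>M\<close> is odd in the frequency, so \<open>M\<close> anticommutes
  with the swap. The antisymmetric \<open>bb X\<close> enters the equation only squared or under
  \<open>M\<close>, hence all its contributions are symmetric.\<close>

lemma sym_parts:
  assumes "dswap X = X"
  shows "dswap (tt X) = tt X" "dswap (bb X) = - bb X" "dswap (mb X) = mb X"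
    "dswap (rr e X) = rr e X" "dswap (e1 e X) = e1 e X" "dswap (Phi e X) = Phi e X"
proof -
  note l = dswap_ops dswap_numeral dswap_of_real dswap_dmono dswap_exp_rem dswap_mult assms
  have dn_symbol: "M (- a) = - M a" for a by (simp add: linear_simps[OF blin(1)])
  show t: "dswap (tt X) = tt X" and b: "dswap (bb X) = - bb X" by (simp_all add: tt_def bb_def l)
  show m: "dswap (mb X) = mb X" by (simp add: mb_def l b dn_symbol)
  show r: "dswap (rr e X) = rr e X" by (simp add: rr_def l t)
  show e1: "dswap (e1 e X) = e1 e X" by (simp add: e1_def l t r)
  have w: "dswap (ww X) = ww X" and n: "dswap (nn X) = nn X" and om: "dswap (om X) = om X"
    by (simp_all add: ww_def nn_def om_def l)
  have N1: "dswap (N1 e X) = N1 e X" and N2: "dswap (N2 e X) = N2 e X"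
    by (simp_all add: N1_def N2_def l r e1 m b dn_symbol)
  show "dswap (Phi e X) = Phi e X"
    by (simp add: Phi_def rem1_def rem2_def rem3_def l w n om N1 N2 t m dn_symbol)
qed

lemma Phi_ord2: assumes "ord2 X" shows "ord2 (Phi e X)"
proof -
  have M: "ord2 (M a)" if "ord2 a" for a using that by (simp add: ord2_def dcoeff_ops)
  have V: "ord2 (V X)" and DV: "ord2 (DV X)" using assms by (simp_all add: ord2_def dcoeff_ops)
  have w: "ord2 (ww X)" using assms by (simp add: ord2_def ww_def dcoeff_ops diag_def)
  have n: "ord2 (nn X)" using assms by (simp add: ord2_def nn_def dcoeff_ops diag_def)
  have p: "ord1 p1" "ord1 m1" by (simp_all add: ord1_def dcoeff_dmono)
  have t: "ord1 (tt X)" unfolding tt_def by (intro ord_rules p V)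
  have b: "ord1 (bb X)" unfolding bb_def by (intro ord_rules p DV)
  have m: "ord1 (mb X)" using b by (simp add: ord1_def mb_def dcoeff_ops)
  have r: "ord2 (rr e X)" unfolding rr_def by (intro ord_rules(3,4) ord_rules(2) t)
  have e1: "ord1 (e1 e X)" unfolding e1_def by (intro ord_rules(6,7,11) t ord_rules(1)[OF r])
  have N1: "ord2 (N1 e X)" unfolding N1_def by (intro ord_rules(8,10) r M ord_rules(2) e1 m b)
  have N2: "ord2 (N2 e X)" unfolding N2_def
    by (intro ord_rules(8,10) r ord_rules(2) e1 m b ord_rules(7,6,11) ord_rules(9) ord_rules(5))
  have 3: "ord2 (rem3 e X)" unfolding rem3_def
    by (intro ord_rules(8,10) ord_rules(4)[OF N1] ord_rules(4)[OF N2] ord_rules(2)) 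
       (intro ord_rules(6,7,11) t ord_rules(1)[OF N1])+
  show ?thesis unfolding Phi_def rem1_def rem2_def
    by (intro ord_rules(8,10,12,13) 3 ord_rules(4)[OF ord_rules(3)[OF w]] ord_rules(3)[OF ord_rules(8)]
        ord_rules(3)[OF w] ord_rules(12)[OF n])
qed

lemma kappa1: "1 + kappa q 1 = 2 / (1 - q)"
  using q by (simp add: kappa_def field_simps)

text \<open>The kernel identity: p + m has angular derivative p - m, and on wave number 1 the factor
  1 + kappa_1 is 2 / (1 - q).\<close>

lemma lin1: "of_real (1 - q) * (p1 + m1 + M (p1 - m1)) = 2 * (p1 + m1)"
proof -
  have "of_real (1 - q) * (p1 + m1 + M (p1 - m1)) = (1 - q) *\<^sub>R (p1 + m1 + M (p1 - m1))"
    by (simp add: scaleR_conv_of_real)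
  also have "\<dots> = 2 *\<^sub>R (p1 + m1)"
    by (rule dps_eqI2) (use q in \<open>auto simp: dcoeff_ops dcoeff_dmono dn_symbol_def angfreq_def wavenum_def field_simps\<close>)
  finally show ?thesis by (simp add: scaleR_conv_of_real)
qed

text \<open>The linearised operator at \<omega> = 1 - q applied to \<open>V X\<close>. Its symbol is
  \<open>den\<close>, which \<open>V\<close> inverts on the wave numbers from 2 on.\<close>

definition high :: "dps \<Rightarrow> dps" where
  "high X = 4 * of_real (1 - q) * V X - 2 * (of_real (1 - q) * of_real (1 - q)) * (V X + M (DV X))"

lemma high: "dcoeff (high X) i = (if 2 \<le> wavenum i then dcoeff X i else 0)"
proof -
  have h: "high X = (4 * (1 - q)) *\<^sub>R V X - (2 * (1 - q)\<^sup>2) *\<^sub>R (V X + M (DV X))"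
    by (simp add: high_def scaleR_conv_of_real power2_eq_square)
  have "dn_symbol q i * angfreq i = kappa q (wavenum i)"
    using abs_angfreq[of i] by (simp add: dn_symbol_def kappa_def sgn_mult_self_eq mult_sgn_abs abs_sgn[symmetric] algebra_simps)
  then have "dcoeff (high X) i = (4 * (1 - q) - 2 * (1 - q)\<^sup>2 * (1 + kappa q (wavenum i))) * inv_symbol q i * dcoeff X i"
    by (simp add: h dcoeff_ops algebra_simps)
  also have "4 * (1 - q) - 2 * (1 - q)\<^sup>2 * (1 + kappa q (wavenum i)) = den q (wavenum i)"
  proof -
    have "4 * (1 - q) = 2 * (1 - q)\<^sup>2 * (1 + kappa q 1)" using q unfolding kappa1 by (simp add: power2_eq_square)
    then show ?thesis by (simp add: den_def algebra_simps)
  qed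
  finally show ?thesis
    using kappa_gt[OF q, of "wavenum i"] q by (auto simp: inv_symbol_def den_def)
qed

text \<open>The three summands carry the wave numbers at least 2, 0 and 1. Symmetry enters in the
  last one, where a single diagonal series must account for both signs of the frequency.\<close>

lemma decompose:
  assumes "X \<in> inv_set"
  shows "X = high X - nn X - 4 * (ww X * (p1 + m1))"
proof -
  have "4 * (ww X * (p1 + m1)) = - (shift X * p1 + shift X * m1)"
  proof -
    have "4 * (ww X * (p1 + m1)) = 4 *\<^sub>R (ww X * (p1 + m1))" by (simp add: scaleR_conv_of_real)
    also have "\<dots> = - (shift X * p1 + shift X * m1)" by (simp add: ww_def algebra_simps)
    finally show ?thesis .
  qed
  moreover have "X = high X + dmul diag X + (shift X * p1 + shift X * m1)"
  proof (rule dps_eqI2)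
    fix m n
    have sym: "dcoeff X (n, m) = dcoeff X (m, n)"
      using assms dcoeff_dswap[of X m n] by (simp add: inv_set_def)
    consider "m = n" | "m = Suc n" | "n = Suc m" | "2 \<le> wavenum (m,n)" "m \<noteq> n" "m \<noteq> Suc n" "n \<noteq> Suc m"
      by (force simp: wavenum_def)
    then show "dcoeff X (m, n) = dcoeff (high X + dmul diag X + (shift X * p1 + shift X * m1)) (m, n)"
      by cases (use sym in \<open>auto simp: high dcoeff_ops diag_def dcoeff_mult_dmono10 dcoeff_mult_dmono01\<close>)
  qed
  ultimately show ?thesis unfolding nn_def by (metis diff_minus_eq_add)
qed

lemma exp_e1: "exp (2 * (e *\<^sub>R tt X)) = 1 + of_real e * e1 e X"
proof -
  have "exp (e *\<^sub>R (2 * tt X)) = 1 + of_real e * e1 e X"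
  proof -
    define R where "R = exp_rem (e *\<^sub>R (2 * tt X))"
    show ?thesis
      unfolding exp_conv_exp_rem e1_def rr_def R_def[symmetric]
      by (simp add: scaleR_conv_of_real power2_eq_square algebra_simps)
  qed
  then show ?thesis by (simp add: scaleR_conv_of_real algebra_simps)
qed

text \<open>The terms linear in \<open>M B\<close> cancel on the left. Expanded in the amplitude,
  the difference of the two sides is then \<open>e\<close> times \<open>X - Phi e X\<close>.\<close>

lemma boundary_equation:
  assumes X: "X \<in> inv_set" and fp: "Phi e X = X"
  defines "T \<equiv> e *\<^sub>R tt X" and "B \<equiv> e *\<^sub>R bb X"
  defines "E \<equiv> exp (2 * T)"
  shows "(E + E * M B - M (E * B) - 1 + om X)\<^sup>2 = ((om X)\<^sup>2 + e *\<^sub>R nn X) * (E * ((1 + M B)\<^sup>2 - B\<^sup>2))"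
proof -
  define \<epsilon> where "\<epsilon> = (of_real e :: dps)"
  define K where "K = (of_real (1 - q) :: dps)"
  define c where "c = p1 + m1"
  define u where "u = V X + M (DV X)"
  note bl = linear_simps[OF blin(1)]
  have t: "tt X = c + V X" by (simp add: tt_def c_def)
  have m: "mb X = M (p1 - m1) + M (DV X)" by (simp add: mb_def bb_def bl)
  have f1: "K * (c + M (p1 - m1)) = 2 * c" using lin1 by (simp add: K_def c_def)
  have f1': "K * (tt X + mb X) = 2 * c + K * u" using f1 by (simp add: t m u_def algebra_simps)
  have f2: "high X = 4 * K * V X - 2 * (K * K) * u" by (simp add: high_def K_def u_def)
  have f3: "X = high X - nn X - 4 * (ww X * c)" using decompose[OF X] by (simp add: c_def)
  have f4: "X + (rem1 X - rem2 e X + \<epsilon> * rem3 e X) = 0"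
    using fp unfolding Phi_def \<epsilon>_def scaleR_conv_of_real by (metis add.commute add.right_inverse)
  have E: "E = 1 + \<epsilon> * e1 e X" unfolding E_def T_def \<epsilon>_def by (rule exp_e1)
  have MB: "M B = \<epsilon> * mb X"
    unfolding B_def bl mb_def \<epsilon>_def by (rule scaleR_conv_of_real)
  have Beq: "B = \<epsilon> * bb X" by (simp add: B_def \<epsilon>_def scaleR_conv_of_real)
  have "E * B = e *\<^sub>R bb X + (e * e) *\<^sub>R (e1 e X * bb X)"
    unfolding E Beq by (simp add: \<epsilon>_def scaleR_conv_of_real algebra_simps)
  then have "M (E * B) = e *\<^sub>R mb X + (e * e) *\<^sub>R M (e1 e X * bb X)"
    by (simp only: bl mb_def)
  then have MEB: "M (E * B) = \<epsilon> * mb X + \<epsilon> * \<epsilon> * M (e1 e X * bb X)"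
    by (simp add: \<epsilon>_def scaleR_conv_of_real)
  have e1: "e1 e X = 2 * tt X + \<epsilon> * rr e X" by (simp add: e1_def \<epsilon>_def scaleR_conv_of_real)
  have L: "E + E * M B - M (E * B) - 1 = 2 * \<epsilon> * tt X + \<epsilon> * \<epsilon> * N1 e X"
    unfolding MEB unfolding MB unfolding E N1_def
    by (simp add: e1 \<epsilon>_def[symmetric] scaleR_conv_of_real algebra_simps)
  have R: "E * ((1 + M B)\<^sup>2 - B\<^sup>2) = 1 + 2 * \<epsilon> * (tt X + mb X) + \<epsilon> * \<epsilon> * N2 e X"
    unfolding MB unfolding Beq E N2_def
    by (simp add: e1 power2_eq_square \<epsilon>_def[symmetric] scaleR_conv_of_real algebra_simps)
  have om: "om X = K + ww X" by (simp add: om_def K_def)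
  \<comment> \<open>\<open>om X\<close> splits into 1 - q, where the kernel identity removes p + m,
    and the correction \<open>ww X\<close>, which contributes (4 - 8) \<open>ww X\<close> times p +
    m.\<close>
  have "4 * om X * tt X - nn X - 2 * ((om X)\<^sup>2 + \<epsilon> * nn X) * (tt X + mb X)
      = 4 * K * tt X - 2 * K * (K * (tt X + mb X)) - nn X + 4 * ww X * tt X - 4 * ww X * (K * (tt X + mb X))
        - 2 * (ww X * ww X + \<epsilon> * nn X) * (tt X + mb X)"
    unfolding om by (simp add: power2_eq_square algebra_simps)
  also have "\<dots> = high X - nn X - 4 * (ww X * c) + (rem1 X - rem2 e X)"
    unfolding f1' f2 rem1_def rem2_def u_def[symmetric] K_def[symmetric]
    by (simp add: t \<epsilon>_def[symmetric] scaleR_conv_of_real algebra_simps)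
  also have "\<dots> = X + (rem1 X - rem2 e X)" using f3 by simp
  finally have lin: "4 * om X * tt X - nn X - 2 * ((om X)\<^sup>2 + \<epsilon> * nn X) * (tt X + mb X) + \<epsilon> * rem3 e X = 0"
    using f4 by (simp only: add.assoc)
  have "(2 * \<epsilon> * tt X + \<epsilon> * \<epsilon> * N1 e X + om X)\<^sup>2 - ((om X)\<^sup>2 + \<epsilon> * nn X) * (1 + 2 * \<epsilon> * (tt X + mb X) + \<epsilon> * \<epsilon> * N2 e X)
    = \<epsilon> * (4 * om X * tt X - nn X - 2 * ((om X)\<^sup>2 + \<epsilon> * nn X) * (tt X + mb X) + \<epsilon> * rem3 e X)"
    unfolding rem3_def by (simp add: power2_eq_square \<epsilon>_def[symmetric] scaleR_conv_of_real algebra_simps)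
  also have "\<dots> = 0" unfolding lin by simp
  finally show ?thesis
    unfolding L R by (simp add: \<epsilon>_def scaleR_conv_of_real)
qed

end

context annular
begin

lemma bifurcating_coefficients:
  obtains e T B w \<nu> where "e > 0" "dswap T = T" "\<And>n. dcoeff T (n,n) = 0" "dcoeff T (Suc 0, 0) = e"
    "has_angular_deriv T B"
    "dcoeff w (0,0) = 0" "\<And>m n. m \<noteq> n \<Longrightarrow> dcoeff w (m,n) = 0"
    "dcoeff \<nu> (0,0) = 0" "\<And>m n. m \<noteq> n \<Longrightarrow> dcoeff \<nu> (m,n) = 0"
    "(exp (2 * T) + exp (2 * T) * M B - M (exp (2 * T) * B) - 1 + (of_real (1 - q) + w))\<^sup>2
      = ((of_real (1 - q) + w)\<^sup>2 + \<nu>) * (exp (2 * T) * ((1 + M B)\<^sup>2 - B\<^sup>2))"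
proof -
  have "0 \<in> inv_set" by (simp add: inv_set_def ord_rules)
  moreover have "Phi e X \<in> inv_set" if "X \<in> inv_set" for e X
    using that by (simp add: inv_set_def sym_parts Phi_ord2)
  ultimately obtain e X where e: "0 < e" and X: "X \<in> inv_set" "Phi e X = X"
    using loc_small_fixed_point[OF Phi_small closed_inv_set, of 1] by (metis zero_less_one)
  note * = boundary_equation[OF X]
  show thesis
  proof (rule that[OF e])
    show "dswap (e *\<^sub>R tt X) = e *\<^sub>R tt X" using sym_parts(1)[of X] X by (simp add: inv_set_def)
    show "dcoeff (e *\<^sub>R tt X) (n,n) = 0" for n by (simp add: tt_def dcoeff_ops dcoeff_dmono inv_symbol_def)
    show "dcoeff (e *\<^sub>R tt X) (Suc 0,0) = e" by (simp add: tt_def dcoeff_ops dcoeff_dmono inv_symbol_def)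
    show "has_angular_deriv (e *\<^sub>R tt X) (e *\<^sub>R bb X)"
      unfolding has_angular_deriv_def
    proof (intro allI)
      fix m n
      have "angfreq (m,n) * dcoeff (p1 + m1) (m,n) = dcoeff (p1 - m1) (m,n)"
        by (auto simp: dcoeff_dmono angfreq_def)
      then have "dcoeff (bb X) (m,n) = angfreq (m,n) * dcoeff (tt X) (m,n)"
        by (simp add: bb_def tt_def dcoeff_ops distrib_left)
      then show "dcoeff (e *\<^sub>R bb X) (m,n) = (real m - real n) * dcoeff (e *\<^sub>R tt X) (m,n)"
        by (simp add: angfreq_def)
    qed
    show "dcoeff (ww X) (0,0) = 0" "dcoeff (e *\<^sub>R nn X) (0,0) = 0"
      using X by (simp_all add: inv_set_def ord2_def ww_def nn_def dcoeff_ops)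
    show "dcoeff (ww X) (m,n) = 0" "dcoeff (e *\<^sub>R nn X) (m,n) = 0" if "m \<noteq> n" for m n
      using that by (simp_all add: ww_def nn_def dcoeff_ops diag_def)
  qed (use * in \<open>simp add: om_def\<close>)
qed

end

section \<open>Evaluation on circles and composition of series\<close>

lemma ev_scaleR_etc:
  fixes P M :: "'b::{real_normed_algebra_1,banach,comm_ring_1}"
  assumes "norm P \<le> 1" "norm M \<le> 1"
  shows "ev P M (a + b) = ev P M a + ev P M b" "ev P M (a - b) = ev P M a - ev P M b"
    "ev P M (- a) = - ev P M a" "ev P M (r *\<^sub>R a) = r *\<^sub>R ev P M a" "ev P M (a ^ n) = ev P M a ^ n"
    "ev P M (of_real r) = of_real r" "ev P M 0 = 0"
proof -
  note l = linear_simps[OF bounded_linear_ev[OF assms]]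
  show "ev P M (a + b) = ev P M a + ev P M b" "ev P M (a - b) = ev P M a - ev P M b"
    "ev P M (- a) = - ev P M a" "ev P M (r *\<^sub>R a) = r *\<^sub>R ev P M a" "ev P M 0 = 0"
    by (simp_all add: l)
  show "ev P M (a ^ n) = ev P M a ^ n"
    by (induction n) (auto simp: ev_one[OF assms] ev_mult[OF assms])
  show "ev P M (of_real r) = of_real r" by (simp add: of_real_def l ev_one[OF assms])
qed

text \<open>For \<open>h\<close> an evaluation this is associativity of composition; for
  \<open>h\<close> the swap it carries symmetry through a composition.\<close>

lemma ev_hom_commute:
  fixes h :: "'a::{real_normed_algebra_1,banach,comm_ring_1} \<Rightarrow> 'b::{real_normed_algebra_1,banach,comm_ring_1}"
  assumes h: "bounded_linear h" "\<And>a b. h (a * b) = h a * h b" "h 1 = 1"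
    and PM: "norm P \<le> 1" "norm M \<le> 1"
  shows "h (ev P M a) = ev (h P) (h M) a"
proof -
  have p: "h (x ^ n) = h x ^ n" for x n by (induction n) (auto simp: h)
  have "h (ev P M a) = (\<Sum>\<^sub>\<infinity>i. h (dcoeff a i *\<^sub>R (P ^ fst i * M ^ snd i)))"
    unfolding ev_def
    using infsumI[OF has_sum_bounded_linear[OF h(1) has_sum_infsum[OF summable_ev[OF PM, of a]]]]
    by (simp add: o_def)
  also have "\<dots> = ev (h P) (h M) a"
    unfolding ev_def by (intro infsum_cong) (simp add: linear_simps(5)[OF h(1)] h p)
  finally show ?thesis .
qed

lemma ev_dswap:
  fixes P M :: "'b::{real_normed_algebra_1,banach,comm_ring_1}"
  shows "ev P M (dswap a) = ev M P a"
proof -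
  have "ev P M (dswap a) = (\<Sum>\<^sub>\<infinity>i. dcoeff a (prod.swap i) *\<^sub>R (P ^ fst i * M ^ snd i))"
    unfolding ev_def by (intro infsum_cong) (auto simp: prod.swap_def)
  also have "\<dots> = (\<Sum>\<^sub>\<infinity>i. dcoeff a i *\<^sub>R (P ^ snd i * M ^ fst i))"
    by (rule infsum_reindex_bij_witness[where i = prod.swap and j = prod.swap]) auto
  also have "\<dots> = ev M P a"
    unfolding ev_def by (intro infsum_cong) (simp add: mult.commute)
  finally show ?thesis .
qed

lemma cnj_ev: "cnj (ev P M a) = ev (cnj P) (cnj M) a"
  unfolding ev_def infsum_cnj[symmetric] by (simp add: scaleR_conv_of_real)

lemma ev_real_if_sym:
  assumes "dswap a = a" shows "ev z (cnj z) a \<in> \<real>"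
  using cnj_ev[of z "cnj z" a] ev_dswap[of z "cnj z" a] assms by (simp add: Reals_cnj_iff)

lemma ev_imag_if_antisym:
  assumes "dswap a = - a" "norm z \<le> 1" shows "Re (ev z (cnj z) a) = 0"
proof -
  have "cnj (ev z (cnj z) a) = - ev z (cnj z) a"
    using cnj_ev[of z "cnj z" a] ev_dswap[of z "cnj z" a] assms by (simp add: ev_scaleR_etc)
  then show ?thesis by (simp add: complex_eq_iff)
qed

lemma ev_dmono: "ev P M (dmono (Suc 0, 0)) = P" "ev P M (dmono (0, Suc 0)) = M"
  for P M :: "'b::{real_normed_algebra_1,banach,comm_ring_1}"
proof -
  have "ev P M (dmono j) = (\<Sum>\<^sub>\<infinity>i\<in>{j}. dcoeff (dmono j) i *\<^sub>R (P ^ fst i * M ^ snd i))" for j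
    unfolding ev_def by (rule infsum_cong_neutral) (auto simp: dcoeff_dmono)
  then show "ev P M (dmono (Suc 0, 0)) = P" "ev P M (dmono (0, Suc 0)) = M" by (simp_all add: dcoeff_dmono)
qed

lemma norm_dmono_le: "norm (dmono j) \<le> 1"
proof (rule norm_dps_finite_bound)
  fix F assume "finite (F :: (nat \<times> nat) set)"
  then show "(\<Sum>i\<in>F. \<bar>dcoeff (dmono j) i\<bar>) \<le> 1" by (simp add: dcoeff_dmono if_distrib[of abs] sum.delta cong: if_cong)
qed

text \<open>Inverting the angle \<open>y \<mapsto> y + h\<close>: with \<open>h\<close> antisymmetric, \<open>y\<close> is imaginary on the diagonal
  \<open>m = cnj p\<close> and \<open>z e\<^sup>y\<close> is a rotation of \<open>z\<close>.\<close>

lemma angular_inversion: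
  assumes h: "dswap h = - h"
  obtains c :: real and Y :: dps where "0 < c" "c \<le> 1" "dswap Y = - Y" "dcoeff Y (0,0) = 0"
    "norm (c *\<^sub>R (dmono (Suc 0,0) * exp Y)) \<le> 1/2" "norm (c *\<^sub>R (dmono (0,Suc 0) * exp (- Y))) \<le> 1/2"
    "Y = - ev (c *\<^sub>R (dmono (Suc 0,0) * exp Y)) (c *\<^sub>R (dmono (0,Suc 0) * exp (- Y))) h"
proof -
  define P where "P = (\<lambda>e Y. e *\<^sub>R (dmono (Suc 0,0) * exp Y))"
  define Q where "Q = (\<lambda>e Y. e *\<^sub>R (dmono (0,Suc 0) * exp (- Y)))"
  define \<Phi> where "\<Phi> = (\<lambda>e Y. - ev (P e Y) (Q e Y) h)"
  define S where "S = {Y. dswap Y = - Y}"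
  have h0: "dcoeff h (0,0) = 0" using arg_cong[OF h, of "\<lambda>a. dcoeff a (0,0)"] by simp
  have "loc_null (\<lambda>(e::real) Y::dps. - Y)"
    using loc_null_linear[OF bounded_linear_minus[OF bounded_linear_ident] loc_null_ident] .
  then have sm: "loc_small P" "loc_small Q"
    unfolding P_def Q_def by (intro loc_small_param loc_lip_mult loc_lip_const loc_lip_exp loc_null_ident)+
  have small: "loc_small \<Phi>"
    unfolding \<Phi>_def by (intro loc_small_uminus loc_small_ev sm h0)
  have "continuous_on UNIV dswap" by (rule linear_continuous_on[OF bounded_linear_dswap])
  then have cl: "closed S" unfolding S_def
    by (intro closed_Collect_eq) (auto intro!: continuous_intros)
  have sP: "dswap (P e Y) = Q e Y" "dswap (Q e Y) = P e Y" if "Y \<in> S" for e Y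
  proof -
    have d: "dswap (dmono (Suc 0,0)) = dmono (0,Suc 0)" "dswap (dmono (0,Suc 0)) = dmono (Suc 0,0)"
      by (rule dps_eqI2; auto simp: dcoeff_dmono)+
    show "dswap (P e Y) = Q e Y" "dswap (Q e Y) = P e Y"
      using that by (simp_all add: P_def Q_def S_def dswap_mult dswap_exp d)
  qed
  have bd: "norm (P e Y) \<le> 1/2" "norm (Q e Y) \<le> 1/2" if "norm Y \<le> 1/4" "0 < e" "e \<le> 1/4" for e Y
  proof -
    have x: "norm (exp Z) \<le> 2" if "norm Z \<le> 1/4" for Z :: dps
    proof -
      have "norm (exp Z) \<le> exp (norm Z)" by (rule norm_exp)
      also have "\<dots> \<le> exp (1/4)" using that by simp
      also have "\<dots> \<le> 1 + 1/4 + (1/4)\<^sup>2" by (rule exp_bound) auto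
      finally show ?thesis by (simp add: power2_eq_square)
    qed
    have "norm (dmono i * exp Z) \<le> 1 * 2" if "norm Z \<le> 1/4" for i Z
      by (rule order_trans[OF norm_mult_ineq]) (intro mult_mono norm_dmono_le x that, auto)
    note m = this
    have "e * norm (dmono i * exp Z) \<le> 1/4 * (1 * 2)" if "norm Z \<le> 1/4" for i Z
      by (intro mult_mono m that) (use \<open>0 < e\<close> \<open>e \<le> 1/4\<close> in auto)
    from this[of Y "(Suc 0,0)"] this[of "-Y" "(0,Suc 0)"] show "norm (P e Y) \<le> 1/2" "norm (Q e Y) \<le> 1/2"
      using that by (simp_all add: P_def Q_def)
  qed
  txt \<open>The symmetry is only preserved where the evaluation converges, so cut off elsewhere.\<close>
  define \<Phi>' where "\<Phi>' = (\<lambda>e Y. if norm (P e Y) \<le> 1 \<and> norm (Q e Y) \<le> 1 then \<Phi> e Y else 0)"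
  have "near_bound \<Phi>' \<eta> \<and> near_lip \<Phi>' \<eta>" if "\<eta> > 0" for \<eta>
  proof
    have b: "near_bound P 1" "near_bound Q 1" "near_bound \<Phi> \<eta>" "near_lip \<Phi> \<eta>"
      using sm small that by (auto simp: loc_small_def)
    show "near_bound \<Phi>' \<eta>" "near_lip \<Phi>' \<eta>"
      using b unfolding near_bound_def near_lip_def by (eventually_elim, simp add: \<Phi>'_def)+
  qed
  then have small': "loc_small \<Phi>'" by (simp add: loc_small_def)
  have inv: "\<Phi>' e Y \<in> S" if "Y \<in> S" for e Y
  proof (cases "norm (P e Y) \<le> 1 \<and> norm (Q e Y) \<le> 1")
    case True
    have "dswap (ev (P e Y) (Q e Y) h) = ev (dswap (P e Y)) (dswap (Q e Y)) h"
      by (rule ev_hom_commute[OF bounded_linear_dswap dswap_mult dswap_one]) (use True in auto)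
    also have "\<dots> = ev (P e Y) (Q e Y) (dswap h)" by (simp add: sP[OF that] ev_dswap)
    finally show ?thesis using True by (simp add: \<Phi>'_def \<Phi>_def S_def h ev_scaleR_etc)
  next
    case False
    then have "\<Phi>' e Y = 0" unfolding \<Phi>'_def by (rule if_not_P)
    then show ?thesis by (simp add: S_def)
  qed
  obtain e Y where Y: "0 < e" "e \<le> 1/4" "norm Y \<le> 1/4" "Y \<in> S" "\<Phi>' e Y = Y"
    using loc_small_fixed_point[OF small' cl _ inv, of "1/4"] by (auto simp: S_def)
  show thesis
  proof (rule that[of e Y])
    have "dcoeff (dswap Y) (0,0) = dcoeff (- Y) (0,0)" using Y(4) by (simp only: S_def mem_Collect_eq)
    then show "dcoeff Y (0,0) = 0" by simp
    show "Y = - ev (e *\<^sub>R (dmono (Suc 0,0) * exp Y)) (e *\<^sub>R (dmono (0,Suc 0) * exp (- Y))) h"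
      using Y(5) bd[OF Y(3,1,2)] by (simp add: \<Phi>'_def \<Phi>_def P_def Q_def)
  qed (use Y bd[OF Y(3,1,2)] in \<open>auto simp: S_def P_def Q_def\<close>)
qed

text \<open>Evaluation at (0, 0) reads off the constant term and commutes with the
  exponential.\<close>

lemma dcoeff_exp_00: "dcoeff (exp a) (0,0) = exp (dcoeff a (0,0))"
proof -
  have "(of_real (dcoeff (exp a) (0,0)) :: complex) = of_real (exp (dcoeff a (0,0)))"
    using ev_exp[of "0::complex" 0 a] by (simp add: ev_zero_zero exp_of_real)
  then show ?thesis by (simp only: of_real_eq_iff)
qed

text \<open>Substituting series without constant term cannot lower the order, as every monomial of
  degree at least 2 contains two factors of order at least 1.\<close>

lemma ord2_ev:
  assumes PM: "norm P \<le> 1" "norm Q \<le> 1" "ord1 P" "ord1 Q" and a: "ord2 a"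
  shows "ord2 (ev P Q a)"
proof -
  have t: "ord2 (dcoeff a i *\<^sub>R (P ^ fst i * Q ^ snd i))" for i
  proof -
    obtain m n where i: "i = (m,n)" by force
    consider "m + n \<le> 1" | k where "m = Suc (Suc k)" | k where "n = Suc (Suc k)" | "m = 1" "n = 1"
    proof -
      have "m + n \<le> 1 \<or> m = Suc (Suc (m - 2)) \<or> n = Suc (Suc (n - 2)) \<or> (m = 1 \<and> n = 1)" by arith
      then show thesis using that by blast
    qed
    then show ?thesis
    proof cases
      case 1
      then have "i \<in> {(0,0),(Suc 0,0),(0,Suc 0)}" by (auto simp: i)
      then have "dcoeff a i = 0" using a by (auto simp: ord2_def)
      then show ?thesis by (simp add: ord_rules)
    next
      case (2 k)
      have "ord2 (P * P)" by (intro ord_rules(2) PM)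
      then have "ord2 (P * P * (P ^ k * Q ^ n))" by (rule ord_rules(3))
      moreover have "P ^ m * Q ^ n = P * P * (P ^ k * Q ^ n)" unfolding 2 by (simp add: mult.assoc)
      ultimately show ?thesis unfolding i fst_conv snd_conv by (metis ord_rules(12))
    next
      case (3 k)
      have "ord2 (Q * Q)" by (intro ord_rules(2) PM)
      then have "ord2 (P ^ m * Q ^ k * (Q * Q))" by (rule ord_rules(4))
      moreover have "P ^ m * Q ^ n = P ^ m * Q ^ k * (Q * Q)" unfolding 3 by (simp add: ac_simps)
      ultimately show ?thesis unfolding i fst_conv snd_conv by (metis ord_rules(12))
    next
      case 4
      show ?thesis unfolding i using 4 by (auto intro!: ord_rules(12,2) PM)
    qed
  qed
  have "dcoeff (ev P Q a) j = (\<Sum>\<^sub>\<infinity>i. dcoeff (dcoeff a i *\<^sub>R (P ^ fst i * Q ^ snd i)) j)" for j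
    unfolding ev_def using infsumI[OF has_sum_bounded_linear[OF bounded_linear_dcoeff has_sum_infsum[OF summable_ev[OF PM(1,2), of a]]]]
    by (simp add: o_def)
  moreover have "dcoeff (dcoeff a i *\<^sub>R (P ^ fst i * Q ^ snd i)) j = 0" if "j \<in> {(0,0),(Suc 0,0),(0,Suc 0)}" for i j
    using t[of i] that unfolding ord2_def by blast
  ultimately have "dcoeff (ev P Q a) j = 0" if "j \<in> {(0,0),(Suc 0,0),(0,Suc 0)}" for j
    using that by (simp only: infsum_0_simp)
  then show ?thesis by (simp add: ord2_def)
qed

lemma dswap_dmono: "dswap (dmono (Suc 0,0)) = dmono (0,Suc 0)" "dswap (dmono (0,Suc 0)) = dmono (Suc 0,0)"
  by (rule dps_eqI2; auto simp: dcoeff_dmono)+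

text \<open>The constant term of exp \<open>Y\<close> is 1, so to first order \<open>P\<close> and
  \<open>Q\<close> are \<open>c\<close> times the two variables. The profile therefore begins with c
  e (p + m), the source of the cosine in the expansion of the boundary.\<close>

lemma profile_coefficients:
  assumes c: "norm P \<le> 1" "norm Q \<le> 1" and PQ: "P = c *\<^sub>R (dmono (Suc 0,0) * exp Y)" "Q = c *\<^sub>R (dmono (0,Suc 0) * exp (- Y))"
    and Y: "dswap Y = - Y" "dcoeff Y (0,0) = 0"
    and T: "dswap T = T" "dcoeff T (0,0) = 0" "dcoeff T (Suc 0,0) = e"
  defines "N \<equiv> exp (ev P Q T) - 1"
  shows "dswap N = N" "dcoeff N (0,0) = 0" "dcoeff N (Suc 0,0) = c * e"
proof -
  have sP: "dswap P = Q" "dswap Q = P"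
    using Y by (simp_all add: PQ dswap_mult dswap_exp dswap_dmono)
  have "dswap (ev P Q T) = ev P Q T"
    using ev_hom_commute[OF bounded_linear_dswap dswap_mult dswap_one c, of T] T(1) ev_dswap[of P Q T]
    by (simp add: sP)
  then show "dswap N = N" by (simp add: N_def dswap_exp)
  have eY: "dcoeff (exp Y) (0,0) = 1" using Y by (simp add: dcoeff_exp_00)
  have P1: "dcoeff P (0,0) = 0" "dcoeff P (Suc 0,0) = c" using eY
    by (simp_all add: PQ mult.commute[of "dmono _"] dcoeff_mult_dmono10)
  have Q1: "dcoeff Q (0,0) = 0" "dcoeff Q (Suc 0,0) = 0"
    by (simp_all add: PQ mult.commute[of "dmono _"] dcoeff_mult_dmono01)
  define T2 where "T2 = T - e *\<^sub>R (dmono (Suc 0,0) + dmono (0,Suc 0))"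
  have T01: "dcoeff T (0,Suc 0) = e" using T(3) dcoeff_dswap[of T "Suc 0" 0] T(1) by simp
  have "ord2 T2" using T T01 by (simp add: T2_def ord2_def dcoeff_dmono)
  then have o: "ord2 (ev P Q T2)" using P1 Q1 by (intro ord2_ev c) (auto simp: ord1_def)
  have "T = T2 + e *\<^sub>R (dmono (Suc 0,0) + dmono (0,Suc 0))" by (simp add: T2_def)
  then have e: "ev P Q T = ev P Q T2 + e *\<^sub>R (P + Q)"
    by (simp add: ev_scaleR_etc[OF c] ev_dmono)
  then have A: "dcoeff (ev P Q T) (0,0) = 0" "dcoeff (ev P Q T) (Suc 0,0) = c * e"
    using o P1 Q1 by (simp_all add: ord2_def)
  define R where "R = exp_rem (ev P Q T)"
  have N: "N = ev P Q T + (ev P Q T * ev P Q T) * R"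
    unfolding N_def exp_conv_exp_rem R_def by (simp add: power2_eq_square)
  have "ord2 ((ev P Q T * ev P Q T) * R)" by (intro ord_rules(3) ord_rules(2)) (simp_all add: ord1_def A)
  then show "dcoeff N (0,0) = 0" "dcoeff N (Suc 0,0) = c * e" using A by (simp_all add: N ord2_def)
qed

section \<open>Fourier modes and harmonic extension\<close>

text \<open>For |zeta| = 1 the monomial of index (n + k, n) evaluates at sigma zeta and its
  conjugate to sigma^(2n+k) zeta^k, so this is the Fourier coefficient of frequency k.\<close>

definition mode :: "dps \<Rightarrow> real \<Rightarrow> nat \<Rightarrow> real" where
  "mode a \<sigma> k = (\<Sum>\<^sub>\<infinity>n. dcoeff a (n + k, n) * \<sigma> ^ (2 * n + k))"

lemma mode_summable:
  assumes "\<bar>\<sigma>\<bar> \<le> 1"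
  shows "(\<lambda>n. dcoeff a (n + k, n) * \<sigma> ^ (2 * n + k)) summable_on UNIV" (is ?S)
    and abs_mode_le: "\<bar>mode a \<sigma> k\<bar> \<le> norm a * \<bar>\<sigma>\<bar> ^ k" (is ?B)
proof -
  have i: "inj (\<lambda>n. (n + k, n))" by (auto simp: inj_on_def)
  have s: "(\<lambda>n. \<bar>dcoeff a (n + k, n)\<bar>) summable_on UNIV" "(\<Sum>\<^sub>\<infinity>n. \<bar>dcoeff a (n + k, n)\<bar>) \<le> norm a"
  proof -
    have r: "(\<lambda>i. \<bar>dcoeff a i\<bar>) summable_on range (\<lambda>n. (n + k, n))"
      by (rule summable_on_subset_banach[OF abs_summable_dcoeff]) simp
    then show "(\<lambda>n. \<bar>dcoeff a (n + k, n)\<bar>) summable_on UNIV"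
      using summable_on_reindex[OF i, of "\<lambda>i. \<bar>dcoeff a i\<bar>"] by (simp add: o_def)
    have "(\<Sum>\<^sub>\<infinity>n. \<bar>dcoeff a (n + k, n)\<bar>) = infsum (\<lambda>i. \<bar>dcoeff a i\<bar>) (range (\<lambda>n. (n + k, n)))"
      using infsum_reindex[OF i, of "\<lambda>i. \<bar>dcoeff a i\<bar>"] by (simp add: o_def)
    also have "\<dots> \<le> norm a" unfolding norm_dps_def by (rule infsum_mono2) (use r in auto)
    finally show "(\<Sum>\<^sub>\<infinity>n. \<bar>dcoeff a (n + k, n)\<bar>) \<le> norm a" .
  qed
  have le: "norm (dcoeff a (n + k, n) * \<sigma> ^ (2 * n + k)) \<le> \<bar>\<sigma>\<bar> ^ k * \<bar>dcoeff a (n + k, n)\<bar>" for n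
  proof -
    have "\<bar>\<sigma>\<bar> ^ (2 * n) \<le> 1" using assms by (intro power_le_one) auto
    then have "\<bar>\<sigma>\<bar> ^ (2 * n) * (\<bar>\<sigma>\<bar> ^ k * \<bar>dcoeff a (n + k, n)\<bar>) \<le> 1 * (\<bar>\<sigma>\<bar> ^ k * \<bar>dcoeff a (n + k, n)\<bar>)"
      by (intro mult_right_mono) auto
    then show ?thesis by (simp add: abs_mult power_abs power_add ac_simps)
  qed
  note d = summable_on_dominated[OF summable_on_cmult_right[OF s(1), of "\<bar>\<sigma>\<bar> ^ k"] le]
  show ?S by (rule d(1))
  have "\<bar>mode a \<sigma> k\<bar> \<le> \<bar>\<sigma>\<bar> ^ k * (\<Sum>\<^sub>\<infinity>n. \<bar>dcoeff a (n + k, n)\<bar>)"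
    using d(3) s(1) by (simp add: mode_def infsum_cmult_right)
  also have "\<dots> \<le> \<bar>\<sigma>\<bar> ^ k * norm a" using s(2) by (intro mult_left_mono) auto
  finally show ?B by (simp add: mult.commute)
qed

lemma mode_mult:
  assumes "\<And>n. dcoeff b (n + k, n) = r * dcoeff a (n + k, n)"
  shows "mode b \<sigma> k = r * mode a \<sigma> k"
  unfolding mode_def assms by (simp add: infsum_cmult_right' mult.assoc)

lemma mode_add: "\<bar>\<sigma>\<bar> \<le> 1 \<Longrightarrow> mode (a + b) \<sigma> k = mode a \<sigma> k + mode b \<sigma> k"
  unfolding mode_def by (subst infsum_add[symmetric]) (auto intro!: mode_summable infsum_cong simp: distrib_right)

text \<open>The index set splits into the diagonal and the two sides of it. The lower side yields
  the negative frequencies, whose coefficients are modes of the swapped series.\<close>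

lemma ev_modes:
  assumes \<sigma>: "\<bar>\<sigma>\<bar> \<le> 1" and \<zeta>: "norm \<zeta> = 1"
  shows "(\<lambda>k. of_real (mode a \<sigma> (Suc k)) * \<zeta> ^ Suc k + of_real (mode (dswap a) \<sigma> (Suc k)) * cnj \<zeta> ^ Suc k)
    sums (ev (of_real \<sigma> * \<zeta>) (cnj (of_real \<sigma> * \<zeta>)) a - of_real (mode a \<sigma> 0))"
proof -
  define f where "f = (\<lambda>i. dcoeff a i *\<^sub>R ((of_real \<sigma> * \<zeta>) ^ fst i * (cnj (of_real \<sigma> * \<zeta>)) ^ snd i))"
  have "norm (of_real \<sigma> * \<zeta>) \<le> 1" "norm (cnj (of_real \<sigma> * \<zeta>)) \<le> 1"
    using \<sigma> \<zeta> by (simp_all add: norm_mult)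
  note s = summable_ev[OF this, of a, folded f_def]
  have ev: "ev (of_real \<sigma> * \<zeta>) (cnj (of_real \<sigma> * \<zeta>)) a = infsum f UNIV"
    by (simp add: ev_def f_def)
  have zz: "\<zeta> * cnj \<zeta> = 1" using \<zeta> by (simp add: complex_norm_square[symmetric])
  have zn: "\<zeta> ^ n * cnj \<zeta> ^ n = 1" for n
    using zz by (simp add: power_mult_distrib[symmetric])
  have fU: "f (n + k, n) = of_real (dcoeff a (n + k, n) * \<sigma> ^ (2 * n + k)) * \<zeta> ^ k" for n k
  proof -
    have "f (n + k, n) = of_real (dcoeff a (n + k, n) * \<sigma> ^ (2 * n + k)) * \<zeta> ^ k * (\<zeta> ^ n * cnj \<zeta> ^ n)"
      by (simp add: f_def scaleR_conv_of_real power_mult_distrib power_add mult_2 mult_2_right ac_simps)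
    then show ?thesis by (simp add: zn)
  qed
  have fL: "f (n, n + k) = of_real (dcoeff (dswap a) (n + k, n) * \<sigma> ^ (2 * n + k)) * cnj \<zeta> ^ k" for n k
  proof -
    have "f (n, n + k) = of_real (dcoeff (dswap a) (n + k, n) * \<sigma> ^ (2 * n + k)) * cnj \<zeta> ^ k * (\<zeta> ^ n * cnj \<zeta> ^ n)"
      by (simp add: f_def scaleR_conv_of_real power_mult_distrib power_add mult_2 mult_2_right ac_simps)
    then show ?thesis by (simp add: zn)
  qed
  have inner: "((\<lambda>n. of_real (dcoeff b (n + k, n) * \<sigma> ^ (2 * n + k)) * z) has_sum (of_real (mode b \<sigma> k) * z)) UNIV" for b k and z :: complex
    unfolding mode_def by (intro has_sum_cmult_left has_sum_of_real has_sum_infsum mode_summable[OF \<sigma>])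
  define hD :: "nat \<Rightarrow> nat \<times> nat" where "hD = (\<lambda>n. (n,n))"
  define hU :: "nat \<times> nat \<Rightarrow> nat \<times> nat" where "hU = (\<lambda>(k,n). (n + Suc k, n))"
  define hL :: "nat \<times> nat \<Rightarrow> nat \<times> nat" where "hL = (\<lambda>(k,n). (n, n + Suc k))"
  have inj: "inj hD" "inj hU" "inj hL" by (auto simp: inj_on_def hD_def hU_def hL_def)
  have sub: "f summable_on A" for A by (rule summable_on_subset_banach[OF s]) simp
  have part: "UNIV = range hD \<union> (range hU \<union> range hL)"
  proof -
    have "(m,n) \<in> range hD \<union> (range hU \<union> range hL)" for m n
    proof (cases m n rule: linorder_cases)
      case less
      then have "(m,n) = hL (n - Suc m, m)" by (simp add: hL_def)
      then show ?thesis by blast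
    next
      case equal
      then have "(m,n) = hD m" by (simp add: hD_def)
      then show ?thesis by blast
    next
      case greater
      then have "(m,n) = hU (m - Suc n, n)" by (simp add: hU_def)
      then show ?thesis by blast
    qed
    then show ?thesis by auto
  qed
  have "infsum f UNIV = infsum f (range hD \<union> (range hU \<union> range hL))"
    by (rule arg_cong[OF part])
  also have "\<dots> = infsum f (range hD) + infsum f (range hU \<union> range hL)"
    by (rule infsum_Un_disjoint[OF sub sub]) (auto simp: hD_def hU_def hL_def)
  also have "infsum f (range hU \<union> range hL) = infsum f (range hU) + infsum f (range hL)"
    by (rule infsum_Un_disjoint[OF sub sub]) (auto simp: hD_def hU_def hL_def)
  finally have "infsum f UNIV = infsum f (range hD) + (infsum f (range hU) + infsum f (range hL))" .
  moreover have "infsum f (range hD) = of_real (mode a \<sigma> 0)"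
    using infsum_reindex[OF inj(1), of f] infsumI[OF inner[of a 0 1]] fU[of _ 0] by (simp add: o_def hD_def)
  ultimately have tot: "ev (of_real \<sigma> * \<zeta>) (cnj (of_real \<sigma> * \<zeta>)) a - of_real (mode a \<sigma> 0)
      = infsum f (range hU) + infsum f (range hL)"
    unfolding ev by simp
  have U: "(\<lambda>k. of_real (mode a \<sigma> (Suc k)) * \<zeta> ^ Suc k) sums infsum f (range hU)"
  proof -
    have "((\<lambda>x. f (hU x)) has_sum infsum f (range hU)) (Sigma UNIV (\<lambda>_. UNIV))"
      using has_sum_reindex[OF inj(2), of f] has_sum_infsum[OF sub[of "range hU"]] by (simp add: o_def)
    then have "((\<lambda>(k,n). f (n + Suc k, n)) has_sum infsum f (range hU)) (Sigma UNIV (\<lambda>_. UNIV))"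
      by (simp add: hU_def case_prod_unfold)
    then have "((\<lambda>k. of_real (mode a \<sigma> (Suc k)) * \<zeta> ^ Suc k) has_sum infsum f (range hU)) UNIV"
      by (rule has_sum_SigmaD) (simp only: case_prod_conv fU inner)
    then show ?thesis by (rule has_sum_imp_sums)
  qed
  have L: "(\<lambda>k. of_real (mode (dswap a) \<sigma> (Suc k)) * cnj \<zeta> ^ Suc k) sums infsum f (range hL)"
  proof -
    have "((\<lambda>x. f (hL x)) has_sum infsum f (range hL)) (Sigma UNIV (\<lambda>_. UNIV))"
      using has_sum_reindex[OF inj(3), of f] has_sum_infsum[OF sub[of "range hL"]] by (simp add: o_def)
    then have "((\<lambda>(k,n). f (n, n + Suc k)) has_sum infsum f (range hL)) (Sigma UNIV (\<lambda>_. UNIV))"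
      by (simp add: hL_def case_prod_unfold)
    then have "((\<lambda>k. of_real (mode (dswap a) \<sigma> (Suc k)) * cnj \<zeta> ^ Suc k) has_sum infsum f (range hL)) UNIV"
      by (rule has_sum_SigmaD) (simp only: case_prod_conv fL inner)
    then show ?thesis by (rule has_sum_imp_sums)
  qed
  show ?thesis unfolding tot by (rule sums_add[OF U L])
qed

subsection \<open>Rapidly decreasing power series\<close>

definition pser :: "(nat \<Rightarrow> real) \<Rightarrow> complex \<Rightarrow> complex" where
  "pser C \<zeta> = (\<Sum>k. of_real (C k) * \<zeta> ^ k)"

definition pser' :: "(nat \<Rightarrow> real) \<Rightarrow> complex \<Rightarrow> complex" where
  "pser' C \<zeta> = (\<Sum>k. diffs (\<lambda>k. of_real (C k)) k * \<zeta> ^ k)"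

text \<open>Decay with ratio at most 1/16 gives convergence up to |zeta| = 8. This leaves room
  around the closed annulus and its reflection, which will be kept inside |zeta| <= 2.\<close>

locale decreasing =
  fixes C :: "nat \<Rightarrow> real" and A \<sigma> :: real
  assumes C: "\<And>k. \<bar>C k\<bar> \<le> A * \<bar>\<sigma>\<bar> ^ k" and \<sigma>: "\<bar>\<sigma>\<bar> \<le> 1/16"
begin

lemma A_nonneg: "0 \<le> A" using C[of 0] by simp

lemma pser_summable:
  fixes \<zeta> :: complex
  assumes "norm \<zeta> \<le> 8" shows "summable (\<lambda>k. of_real (C k) * \<zeta> ^ k)"
proof (rule summable_comparison_test')
  show "summable (\<lambda>k. A * (1/2) ^ k)" by (intro summable_mult summable_geometric) simp
  fix k
  have "norm (of_real (C k) * \<zeta> ^ k) \<le> (A * \<bar>\<sigma>\<bar> ^ k) * 8 ^ k"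
    unfolding norm_mult norm_power norm_of_real by (intro mult_mono C power_mono assms) (use A_nonneg in auto)
  also have "\<dots> = A * (\<bar>\<sigma>\<bar> * 8) ^ k" by (simp add: power_mult_distrib)
  also have "\<dots> \<le> A * (1/2) ^ k" by (intro mult_left_mono power_mono) (use \<sigma> A_nonneg in auto)
  finally show "norm (of_real (C k) * \<zeta> ^ k) \<le> A * (1/2) ^ k" .
qed

lemma pser_sums: "norm \<zeta> \<le> 8 \<Longrightarrow> (\<lambda>k. of_real (C k) * \<zeta> ^ k) sums pser C \<zeta>"
  unfolding pser_def by (rule summable_sums[OF pser_summable])

lemma diffs_summable: "norm \<zeta> < 8 \<Longrightarrow> summable (\<lambda>k. diffs (\<lambda>k. of_real (C k)) k * \<zeta> ^ k)" for \<zeta> :: complex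
  by (rule termdiff_converges[where K = 8]) (auto intro!: pser_summable)

lemma pser_deriv: "norm \<zeta> < 8 \<Longrightarrow> (pser C has_field_derivative pser' C \<zeta>) (at \<zeta>)"
  unfolding pser_def[abs_def] pser'_def
  by (rule termdiffs_strong[where K = "8"]) (use pser_summable[of 8] in auto)

lemma pser'_sums: "norm \<zeta> < 8 \<Longrightarrow> (\<lambda>k. of_real (real k * C k) * \<zeta> ^ k) sums (\<zeta> * pser' C \<zeta>)"
proof -
  assume "norm \<zeta> < 8"
  then have "(\<lambda>n. of_nat n * of_real (C n) * \<zeta> ^ (n - Suc 0)) sums pser' C \<zeta>"
    unfolding pser'_def by (intro diffs_equiv diffs_summable)
  from sums_mult[OF this, of \<zeta>] show ?thesis
  proof (rule sums_cong[THEN iffD1, rotated])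
    fix n show "\<zeta> * (of_nat n * of_real (C n) * \<zeta> ^ (n - Suc 0)) = of_real (real n * C n) * \<zeta> ^ n"
      by (cases n) auto
  qed
qed

text \<open>The factor 4 is the sum of (k + 1) / 2^k, which applies because 4 |sigma| <=
  1/2.\<close>

lemma norm_pser'_le: "norm \<zeta> \<le> 4 \<Longrightarrow> norm (pser' C \<zeta>) \<le> 4 * A * \<bar>\<sigma>\<bar>"
proof -
  assume z: "norm \<zeta> \<le> 4"
  have g: "(\<lambda>k. of_nat (Suc k) * (1/2::real) ^ k) sums (1 / (1 - 1/2)\<^sup>2)"
    by (rule geometric_deriv_sums) simp
  have "norm (pser' C \<zeta>) \<le> (\<Sum>k. A * \<bar>\<sigma>\<bar> * (of_nat (Suc k) * (1/2) ^ k))"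
    unfolding pser'_def
  proof (rule norm_suminf_le)
    show "summable (\<lambda>k. A * \<bar>\<sigma>\<bar> * (of_nat (Suc k) * (1/2) ^ k))"
      by (intro summable_mult sums_summable[OF g])
    fix k
    have "norm (diffs (\<lambda>k. of_real (C k)) k * \<zeta> ^ k) = real (Suc k) * (\<bar>C (Suc k)\<bar> * norm \<zeta> ^ k)"
      unfolding diffs_def norm_mult norm_power norm_of_real norm_of_nat by simp
    also have "\<dots> \<le> real (Suc k) * ((A * \<bar>\<sigma>\<bar> ^ Suc k) * 4 ^ k)"
      by (intro mult_left_mono mult_mono C power_mono z) (use A_nonneg in auto)
    also have "\<dots> = A * \<bar>\<sigma>\<bar> * (real (Suc k) * (\<bar>\<sigma>\<bar> * 4) ^ k)"
      by (simp add: power_mult_distrib algebra_simps)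
    also have "\<dots> \<le> A * \<bar>\<sigma>\<bar> * (real (Suc k) * (1/2) ^ k)"
      by (intro mult_left_mono power_mono) (use \<sigma> A_nonneg in auto)
    finally show "norm (diffs (\<lambda>k. of_real (C k)) k * \<zeta> ^ k) \<le> A * \<bar>\<sigma>\<bar> * (of_nat (Suc k) * (1/2) ^ k)" by simp
  qed
  also have "\<dots> = A * \<bar>\<sigma>\<bar> * 4"
    using sums_unique[OF sums_mult[OF g, of "A * \<bar>\<sigma>\<bar>"]] by (simp add: power2_eq_square)
  finally show ?thesis by (simp add: algebra_simps)
qed

lemma pser_Lipschitz:
  assumes "norm x \<le> 4" "norm y \<le> 4" shows "norm (pser C x - pser C y) \<le> 4 * A * \<bar>\<sigma>\<bar> * norm (x - y)"
proof (rule field_differentiable_bound[where S = "cball 0 4" and f' = "pser' C"])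
  show "convex (cball (0::complex) 4)" by simp
  show "(pser C has_field_derivative pser' C z) (at z within cball 0 4)" if "z \<in> cball 0 4" for z
    using that by (intro has_field_derivative_at_within[OF pser_deriv]) simp
  show "norm (pser' C z) \<le> 4 * A * \<bar>\<sigma>\<bar>" if "z \<in> cball 0 4" for z
    using that by (intro norm_pser'_le) simp
  show "x \<in> cball 0 4" "y \<in> cball 0 4" using assms by (simp_all add: dist_norm)
qed

lemma cnj_pser: "norm \<zeta> \<le> 8 \<Longrightarrow> cnj (pser C \<zeta>) = pser C (cnj \<zeta>)"
proof -
  assume "norm \<zeta> \<le> 8"
  from sums_cnj[THEN iffD2, OF pser_sums[OF this]] have "(\<lambda>k. of_real (C k) * cnj \<zeta> ^ k) sums cnj (pser C \<zeta>)" by simp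
  then show ?thesis unfolding pser_def by (simp add: sums_iff)
qed

end

text \<open>With these coefficients C, and \<open>a\<close> symmetric, C(zeta) - C(q / zeta) has
  vanishing real part on the inner circle |zeta|^2 = q and the real part \<open>a\<close> minus its
  mean on the unit circle.\<close>

definition ext_coeff :: "real \<Rightarrow> dps \<Rightarrow> real \<Rightarrow> nat \<Rightarrow> real" where
  "ext_coeff q a \<sigma> k = (if k = 0 then 0 else 2 / (1 - q ^ k) * mode a \<sigma> k)"

context annular
begin

lemma ext_decreasing:
  assumes "\<bar>\<sigma>\<bar> \<le> 1/16" shows "decreasing (ext_coeff q a \<sigma>) (2 / (1 - q) * norm a) \<sigma>"
proof
  fix k
  show "\<bar>ext_coeff q a \<sigma> k\<bar> \<le> 2 / (1 - q) * norm a * \<bar>\<sigma>\<bar> ^ k"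
  proof (cases "k = 0")
    case False
    then have "1 - q ^ k \<ge> 1 - q" using q_pow[of k] by simp
    then have "2 / (1 - q ^ k) \<le> 2 / (1 - q)" "0 \<le> 2 / (1 - q ^ k)" using q by (auto intro!: frac_le)
    then have "\<bar>2 / (1 - q ^ k)\<bar> * \<bar>mode a \<sigma> k\<bar> \<le> 2 / (1 - q) * (norm a * \<bar>\<sigma>\<bar> ^ k)"
      using abs_mode_le[of \<sigma> a k] assms q by (intro mult_mono) (auto simp del: abs_divide)
    then show ?thesis using False by (simp add: ext_coeff_def abs_mult)
  qed (use q in \<open>simp add: ext_coeff_def\<close>)
qed (rule assms)

lemma dn_symbol_mode: "dn_symbol q (n + Suc k, n) = (1 + q ^ Suc k) / (1 - q ^ Suc k)" "dn_symbol q (n + 0, n) = 0"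
proof -
  have "wavenum (n + Suc k, n) = Suc k" unfolding wavenum_def fst_conv snd_conv of_nat_add by simp
  then show "dn_symbol q (n + Suc k, n) = (1 + q ^ Suc k) / (1 - q ^ Suc k)" "dn_symbol q (n + 0, n) = 0"
    unfolding dn_symbol_def by (simp_all add: angfreq_def)
qed

text \<open>Fourier coefficients are compared: at frequencies k and -k the series
  \<open>a + M a\<close> has C_k and - q^k C_k. The second identity is the derivative of the first
  along the circle.\<close>

lemma ext_boundary:
  assumes \<sigma>: "\<bar>\<sigma>\<bar> \<le> 1/16" and \<zeta>: "norm \<zeta> = 1" and a: "dswap a = a" "has_angular_deriv a a'"
  defines "C \<equiv> ext_coeff q a \<sigma>" and "ez \<equiv> ev (of_real \<sigma> * \<zeta>) (cnj (of_real \<sigma> * \<zeta>))"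
  shows "pser C \<zeta> - pser C (of_real q / \<zeta>) = ez a + ez (M a) - of_real (mode a \<sigma> 0)" (is ?V)
    and "\<zeta> * pser' C \<zeta> + of_real q / \<zeta> * pser' C (of_real q / \<zeta>) = ez (M a') + ez a'" (is ?D)
proof -
  have \<sigma>1: "\<bar>\<sigma>\<bar> \<le> 1" using \<sigma> by simp
  interpret decreasing C "2 / (1 - q) * norm a" \<sigma> unfolding C_def by (rule ext_decreasing[OF \<sigma>])
  have cz: "of_real q / \<zeta> = of_real q * cnj \<zeta>"
  proof -
    have "\<zeta> * cnj \<zeta> = 1" "\<zeta> \<noteq> 0" using \<zeta> by (auto simp: complex_norm_square[symmetric])
    then show ?thesis by (simp add: divide_eq_eq mult.assoc mult.commute[of "cnj \<zeta>"])
  qed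
  have nq: "norm (of_real q * cnj \<zeta>) < 8" using \<zeta> q by (simp add: norm_mult)
  have nz: "norm \<zeta> < 8" using \<zeta> by simp
  have nz0: "1 - q ^ Suc k \<noteq> 0" for k using q_pow[of "Suc k"] q by linarith
  have n1: "norm (of_real \<sigma> * \<zeta>) \<le> 1" "norm (cnj (of_real \<sigma> * \<zeta>)) \<le> 1"
    using \<sigma>1 \<zeta> by (simp_all add: norm_mult)
  note add = ev_scaleR_etc(1)[OF n1]
  have dM: "dswap (M b) = - M (dswap b)" for b by (rule dswap_ops)
  have C0: "C 0 = 0" by (simp add: C_def ext_coeff_def)
  have CS: "C (Suc k) = 2 / (1 - q ^ Suc k) * mode a \<sigma> (Suc k)" for k by (simp add: C_def ext_coeff_def)
  have mM: "mode (M b) \<sigma> (Suc k) = (1 + q ^ Suc k) / (1 - q ^ Suc k) * mode b \<sigma> (Suc k)" for b k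
    by (rule mode_mult) (simp only: dcoeff_ops dn_symbol_mode)
  have mM0: "mode (M b) \<sigma> 0 = 0" for b
    using mode_mult[of "M b" 0 0 b \<sigma>] by (simp add: dcoeff_ops dn_symbol_mode(2)[simplified])
  have mneg: "mode (- b) \<sigma> k = - mode b \<sigma> k" for b k using mode_mult[of "- b" k "-1" b \<sigma>] by simp
  have 1: "mode (a + M a) \<sigma> (Suc k) = C (Suc k)" for k
    unfolding mode_add[OF \<sigma>1] mM CS using nz0[of k] by (simp add: field_simps)
  have 2: "mode (dswap (a + M a)) \<sigma> (Suc k) = - (q ^ Suc k * C (Suc k))" for k
  proof -
    have "dswap (a + M a) = a + - M a" by (simp add: dM a)
    then show ?thesis
      unfolding CS using nz0[of k] by (simp only: mode_add[OF \<sigma>1] mneg mM) (simp add: field_simps)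
  qed
  have 3: "mode (a + M a) \<sigma> 0 = mode a \<sigma> 0" by (simp add: mode_add[OF \<sigma>1] mM0)
  have "(\<lambda>k. of_real (C (Suc k)) * \<zeta> ^ Suc k - of_real (C (Suc k)) * (of_real q * cnj \<zeta>) ^ Suc k)
      sums (ez (a + M a) - of_real (mode a \<sigma> 0))"
    using ev_modes[OF \<sigma>1 \<zeta>, of "a + M a"] unfolding 1 2 3 ez_def[symmetric]
    by (simp add: power_mult_distrib algebra_simps)
  moreover have "(\<lambda>k. of_real (C (Suc k)) * \<zeta> ^ Suc k - of_real (C (Suc k)) * (of_real q * cnj \<zeta>) ^ Suc k)
      sums (pser C \<zeta> - pser C (of_real q * cnj \<zeta>))"
    using sums_diff[OF pser_sums[of \<zeta>] pser_sums[of "of_real q * cnj \<zeta>"]] nz nq C0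
    by (subst sums_Suc_iff) auto
  ultimately have "ez (a + M a) - of_real (mode a \<sigma> 0) = pser C \<zeta> - pser C (of_real q * cnj \<zeta>)"
    by (rule sums_unique2)
  then show ?V unfolding cz by (simp only: ez_def add)
  have a': "mode a' \<sigma> k = real k * mode a \<sigma> k" for k
    by (rule mode_mult) (use a(2) in \<open>simp add: has_angular_deriv_def\<close>)
  have sa': "dswap a' = - a'"
  proof (rule dps_eqI2)
    fix m n
    have "dcoeff a (n,m) = dcoeff a (m,n)" using dcoeff_dswap[of a m n] a(1) by simp
    moreover have "dcoeff a' (i,j) = (real i - real j) * dcoeff a (i,j)" for i j
      using a(2) by (simp add: has_angular_deriv_def)
    ultimately show "dcoeff (dswap a') (m,n) = dcoeff (- a') (m,n)"
      unfolding dcoeff_dswap dcoeff_uminus by (simp add: left_diff_distrib)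
  qed
  have 1: "mode (M a' + a') \<sigma> (Suc k) = real (Suc k) * C (Suc k)" for k
    unfolding mode_add[OF \<sigma>1] mM CS a' using nz0[of k] by (simp add: field_simps)
  have 2: "mode (dswap (M a' + a')) \<sigma> (Suc k) = q ^ Suc k * (real (Suc k) * C (Suc k))" for k
  proof -
    have "dswap (M a' + a') = M a' + - a'" by (simp add: dM sa' linear_simps[OF blin(1)])
    then show ?thesis
      unfolding CS using nz0[of k] by (simp only: mode_add[OF \<sigma>1] mneg mM a') (simp add: field_simps)
  qed
  have 3: "mode (M a' + a') \<sigma> 0 = 0" by (simp add: mode_add[OF \<sigma>1] mM0 a')
  have "(\<lambda>k. of_real (real (Suc k) * C (Suc k)) * \<zeta> ^ Suc k + of_real (real (Suc k) * C (Suc k)) * (of_real q * cnj \<zeta>) ^ Suc k)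
      sums ez (M a' + a')"
    using ev_modes[OF \<sigma>1 \<zeta>, of "M a' + a'"] unfolding 1 2 3 ez_def[symmetric]
    by (simp add: power_mult_distrib algebra_simps)
  moreover have "(\<lambda>k. of_real (real (Suc k) * C (Suc k)) * \<zeta> ^ Suc k + of_real (real (Suc k) * C (Suc k)) * (of_real q * cnj \<zeta>) ^ Suc k)
      sums (\<zeta> * pser' C \<zeta> + of_real q * cnj \<zeta> * pser' C (of_real q * cnj \<zeta>))"
    using sums_add[OF pser'_sums[OF nz] pser'_sums[OF nq]] by (subst sums_Suc_iff) auto
  ultimately have "ez (M a' + a') = \<zeta> * pser' C \<zeta> + of_real q * cnj \<zeta> * pser' C (of_real q * cnj \<zeta>)"
    by (rule sums_unique2)
  then show ?D unfolding cz by (simp only: ez_def add)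
qed

end

section \<open>The conformal map\<close>

text \<open>In angles the map is a bounded perturbation of the identity, so the intermediate value
  theorem applies on an interval whose half-width bounds \<open>\<phi>\<close>.\<close>

lemma circle_rotation_surj:
  fixes \<phi> :: "complex \<Rightarrow> real"
  assumes r: "r > 0" and c: "continuous_on (sphere 0 r) \<phi>" and u: "norm u = r"
  obtains \<zeta> where "norm \<zeta> = r" "\<zeta> * cis (\<phi> \<zeta>) = u"
proof -
  have "compact (\<phi> ` sphere 0 r)" by (intro compact_continuous_image c) simp
  from compact_imp_bounded[OF this] obtain B where "\<forall>\<zeta>\<in>sphere 0 r. \<bar>\<phi> \<zeta>\<bar> \<le> B"
    by (auto simp: bounded_iff)
  then have B: "\<bar>\<phi> \<zeta>\<bar> \<le> B" if "norm \<zeta> = r" for \<zeta> using that by simp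
  define F where "F = (\<lambda>t. t + \<phi> (of_real r * cis t))"
  define a where "a = Arg u"
  have n: "norm (of_real r * cis t) = r" for t using r by (simp add: norm_mult)
  have "continuous_on UNIV F" unfolding F_def
    by (intro continuous_intros continuous_on_compose2[OF c]) (auto simp: n)
  then have cF: "continuous_on {a - B..a + B} F" by (rule continuous_on_subset) simp
  have "B \<ge> 0" using B[OF u] by linarith
  moreover have "F (a - B) \<le> a" "a \<le> F (a + B)"
    using B[OF n[of "a - B"]] B[OF n[of "a + B"]] by (auto simp: F_def)
  ultimately obtain t where t: "F t = a" using IVT'[of F "a - B" a "a + B"] cF by auto
  show thesis
  proof (rule that[of "of_real r * cis t"])
    have "of_real r * cis t * cis (\<phi> (of_real r * cis t)) = of_real r * cis (F t)"
      by (simp add: F_def cis_mult mult.assoc)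
    also have "\<dots> = u" using Arg_eq[of u] u r unfolding t a_def by (auto simp: cis_conv_exp)
    finally show "of_real r * cis t * cis (\<phi> (of_real r * cis t)) = u" .
  qed (rule n)
qed

lemma norm_exp_minus_one_le:
  fixes z :: complex assumes "norm z \<le> 1" shows "norm (exp z - 1) \<le> 3 * norm z"
proof -
  have "norm (exp z - exp 0) \<le> exp 1 * norm (z - 0)"
  proof (rule field_differentiable_bound[where S = "cball 0 1" and f' = exp])
    show "norm (exp w) \<le> exp 1" if "w \<in> cball 0 1" for w :: complex
      using that complex_Re_le_cmod[of w] by (simp add: norm_exp_eq_Re)
  qed (use assms in \<open>auto intro!: derivative_eq_intros\<close>)
  also have "\<dots> \<le> 3 * norm (z - 0)" by (intro mult_right_mono exp_le) auto
  finally show ?thesis by simp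
qed

text \<open>\<open>C\<close> generates the logarithm of f(zeta) / zeta. \<open>C'\<close> generates
  the holomorphic function whose real part will agree with |f|^2 up to its mean on the unit circle.
  The last bound keeps the map close enough to the identity to be injective.\<close>

locale annular_map = outer: decreasing C A \<sigma> + inner: decreasing C' A' \<sigma>
  for C A \<sigma> C' A' +
  fixes lam :: real
  assumes lam: "0 < lam" "lam < 1" and C0: "C 0 = 0" and small: "4 * A * \<bar>\<sigma>\<bar> \<le> (1 - lam) / 64"
begin

text \<open>An open neighbourhood of the closed annulus, so that the map and its inverse are smooth
  across both boundary circles.\<close>

definition reg :: "complex set" where "reg = {\<zeta>. lam / 2 < norm \<zeta> \<and> norm \<zeta> < 2}"

text \<open>Holomorphic, and equal to complex conjugation on |zeta| = lam. Since the power series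
  have real coefficients, \<open>g\<close> and \<open>k\<close> are purely imaginary there.\<close>

definition refl :: "complex \<Rightarrow> complex" where "refl \<zeta> = of_real (lam\<^sup>2) / \<zeta>"

definition g :: "complex \<Rightarrow> complex" where "g \<zeta> = pser C \<zeta> - pser C (refl \<zeta>)"

definition k :: "complex \<Rightarrow> complex" where "k \<zeta> = pser C' \<zeta> - pser C' (refl \<zeta>)"

definition g' :: "complex \<Rightarrow> complex" where
  "g' \<zeta> = pser' C \<zeta> + of_real (lam\<^sup>2) / \<zeta>\<^sup>2 * pser' C (refl \<zeta>)"

definition k' :: "complex \<Rightarrow> complex" where
  "k' \<zeta> = pser' C' \<zeta> + of_real (lam\<^sup>2) / \<zeta>\<^sup>2 * pser' C' (refl \<zeta>)"

definition f :: "complex \<Rightarrow> complex" where "f \<zeta> = \<zeta> * exp (g \<zeta>)"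

definition f' :: "complex \<Rightarrow> complex" where "f' \<zeta> = exp (g \<zeta>) * (1 + \<zeta> * g' \<zeta>)"

abbreviation "L \<equiv> 4 * A * \<bar>\<sigma>\<bar>"

lemma L: "0 \<le> L" "L \<le> 1/64"
  using outer.A_nonneg small lam by (auto simp: field_simps)

lemma reg_facts:
  assumes "\<zeta> \<in> reg" shows "\<zeta> \<noteq> 0" "norm \<zeta> \<le> 4" "norm (refl \<zeta>) \<le> 2" "norm (refl \<zeta>) \<le> 4" "norm \<zeta> \<le> 2"
    "norm \<zeta> < 8" "norm (refl \<zeta>) < 8"
proof -
  have *: "lam / 2 < norm \<zeta>" "norm \<zeta> < 2" using assms by (auto simp: reg_def)
  then show 0: "\<zeta> \<noteq> 0" "norm \<zeta> \<le> 4" "norm \<zeta> \<le> 2" "norm \<zeta> < 8" using lam by auto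
  have "lam\<^sup>2 \<le> lam" using lam by (simp add: power2_eq_square)
  then have "lam\<^sup>2 \<le> 2 * norm \<zeta>" using * by simp
  then show r: "norm (refl \<zeta>) \<le> 2" using 0(1) by (simp add: refl_def norm_divide norm_power pos_divide_le_eq)
  then show "norm (refl \<zeta>) \<le> 4" "norm (refl \<zeta>) < 8" by simp_all
qed

lemma open_reg: "open reg"
proof -
  have "reg = {\<zeta>. lam / 2 < norm \<zeta>} \<inter> {\<zeta>. norm \<zeta> < 2}" by (auto simp: reg_def)
  then show ?thesis by (auto intro!: open_Int open_Collect_less continuous_intros)
qed

lemma refl_deriv: "\<zeta> \<in> reg \<Longrightarrow> (refl has_field_derivative - (of_real (lam\<^sup>2) / \<zeta>\<^sup>2)) (at \<zeta>)"
  unfolding refl_def[abs_def] using reg_facts(1)[of \<zeta>]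
  by (auto intro!: derivative_eq_intros simp: power2_eq_square field_simps)

lemma g_deriv: "\<zeta> \<in> reg \<Longrightarrow> (g has_field_derivative g' \<zeta>) (at \<zeta>)"
  and k_deriv: "\<zeta> \<in> reg \<Longrightarrow> (k has_field_derivative k' \<zeta>) (at \<zeta>)"
proof -
  assume z: "\<zeta> \<in> reg"
  have eq: "a - b * - (of_real (lam\<^sup>2) / \<zeta>\<^sup>2) = a + of_real (lam\<^sup>2) / \<zeta>\<^sup>2 * b" for a b by simp
  note G = DERIV_diff[OF outer.pser_deriv DERIV_chain2[OF outer.pser_deriv refl_deriv[OF z]]]
    and K = DERIV_diff[OF inner.pser_deriv DERIV_chain2[OF inner.pser_deriv refl_deriv[OF z]]]
  show "(g has_field_derivative g' \<zeta>) (at \<zeta>)" "(k has_field_derivative k' \<zeta>) (at \<zeta>)"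
    unfolding g_def[abs_def] k_def[abs_def] g'_def k'_def eq[symmetric]
    by (rule G[OF reg_facts(6,7)[OF z]], rule K[OF reg_facts(6,7)[OF z]])
qed

lemma f_deriv: "\<zeta> \<in> reg \<Longrightarrow> (f has_field_derivative f' \<zeta>) (at \<zeta>)"
  unfolding f_def[abs_def] f'_def
  by (rule DERIV_cong[OF DERIV_mult[OF DERIV_ident DERIV_chain2[OF DERIV_exp g_deriv]]]) (auto simp: algebra_simps)

lemma f_holomorphic: "f holomorphic_on reg"
  using f_deriv open_reg by (auto simp: holomorphic_on_open)

text \<open>\<open>reg\<close> is not convex, so the mean value estimate is taken for the power
  series on a disc. The reflection contributes the factor lam^2 / (|x| |y|), at most 4 on
  \<open>reg\<close>, and 5 = 1 + 4.\<close>

lemma g_Lipschitz: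
  assumes "x \<in> reg" "y \<in> reg" shows "norm (g x - g y) \<le> 5 * L * norm (x - y)"
proof -
  note X = reg_facts[OF assms(1)] and Y = reg_facts[OF assms(2)]
  have "lam / 2 * (lam / 2) \<le> norm x * norm y"
    using assms lam by (intro mult_mono) (auto simp: reg_def)
  then have "lam\<^sup>2 / (norm x * norm y) \<le> 4"
    using X(1) Y(1) by (subst pos_divide_le_eq) (auto simp: power2_eq_square)
  moreover have "norm (refl x - refl y) = lam\<^sup>2 / (norm x * norm y) * norm (x - y)"
  proof -
    have "refl x - refl y = of_real (lam\<^sup>2) / (x * y) * (y - x)"
      using X(1) Y(1) by (simp add: refl_def field_simps)
    then show ?thesis by (simp add: norm_mult norm_divide norm_power norm_minus_commute)
  qed
  ultimately have r: "norm (refl x - refl y) \<le> 4 * norm (x - y)"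
    by (simp only: mult_right_mono norm_ge_zero)
  have "norm (g x - g y) = norm ((pser C x - pser C y) - (pser C (refl x) - pser C (refl y)))"
    by (simp add: g_def algebra_simps)
  also have "\<dots> \<le> norm (pser C x - pser C y) + norm (pser C (refl x) - pser C (refl y))"
    by (rule norm_triangle_ineq4)
  also have "\<dots> \<le> L * norm (x - y) + L * norm (refl x - refl y)"
    by (intro add_mono outer.pser_Lipschitz X Y)
  also have "\<dots> \<le> L * norm (x - y) + L * (4 * norm (x - y))"
    by (intro add_mono mult_left_mono r L) simp
  finally show ?thesis by (simp add: algebra_simps)
qed

lemma norm_g_le: assumes "x \<in> reg" shows "norm (g x) \<le> 4 * L"
proof -
  have 0: "pser C 0 = 0" unfolding pser_def using suminf_finite[of "{0}" "\<lambda>k. of_real (C k) * 0 ^ k"] C0 by simp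
  have *: "norm (pser C y) \<le> L * 2" if "norm y \<le> 2" for y
  proof -
    have "norm (pser C y - pser C 0) \<le> L * norm (y - 0)" by (rule outer.pser_Lipschitz) (use that in auto)
    also have "\<dots> \<le> L * 2" using that L by (intro mult_left_mono) auto
    finally show ?thesis using 0 by simp
  qed
  have "norm (g x) \<le> norm (pser C x) + norm (pser C (refl x))" unfolding g_def by (rule norm_triangle_ineq4)
  also have "\<dots> \<le> L * 2 + L * 2" by (intro add_mono * reg_facts(3,5) assms)
  finally show ?thesis by simp
qed

text \<open>If \<open>f x = f y\<close> then \<open>x / y = exp (g y - g x)\<close> is closer to \<open>1\<close> than \<open>x / y\<close> can be,
  as \<open>g\<close> has a small Lipschitz constant.\<close>

lemma f_inj: "inj_on f reg"
proof (rule inj_onI)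
  fix x y assume xy: "x \<in> reg" "y \<in> reg" "f x = f y"
  define d where "d = g y - g x"
  have "norm d \<le> 5 * L * norm (y - x)" unfolding d_def by (rule g_Lipschitz[OF xy(2,1)])
  have "norm d \<le> 4 * L + 4 * L" unfolding d_def
    by (rule order_trans[OF norm_triangle_ineq4]) (intro add_mono norm_g_le xy)
  then have "norm d \<le> 1" using L by simp
  have "x * exp (g x) = y * exp (g y)" using xy(3) by (simp add: f_def)
  then have "x = y * exp d" by (simp add: d_def exp_diff field_simps)
  then have "norm (y - x) = norm y * norm (exp d - 1)"
    by (simp add: norm_minus_commute[of y] norm_mult[symmetric] algebra_simps)
  also have "\<dots> \<le> 2 * (3 * (5 * L * norm (y - x)))"
    using norm_exp_minus_one_le[OF \<open>norm d \<le> 1\<close>] \<open>norm d \<le> 5 * L * norm (y - x)\<close> reg_facts(5)[OF xy(2)]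
    by (intro mult_mono) auto
  finally have "norm (y - x) \<le> (30 * L) * norm (y - x)" by simp
  moreover have "30 * L < 1" using L by simp
  ultimately have "norm (y - x) \<le> 0"
    using mult_strict_right_mono[of "30 * L" 1 "norm (y - x)"] by (smt (verit))
  then show "x = y" by simp
qed

lemma circle_in_reg: "norm \<zeta> = 1 \<Longrightarrow> \<zeta> \<in> reg" "norm \<zeta> = lam \<Longrightarrow> \<zeta> \<in> reg"
  "lam \<le> norm \<zeta> \<Longrightarrow> norm \<zeta> \<le> 1 \<Longrightarrow> \<zeta> \<in> reg"
  using lam by (auto simp: reg_def)

lemma inner_circle:
  assumes "norm \<zeta> = lam"
  shows "Re (g \<zeta>) = 0" "Re (k \<zeta>) = 0" "norm (f \<zeta>) = lam"
proof -
  have "\<zeta> \<noteq> 0" using assms lam by auto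
  moreover have "\<zeta> * cnj \<zeta> = of_real (lam\<^sup>2)" using complex_norm_square[of \<zeta>] assms by simp
  ultimately have r: "refl \<zeta> = cnj \<zeta>" by (simp add: refl_def divide_eq_eq mult.commute)
  have n: "norm \<zeta> \<le> 8" using assms lam by simp
  show g: "Re (g \<zeta>) = 0" "Re (k \<zeta>) = 0"
    unfolding g_def k_def r outer.cnj_pser[OF n, symmetric] inner.cnj_pser[OF n, symmetric] by simp_all
  show "norm (f \<zeta>) = lam" using g assms by (simp add: f_def norm_mult norm_exp_eq_Re)
qed

lemma g_continuous: "continuous_on reg g"
  using g_deriv by (intro continuous_at_imp_continuous_on) (auto intro: DERIV_isCont)

text \<open>On the inner circle \<open>f\<close> rotates each point by the angle
  \<open>Im (g \<zeta>)\<close>.\<close>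

lemma inner_circle_surj:
  assumes "norm z = lam" obtains \<zeta> where "norm \<zeta> = lam" "f \<zeta> = z"
proof -
  have "continuous_on (sphere 0 lam) (\<lambda>\<zeta>. Im (g \<zeta>))"
    by (intro continuous_intros continuous_on_subset[OF g_continuous]) (auto intro: circle_in_reg)
  then obtain \<zeta> where z: "norm \<zeta> = lam" "\<zeta> * cis (Im (g \<zeta>)) = z"
    using circle_rotation_surj[OF lam(1) _ assms] by metis
  have "exp (g \<zeta>) = cis (Im (g \<zeta>))" using inner_circle(1)[OF z(1)] by (simp add: exp_eq_polar)
  then show thesis using that z by (simp add: f_def)
qed

end

locale annular_domain = annular_map +
  fixes \<nu> :: "complex \<Rightarrow> real"
  assumes nu_cont: "continuous_on (sphere 0 1) \<nu>" and nu_small: "\<And>u. norm u = 1 \<Longrightarrow> \<bar>\<nu> u\<bar> \<le> (1 - lam) / 4"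
    and nu_f: "\<And>u. norm u = 1 \<Longrightarrow> \<exists>\<zeta>. norm \<zeta> = 1 \<and> f \<zeta> = u * of_real (1 + \<nu> u)"
    and f_nu: "\<And>\<zeta>. norm \<zeta> = 1 \<Longrightarrow> \<exists>u. norm u = 1 \<and> f \<zeta> = u * of_real (1 + \<nu> u)"
begin

definition dom :: "complex set" where
  "dom = {z. lam < norm z \<and> norm z < 1 + \<nu> (z / of_real (norm z))}"

definition ann :: "complex set" where "ann = {\<zeta>. lam < norm \<zeta> \<and> norm \<zeta> < 1}"
definition cann :: "complex set" where "cann = {\<zeta>. lam \<le> norm \<zeta> \<and> norm \<zeta> \<le> 1}"

lemma nu_gt: "norm u = 1 \<Longrightarrow> lam < 1 + \<nu> u"
  using nu_small[of u] lam by (simp add: abs_le_iff field_simps)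

lemma connected_dom: "connected dom"
proof -
  define h where "h = (\<lambda>(\<rho>,t). of_real (lam + \<rho> * (1 + \<nu> (cis t) - lam)) * cis t)"
  define S where "S = {0<..<1::real} \<times> (UNIV :: real set)"
  have c1: "continuous_on S (\<lambda>p. \<nu> (cis (snd p)))"
    by (rule continuous_on_compose2[OF nu_cont]) (auto intro!: continuous_intros)
  have "continuous_on S h" unfolding h_def case_prod_unfold by (intro continuous_intros c1)
  moreover have "connected S" unfolding S_def by (intro convex_connected convex_Times) auto
  ultimately have "connected (h ` S)" by (rule connected_continuous_image)
  moreover have "h ` S = dom"
  proof
    show "h ` S \<subseteq> dom"
    proof
      fix z assume "z \<in> h ` S"
      then obtain \<rho> t where p: "0 < \<rho>" "\<rho> < 1" and z: "z = of_real (lam + \<rho> * (1 + \<nu> (cis t) - lam)) * cis t"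
        by (auto simp: S_def h_def)
      have d: "0 < 1 + \<nu> (cis t) - lam" using nu_gt[of "cis t"] by simp
      define r where "r = lam + \<rho> * (1 + \<nu> (cis t) - lam)"
      have r: "lam < r" using p d by (simp add: r_def)
      have "\<rho> * (1 + \<nu> (cis t) - lam) < 1 * (1 + \<nu> (cis t) - lam)" using p d by (intro mult_strict_right_mono)
      then have r2: "r < 1 + \<nu> (cis t)" by (simp add: r_def)
      have "norm z = r" using r lam by (simp add: z r_def[symmetric] norm_mult)
      moreover have "z / of_real r = cis t" using r lam by (simp add: z r_def[symmetric])
      ultimately show "z \<in> dom" using r r2 by (simp add: dom_def)
    qed
    show "dom \<subseteq> h ` S"
    proof
      fix z assume z: "z \<in> dom"
      define t where "t = Arg z"
      have n: "lam < norm z" "norm z < 1 + \<nu> (z / of_real (norm z))" using z by (auto simp: dom_def)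
      have z0: "z \<noteq> 0" using n lam by auto
      have "z = of_real (norm z) * cis t" using Arg_eq[OF z0] by (simp add: t_def cis_conv_exp)
      then have u: "z / of_real (norm z) = cis t" using z0
        by (metis nonzero_mult_div_cancel_left of_real_eq_0_iff norm_eq_zero)
      define \<rho> where "\<rho> = (norm z - lam) / (1 + \<nu> (cis t) - lam)"
      have d: "0 < 1 + \<nu> (cis t) - lam" using nu_gt[of "cis t"] by simp
      have "0 < \<rho>" "\<rho> < 1" using n d u by (auto simp: \<rho>_def)
      moreover have "h (\<rho>, t) = z"
      proof -
        have "lam + \<rho> * (1 + \<nu> (cis t) - lam) = norm z" using d by (simp add: \<rho>_def)
        then show ?thesis using \<open>z = of_real (norm z) * cis t\<close> unfolding h_def case_prod_conv by simp
      qed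
      ultimately show "z \<in> h ` S" unfolding S_def by (force intro: image_eqI[of _ _ "(\<rho>,t)"])
    qed
  qed
  ultimately show ?thesis by simp
qed

lemma ann_reg: "ann \<subseteq> reg" "cann \<subseteq> reg" "ann \<subseteq> cann"
  using lam by (auto simp: ann_def cann_def reg_def)

lemma compact_cann: "compact cann"
proof -
  have "cann = {\<zeta>. lam \<le> norm \<zeta>} \<inter> cball 0 1" by (auto simp: cann_def)
  moreover have "closed {\<zeta>::complex. lam \<le> norm \<zeta>}" by (intro closed_Collect_le continuous_intros)
  ultimately show ?thesis by (simp add: closed_Int_compact)
qed

lemma open_ann: "open ann"
proof -
  have "ann = {\<zeta>. lam < norm \<zeta>} \<inter> {\<zeta>. norm \<zeta> < 1}" by (auto simp: ann_def)
  then show ?thesis by (auto intro!: open_Int open_Collect_less continuous_intros)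
qed

lemma boundary_not_dom: "norm u = 1 \<Longrightarrow> u * of_real (1 + \<nu> u) \<notin> dom"
proof -
  assume u: "norm u = 1"
  then have p: "0 < 1 + \<nu> u" using nu_gt[OF u] lam by simp
  then have "norm (u * of_real (1 + \<nu> u)) = 1 + \<nu> u" using u by (simp add: norm_mult del: of_real_add)
  then show ?thesis using p by (simp add: dom_def del: of_real_add)
qed

text \<open>A starting point for the connectedness argument below. On the middle circle the
  logarithm of |f| differs from that of |zeta| by at most 4 L <= (1 - lam) / 16, which is well
  within the distance to both boundary curves.\<close>

lemma mid_point: "f (of_real ((1 + lam) / 2)) \<in> dom"
proof -
  define x where "x = (of_real ((1 + lam) / 2) :: complex)"
  have nx: "norm x = (1 + lam) / 2" unfolding x_def norm_of_real using lam by simp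
  have xr: "x \<in> reg" using nx lam by (simp add: reg_def)
  have s: "64 * L \<le> 1 - lam" using small by (simp add: field_simps)
  have R: "\<bar>Re (g x)\<bar> \<le> 4 * L" using norm_g_le[OF xr] abs_Re_le_cmod[of "g x"] by linarith
  have nf: "norm (f x) = (1 + lam) / 2 * exp (Re (g x))" by (simp add: f_def norm_mult norm_exp_eq_Re nx)
  have "1 - 4 * L \<le> exp (Re (g x))" using exp_ge_add_one_self[of "Re (g x)"] R by linarith
  then have "(1 + lam) / 2 * (1 - 4 * L) \<le> norm (f x)" unfolding nf using lam by (intro mult_left_mono) auto
  moreover have "(1 + lam) / 2 * (4 * L) \<le> 1 * (4 * L)" using lam L by (intro mult_right_mono) auto
  then have "(1 + lam) / 2 - 4 * L \<le> (1 + lam) / 2 * (1 - 4 * L)" by (simp add: right_diff_distrib)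
  ultimately have 1: "lam < norm (f x)" using s lam by (simp add: field_simps)
  have "exp (Re (g x)) \<le> exp (4 * L)" using R by simp
  also have "\<dots> \<le> 1 + 4 * L + (4 * L)\<^sup>2" by (rule exp_bound) (use L in auto)
  also have "(4 * L)\<^sup>2 \<le> 4 * L"
    unfolding power2_eq_square by (rule mult_left_le) (use L in auto)
  finally have e: "exp (Re (g x)) \<le> 1 + 8 * L" by simp
  have "norm (f x) \<le> (1 + lam) / 2 * (1 + 8 * L)" unfolding nf using lam e by (intro mult_left_mono) auto
  also have "\<dots> \<le> (1 + lam) / 2 + 8 * L"
  proof -
    have "(1 + lam) / 2 * (8 * L) \<le> 1 * (8 * L)" using lam L by (intro mult_right_mono) auto
    then show ?thesis by (simp add: distrib_left)
  qed
  also have "\<dots> < 1 - (1 - lam) / 4" using s lam by (simp add: field_simps)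
  finally have "norm (f x) < 1 - (1 - lam) / 4" .
  moreover have "f x \<noteq> 0" using 1 lam by auto
  then have "norm (f x / of_real (norm (f x))) = 1" by (simp add: norm_divide)
  from nu_small[OF this] have "- ((1 - lam) / 4) \<le> \<nu> (f x / of_real (norm (f x)))" by linarith
  ultimately have "norm (f x) < 1 + \<nu> (f x / of_real (norm (f x)))" by linarith
  with 1 show ?thesis unfolding dom_def x_def[symmetric] by blast
qed

text \<open>In the connected set \<open>dom\<close> the image of the open annulus is open by the
  open mapping theorem. It is also closed, because the two circles that bound \<open>cann\<close>
  are mapped outside \<open>dom\<close>.\<close>

lemma dom_subset_image: "dom \<subseteq> f ` ann"
proof -
  have cf: "continuous_on cann f" 
    using holomorphic_on_imp_continuous_on[OF f_holomorphic] ann_reg(2) by (rule continuous_on_subset)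
  have eq: "dom \<inter> f ` ann = dom \<inter> f ` cann"
  proof
    show "dom \<inter> f ` ann \<subseteq> dom \<inter> f ` cann" using ann_reg by auto
    show "dom \<inter> f ` cann \<subseteq> dom \<inter> f ` ann"
    proof
      fix z assume z: "z \<in> dom \<inter> f ` cann"
      then obtain \<zeta> where \<zeta>: "\<zeta> \<in> cann" "z = f \<zeta>" by auto
      have "norm \<zeta> \<noteq> lam" using inner_circle(3)[of \<zeta>] z \<zeta> by (auto simp: dom_def)
      moreover have "norm \<zeta> \<noteq> 1" using f_nu[of \<zeta>] boundary_not_dom z \<zeta> by auto
      ultimately have "\<zeta> \<in> ann" using \<zeta> by (auto simp: ann_def cann_def)
      then show "z \<in> dom \<inter> f ` ann" using z \<zeta> by auto
    qed
  qed
  have "open (f ` ann)"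
    by (rule open_mapping_thm3[OF holomorphic_on_subset[OF f_holomorphic ann_reg(1)] open_ann
        inj_on_subset[OF f_inj ann_reg(1)]])
  then have "openin (top_of_set dom) (dom \<inter> f ` ann)" by (rule openin_open_Int)
  moreover have "closedin (top_of_set dom) (dom \<inter> f ` ann)"
    unfolding eq by (intro closedin_closed_Int compact_imp_closed compact_continuous_image cf compact_cann)
  moreover have "f (of_real ((1 + lam) / 2)) \<in> dom \<inter> f ` ann"
  proof -
    have "norm (of_real ((1 + lam) / 2) :: complex) = (1 + lam) / 2" unfolding norm_of_real using lam by simp
    then have "of_real ((1 + lam) / 2) \<in> ann" using lam by (simp add: ann_def del: of_real_divide)
    then show ?thesis using mid_point by blast
  qed
  ultimately have "dom \<inter> f ` ann = dom" using connected_dom unfolding connected_clopen by blast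
  then show ?thesis by blast
qed

end

section \<open>The explicit solution of the Dirichlet problem\<close>

lemma has_derivative_ln_norm:
  fixes z :: complex assumes "z \<noteq> 0"
  shows "((\<lambda>z. ln (norm z)) has_derivative (\<lambda>d. Re (d / z))) (at z)"
proof -
  have "((\<lambda>z. ln (norm z)) has_derivative (\<lambda>d. (d \<bullet> sgn z) * inverse (norm z))) (at z)"
    using assms by (auto intro!: derivative_eq_intros has_derivative_norm simp: divide_inverse)
  moreover have "(d \<bullet> sgn z) * inverse (norm z) = Re (d / z)" for d
  proof -
    have "(d \<bullet> sgn z) * inverse (norm z) = (d \<bullet> z) / (norm z)\<^sup>2"
      by (simp add: sgn_div_norm power2_eq_square divide_inverse)
    then show ?thesis by (simp add: inner_complex_def Re_divide cmod_power2)
  qed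
  ultimately show ?thesis by simp
qed

lemma has_derivative_norm_sq:
  "((\<lambda>z::complex. (norm z)\<^sup>2) has_derivative (\<lambda>d. 2 * Re (cnj z * d))) (at z)"
proof -
  have "((\<lambda>z::complex. z \<bullet> z) has_derivative (\<lambda>d. 2 * Re (cnj z * d))) (at z)"
    by (auto intro!: derivative_eq_intros simp: inner_complex_def algebra_simps)
  then show ?thesis by (simp add: power2_norm_eq_inner)
qed

lemma has_derivative_Re_field:
  assumes "(F has_field_derivative D) (at z)"
  shows "((\<lambda>z. Re (F z)) has_derivative (\<lambda>d. Re (D * d))) (at z)"
  using has_derivative_compose[OF assms[unfolded has_field_derivative_def] bounded_linear_imp_has_derivative[OF bounded_linear_Re]]
  by simp

context annular_domain
begin

text \<open>The solution is \<gamma> |z|^2 / 4 with two harmonic corrections in the variable zeta =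
  h(z): \<open>Re k\<close> removes |f|^2 up to a constant on the outer boundary, and a multiple of
  ln |zeta| adjusts the remaining constants. The hypothesis \<open>Q\<close> is the Neumann
  condition multiplied by |zeta f'|^2 and pulled back to the unit circle.\<close>

lemma overdetermined_complex:
  fixes \<gamma> e0 c0 Q :: real
  defines "\<Phi> \<equiv> \<lambda>\<zeta>. - of_real (\<gamma> / 4) * k' \<zeta> + of_real (c0 / ln lam) / \<zeta>"
  assumes c0: "c0 = \<gamma> * (e0 - lam\<^sup>2) / 4 + 1"
    and k_boundary: "\<And>\<zeta>. norm \<zeta> = 1 \<Longrightarrow> Re (k \<zeta>) = (norm (f \<zeta>))\<^sup>2 - e0"
    and Q: "\<And>\<zeta>. norm \<zeta> = 1 \<Longrightarrow>
      (norm (of_real (\<gamma> / 2 * (norm (f \<zeta>))\<^sup>2) * (1 + \<zeta> * g' \<zeta>) + \<zeta> * \<Phi> \<zeta>))\<^sup>2 = Q * (norm (f \<zeta> * (1 + \<zeta> * g' \<zeta>)))\<^sup>2"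
  obtains U K F \<psi> where "open U" "compact K" "K \<subseteq> U" "dom \<subseteq> K" "F holomorphic_on U"
    "\<And>z. z \<in> U \<Longrightarrow> (\<psi> has_derivative (\<lambda>d. Re ((of_real (\<gamma> / 2) * cnj z + F z) * d))) (at z)"
    "\<And>z. norm z = lam \<Longrightarrow> \<psi> z = 1" 
    "\<And>u. norm u = 1 \<Longrightarrow> \<psi> (u * of_real (1 + \<nu> u)) = 0"
    "\<And>u. norm u = 1 \<Longrightarrow> (norm (of_real (\<gamma> / 2) * cnj (u * of_real (1 + \<nu> u)) + F (u * of_real (1 + \<nu> u))))\<^sup>2 = Q"
proof -
  obtain h where h: "h holomorphic_on (f ` reg)" "\<And>\<zeta>. \<zeta> \<in> reg \<Longrightarrow> deriv f \<zeta> * deriv h (f \<zeta>) = 1"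
    "\<And>\<zeta>. \<zeta> \<in> reg \<Longrightarrow> h (f \<zeta>) = \<zeta>"
    using holomorphic_has_inverse[OF f_holomorphic open_reg f_inj] by metis
  define U where "U = f ` reg"
  define K where "K = f ` cann"
  define F where "F = (\<lambda>z. \<Phi> (h z) * deriv h z)"
  define \<psi> where "\<psi> = (\<lambda>z. \<gamma> * ((norm z)\<^sup>2 - lam\<^sup>2) / 4 + 1 - \<gamma> / 4 * Re (k (h z)) + c0 * (ln (norm (h z)) - ln lam) / ln lam)"
  have oU: "open U" unfolding U_def by (rule open_mapping_thm3[OF f_holomorphic open_reg f_inj])
  have hr: "h z \<in> reg" "f (h z) = z" if "z \<in> U" for z using that h(3) by (auto simp: U_def)
  have df: "deriv f \<zeta> = f' \<zeta>" if "\<zeta> \<in> reg" for \<zeta> using f_deriv[OF that] by (rule DERIV_imp_deriv)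
  have hd: "(h has_field_derivative deriv h z) (at z)" if "z \<in> U" for z
    using h(1) oU that by (intro holomorphic_derivI[of h U]) (auto simp: U_def)
  have k'h: "k' holomorphic_on reg"
    using holomorphic_deriv[of k reg] k_deriv open_reg
    by (metis DERIV_imp_deriv holomorphic_on_open holomorphic_transform)
  have \<Phi>h: "\<Phi> holomorphic_on reg" unfolding \<Phi>_def
    by (intro holomorphic_intros k'h) (use reg_facts in auto)
  show thesis
  proof (rule that[OF oU])
    show "compact K" unfolding K_def
      by (intro compact_continuous_image compact_cann
          continuous_on_subset[OF holomorphic_on_imp_continuous_on[OF f_holomorphic] ann_reg(2)])
    show "K \<subseteq> U" using ann_reg by (auto simp: K_def U_def)
    show "dom \<subseteq> K" unfolding K_def by (rule subset_trans[OF dom_subset_image image_mono[OF ann_reg(3)]])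
    show "F holomorphic_on U" unfolding F_def
    proof (intro holomorphic_on_mult holomorphic_deriv oU)
      show "h holomorphic_on U" using h(1) by (simp add: U_def)
      then show "(\<lambda>z. \<Phi> (h z)) holomorphic_on U"
        using holomorphic_on_compose_gen[OF _ \<Phi>h, of h U] hr by (auto simp: o_def)
    qed
    show "(\<psi> has_derivative (\<lambda>d. Re ((of_real (\<gamma> / 2) * cnj z + F z) * d))) (at z)" if z: "z \<in> U" for z
    proof -
      have 1: "((\<lambda>z. Re (k (h z))) has_derivative (\<lambda>d. Re (k' (h z) * deriv h z * d))) (at z)"
        by (rule has_derivative_Re_field[OF DERIV_chain2[OF k_deriv[OF hr(1)[OF z]] hd[OF z]]])
      have 2: "((\<lambda>z. ln (norm (h z))) has_derivative (\<lambda>d. Re (deriv h z * d / h z))) (at z)"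
        using has_derivative_compose[OF hd[OF z, unfolded has_field_derivative_def]
            has_derivative_ln_norm[OF reg_facts(1)[OF hr(1)[OF z]]]] by simp
      have r: "of_real x * w = x *\<^sub>R w" for x and w :: complex by (simp add: scaleR_conv_of_real)
      have "(\<psi> has_derivative (\<lambda>d. \<gamma> / 4 * (2 * Re (cnj z * d)) - \<gamma> / 4 * Re (k' (h z) * deriv h z * d)
          + c0 / ln lam * Re (deriv h z * d / h z))) (at z)"
      proof -
        have "ln lam \<noteq> 0" using lam by simp
        then have e: "\<psi> = (\<lambda>z. \<gamma> / 4 * (norm z)\<^sup>2 - \<gamma> / 4 * Re (k (h z)) + c0 / ln lam * ln (norm (h z)) + (1 - \<gamma> * lam\<^sup>2 / 4 - c0))"
          by (auto simp: \<psi>_def field_simps)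
        show ?thesis unfolding e
          by (intro has_derivative_add_const has_derivative_add has_derivative_diff has_derivative_mult_right
              has_derivative_norm_sq 1 2)
      qed
      moreover have "\<gamma> / 4 * (2 * Re (cnj z * d)) - \<gamma> / 4 * Re (k' (h z) * deriv h z * d)
          + c0 / ln lam * Re (deriv h z * d / h z) = Re ((of_real (\<gamma> / 2) * cnj z + F z) * d)" for d
      proof -
        have "(of_real (\<gamma> / 2) * cnj z + F z) * d = (\<gamma> / 2) *\<^sub>R (cnj z * d) - (\<gamma> / 4) *\<^sub>R (k' (h z) * deriv h z * d)
          + (c0 / ln lam) *\<^sub>R (deriv h z * d / h z)"
          by (simp add: F_def \<Phi>_def scaleR_conv_of_real algebra_simps)
        then show ?thesis by simp
      qed
      ultimately show ?thesis by simp
    qed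
    show "\<psi> z = 1" if zl: "norm z = lam" for z
    proof -
      obtain \<zeta> where \<zeta>: "norm \<zeta> = lam" "f \<zeta> = z" using inner_circle_surj[OF zl] by blast
      have "h z = \<zeta>" using h(3)[of \<zeta>] \<zeta> circle_in_reg by auto
      then show ?thesis using \<zeta> zl inner_circle(2) by (simp add: \<psi>_def)
    qed
    fix u :: complex assume u: "norm u = 1"
    obtain \<zeta> where \<zeta>: "norm \<zeta> = 1" "f \<zeta> = u * of_real (1 + \<nu> u)" using nu_f[OF u] by blast
    define z where "z = f \<zeta>"
    have \<zeta>r: "\<zeta> \<in> reg" by (rule circle_in_reg) fact
    have hz: "h z = \<zeta>" using h(3) \<zeta>r by (simp add: z_def)
    have "ln lam < 0" using lam by (simp add: ln_less_zero)
    then have c: "c0 * (ln (norm \<zeta>) - ln lam) / ln lam = - c0" using \<zeta>(1) by (simp add: field_simps)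
    have "\<psi> z = 0" unfolding \<psi>_def hz k_boundary[OF \<zeta>(1)] c unfolding z_def[symmetric] c0
      by (simp add: field_simps)
    then show "\<psi> (u * of_real (1 + \<nu> u)) = 0" using \<zeta> by (simp add: z_def)
    define X where "X = of_real (\<gamma> / 2) * cnj z + F z"
    have nz: "f' \<zeta> \<noteq> 0" using h(2)[OF \<zeta>r] df[OF \<zeta>r] by auto
    have fz: "\<zeta> * f' \<zeta> = z * (1 + \<zeta> * g' \<zeta>)" by (simp add: f'_def z_def f_def)
    have "\<zeta> * f' \<zeta> * X = of_real (\<gamma> / 2) * cnj z * (\<zeta> * f' \<zeta>) + \<zeta> * \<Phi> \<zeta> * (f' \<zeta> * deriv h z)"
      unfolding X_def F_def hz by (simp only: distrib_left ac_simps)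
    also have "\<dots> = of_real (\<gamma> / 2) * (z * cnj z) * (1 + \<zeta> * g' \<zeta>) + \<zeta> * \<Phi> \<zeta> * (f' \<zeta> * deriv h z)"
      unfolding fz by (simp only: ac_simps)
    also have "\<dots> = of_real (\<gamma> / 2 * (norm z)\<^sup>2) * (1 + \<zeta> * g' \<zeta>) + \<zeta> * \<Phi> \<zeta>"
      using h(2)[OF \<zeta>r] df[OF \<zeta>r] by (simp add: z_def complex_norm_square[symmetric])
    finally have "(norm (\<zeta> * f' \<zeta> * X))\<^sup>2 = Q * (norm (\<zeta> * f' \<zeta>))\<^sup>2"
      using Q[OF \<zeta>(1)] unfolding fz by (simp only: z_def)
    then have "(norm X)\<^sup>2 * (norm (\<zeta> * f' \<zeta>))\<^sup>2 = Q * (norm (\<zeta> * f' \<zeta>))\<^sup>2"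
      by (simp add: norm_mult power_mult_distrib mult.commute)
    moreover have "(norm (\<zeta> * f' \<zeta>))\<^sup>2 \<noteq> 0" using nz \<zeta>(1) by auto
    ultimately have "(norm X)\<^sup>2 = Q" by (simp only: mult_cancel_right) simp
    then show "(norm (of_real (\<gamma> / 2) * cnj (u * of_real (1 + \<nu> u)) + F (u * of_real (1 + \<nu> u))))\<^sup>2 = Q"
      using \<zeta>(2) by (simp only: X_def z_def)
  qed
qed

end

section \<open>Curves of trigonometric series\<close>

text \<open>The phase makes the class closed under differentiation: a derivative multiplies by the
  frequency and adds \<open>pi / 2\<close> to the phase.\<close>

definition trig_series :: "(nat \<times> nat \<Rightarrow> real) \<Rightarrow> real \<Rightarrow> real \<Rightarrow> real" where
  "trig_series b \<phi> \<theta> = (\<Sum>\<^sub>\<infinity>i. b i * cos (angfreq i * \<theta> + \<phi>))"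

lemma cos_Lipschitz: "\<bar>cos a - cos b\<bar> \<le> \<bar>a - b\<bar>" for a b :: real
  using field_differentiable_bound[of UNIV cos "\<lambda>x. - sin x" 1 a b]
  by (auto intro!: derivative_eq_intros)

lemma cos_Taylor: "\<bar>cos (x + d) - cos x - d * cos (x + pi / 2)\<bar> \<le> d\<^sup>2" for x d :: real
proof (cases "d = 0")
  case False
  have "\<bar>cos (x + d) - cos x - d * cos (x + pi/2)\<bar> \<le> \<bar>d\<bar> * \<bar>d\<bar>"
  proof -
    define F where "F = (\<lambda>y. cos (x + y) - y * cos (x + pi / 2))"
    have "norm (F d - F 0) \<le> \<bar>d\<bar> * norm (d - 0)"
    proof (rule field_differentiable_bound[where S = "{-\<bar>d\<bar>..\<bar>d\<bar>}" and f' = "\<lambda>y. cos (x + y + pi/2) - cos (x + pi/2)"])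
      show "(F has_field_derivative cos (x + y + pi/2) - cos (x + pi/2)) (at y within {-\<bar>d\<bar>..\<bar>d\<bar>})" for y
        unfolding F_def by (auto intro!: derivative_eq_intros simp: cos_add sin_add)
      show "norm (cos (x + y + pi/2) - cos (x + pi/2)) \<le> \<bar>d\<bar>" if "y \<in> {-\<bar>d\<bar>..\<bar>d\<bar>}" for y
        using cos_Lipschitz[of "x + y + pi/2" "x + pi/2"] that by auto
    qed auto
    then show ?thesis by (simp add: F_def)
  qed
  then show ?thesis by (simp add: power2_eq_square flip: abs_mult)
qed simp

text \<open>Three powers of the frequency: two for the second derivative and one that dominates the
  Hoelder seminorm.\<close>

definition wsum :: "(nat \<times> nat \<Rightarrow> real) \<Rightarrow> bool" where
  "wsum b \<longleftrightarrow> (\<lambda>i. \<bar>b i\<bar> * (1 + \<bar>angfreq i\<bar>) ^ 3) summable_on UNIV"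

definition wnorm :: "(nat \<times> nat \<Rightarrow> real) \<Rightarrow> real" where
  "wnorm b = (\<Sum>\<^sub>\<infinity>i. \<bar>b i\<bar> * (1 + \<bar>angfreq i\<bar>) ^ 3)"

lemma angfreq_pow_le: "k \<le> 3 \<Longrightarrow> \<bar>angfreq i\<bar> ^ k \<le> (1 + \<bar>angfreq i\<bar>) ^ 3"
  by (rule order_trans[OF power_mono[of "\<bar>angfreq i\<bar>" "1 + \<bar>angfreq i\<bar>" k] power_increasing]) auto

lemma tr_bound:
  assumes b: "wsum b" and le: "\<And>i. \<bar>f i\<bar> \<le> C * (\<bar>b i\<bar> * (1 + \<bar>angfreq i\<bar>) ^ 3)"
  shows "f summable_on UNIV" "\<bar>infsum f UNIV\<bar> \<le> C * wnorm b"
proof -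
  have s: "(\<lambda>i. C * (\<bar>b i\<bar> * (1 + \<bar>angfreq i\<bar>) ^ 3)) summable_on UNIV"
    using b unfolding wsum_def by (rule summable_on_cmult_right)
  have le': "norm (f i) \<le> C * (\<bar>b i\<bar> * (1 + \<bar>angfreq i\<bar>) ^ 3)" for i using le by simp
  show "f summable_on UNIV" by (rule summable_on_dominated(1)[OF s le'])
  show "\<bar>infsum f UNIV\<bar> \<le> C * wnorm b"
    using summable_on_dominated(3)[OF s le'] b
    by (simp add: wnorm_def wsum_def infsum_cmult_right del: abs_mult)
qed

lemma tr_term:
  assumes "wsum b" "k \<le> 3"
  shows "(\<lambda>i. angfreq i ^ k * b i * cos (angfreq i * \<theta> + \<phi>)) summable_on UNIV"
    "\<bar>trig_series (\<lambda>i. angfreq i ^ k * b i) \<phi> \<theta>\<bar> \<le> wnorm b"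
proof -
  have "\<bar>angfreq i ^ k * b i * cos (angfreq i * \<theta> + \<phi>)\<bar> \<le> 1 * (\<bar>b i\<bar> * (1 + \<bar>angfreq i\<bar>) ^ 3)" for i
  proof -
    have "\<bar>angfreq i\<bar> ^ k * \<bar>b i\<bar> * \<bar>cos (angfreq i * \<theta> + \<phi>)\<bar> \<le> (1 + \<bar>angfreq i\<bar>) ^ 3 * \<bar>b i\<bar> * 1"
      by (intro mult_mono angfreq_pow_le assms) auto
    then show ?thesis by (simp add: abs_mult power_abs mult.commute)
  qed
  from tr_bound[OF assms(1) this]
  show "(\<lambda>i. angfreq i ^ k * b i * cos (angfreq i * \<theta> + \<phi>)) summable_on UNIV"
    "\<bar>trig_series (\<lambda>i. angfreq i ^ k * b i) \<phi> \<theta>\<bar> \<le> wnorm b" by (simp_all add: trig_series_def)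
qed

lemma quotient_bound:
  fixes h x D c :: real
  assumes "h \<noteq> 0" "\<bar>x - h * D\<bar> \<le> \<bar>h\<bar> * c" shows "norm (x / h - D) \<le> c"
proof -
  have "x - h * D = h * (x / h - D)" using assms(1) by (simp add: field_simps)
  then have "\<bar>h\<bar> * \<bar>x / h - D\<bar> \<le> \<bar>h\<bar> * c" using assms(2) by (simp only: abs_mult)
  then show ?thesis using assms(1) by simp
qed

lemma tr_deriv:
  assumes b: "wsum b" and k: "k \<le> 1"
  shows "(trig_series (\<lambda>i. angfreq i ^ k * b i) \<phi> has_real_derivative trig_series (\<lambda>i. angfreq i ^ Suc k * b i) (\<phi> + pi/2) \<theta>) (at \<theta>)"
proof -
  let ?f = "trig_series (\<lambda>i. angfreq i ^ k * b i) \<phi>" let ?D = "trig_series (\<lambda>i. angfreq i ^ Suc k * b i) (\<phi> + pi/2) \<theta>"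
  have est: "\<bar>?f (\<theta> + h) - ?f \<theta> - h * ?D\<bar> \<le> h\<^sup>2 * wnorm b" for h
  proof -
    let ?t = "\<lambda>i. angfreq i ^ k * b i * cos (angfreq i * (\<theta> + h) + \<phi>) - angfreq i ^ k * b i * cos (angfreq i * \<theta> + \<phi>)
       - h * (angfreq i ^ Suc k * b i * cos (angfreq i * \<theta> + (\<phi> + pi/2)))"
    have "\<bar>?t i\<bar> \<le> h\<^sup>2 * (\<bar>b i\<bar> * (1 + \<bar>angfreq i\<bar>) ^ 3)" for i
    proof -
      define x where "x = angfreq i * \<theta> + \<phi>"
      have "?t i = angfreq i ^ k * b i * (cos (x + angfreq i * h) - cos x - (angfreq i * h) * cos (x + pi/2))"
        by (simp add: x_def algebra_simps)
      also have "\<bar>\<dots>\<bar> \<le> \<bar>angfreq i\<bar> ^ k * \<bar>b i\<bar> * (angfreq i * h)\<^sup>2"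
        unfolding abs_mult power_abs by (intro mult_left_mono cos_Taylor) auto
      also have "\<dots> = h\<^sup>2 * (\<bar>b i\<bar> * \<bar>angfreq i\<bar> ^ (k + 2))"
        by (simp add: power_add power_mult_distrib power2_eq_square)
      also have "\<dots> \<le> h\<^sup>2 * (\<bar>b i\<bar> * (1 + \<bar>angfreq i\<bar>) ^ 3)"
        by (intro mult_left_mono angfreq_pow_le) (use k in auto)
      finally show ?thesis .
    qed
    from tr_bound(2)[OF b this] have 1: "\<bar>infsum ?t UNIV\<bar> \<le> h\<^sup>2 * wnorm b" .
    have s: "(\<lambda>i. angfreq i ^ k * b i * cos (angfreq i * x + \<phi>)) summable_on UNIV" for x
      by (rule tr_term(1)[OF b]) (use k in simp)
    have s': "(\<lambda>i. h * (angfreq i ^ Suc k * b i * cos (angfreq i * \<theta> + (\<phi> + pi/2)))) summable_on UNIV"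
      by (intro summable_on_cmult_right tr_term(1)[OF b]) (use k in simp)
    have "infsum ?t UNIV = ?f (\<theta> + h) - ?f \<theta> - h * ?D"
      unfolding trig_series_def infsum_diff(2)[OF infsum_diff(1)[OF s s] s'] infsum_diff(2)[OF s s] infsum_cmult_right' ..
    with 1 show ?thesis by simp
  qed
  have "((\<lambda>h. (?f (\<theta> + h) - ?f \<theta>) / h - ?D) \<longlongrightarrow> 0) (at 0)"
  proof (rule Lim_null_comparison)
    show "\<forall>\<^sub>F h in at 0. norm ((?f (\<theta> + h) - ?f \<theta>) / h - ?D) \<le> \<bar>h\<bar> * wnorm b"
      unfolding eventually_at_filter
    proof (intro always_eventually allI impI)
      fix h :: real assume h: "h \<noteq> 0"
      show "norm ((?f (\<theta> + h) - ?f \<theta>) / h - ?D) \<le> \<bar>h\<bar> * wnorm b"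
        by (rule quotient_bound[OF h]) (use est[of h] in \<open>simp add: power2_eq_square flip: mult.assoc abs_mult\<close>)
    qed
    show "((\<lambda>h. \<bar>h\<bar> * wnorm b) \<longlongrightarrow> 0) (at 0)" by (auto intro!: tendsto_eq_intros)
  qed
  then show ?thesis unfolding DERIV_def by (rule LIM_zero_cancel)
qed

lemma min_two_powr:
  fixes y :: real assumes "0 < y" "0 < \<alpha>" "\<alpha> < 1" shows "min 2 y \<le> 2 * y powr \<alpha>"
proof (cases "y \<le> 1")
  case True
  then have "y powr 1 \<le> y powr \<alpha>" using assms by (intro powr_mono') auto
  then show ?thesis using assms by auto
next
  case False
  then have "1 \<le> y powr \<alpha>" using assms by (intro ge_one_powr_ge_zero) auto
  then show ?thesis by simp
qed

text \<open>Interpolation between the bounds 2 and |a - b| for the difference of two cosines. A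
  nonzero frequency is at least 1 in modulus, so its power \<open>\<alpha>\<close> is dominated by
  the frequency itself.\<close>

lemma tr_second_holder:
  assumes b: "wsum b" and \<alpha>: "0 < \<alpha>" "\<alpha> < 1"
  shows "\<bar>trig_series (\<lambda>i. angfreq i ^ 2 * b i) \<phi> x - trig_series (\<lambda>i. angfreq i ^ 2 * b i) \<phi> y\<bar> \<le> 2 * wnorm b * \<bar>x - y\<bar> powr \<alpha>"
proof -
  let ?t = "\<lambda>i. angfreq i ^ 2 * b i * cos (angfreq i * x + \<phi>) - angfreq i ^ 2 * b i * cos (angfreq i * y + \<phi>)"
  have "\<bar>?t i\<bar> \<le> 2 * \<bar>x - y\<bar> powr \<alpha> * (\<bar>b i\<bar> * (1 + \<bar>angfreq i\<bar>) ^ 3)" for i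
  proof (cases "angfreq i = 0 \<or> x = y")
    case False
    then have k1: "1 \<le> \<bar>angfreq i\<bar>" unfolding abs_angfreq using abs_angfreq[of i] by (cases "wavenum i") auto
    have "\<bar>cos (angfreq i * x + \<phi>) - cos (angfreq i * y + \<phi>)\<bar> \<le> min 2 (\<bar>angfreq i\<bar> * \<bar>x - y\<bar>)"
    proof (rule min.boundedI)
      show "\<bar>cos (angfreq i * x + \<phi>) - cos (angfreq i * y + \<phi>)\<bar> \<le> 2"
        using abs_cos_le_one[of "angfreq i * x + \<phi>"] abs_cos_le_one[of "angfreq i * y + \<phi>"] by linarith
      show "\<bar>cos (angfreq i * x + \<phi>) - cos (angfreq i * y + \<phi>)\<bar> \<le> \<bar>angfreq i\<bar> * \<bar>x - y\<bar>"
        using cos_Lipschitz[of "angfreq i * x + \<phi>" "angfreq i * y + \<phi>"] by (simp add: abs_mult[symmetric] algebra_simps)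
    qed
    also have "\<dots> \<le> 2 * (\<bar>angfreq i\<bar> * \<bar>x - y\<bar>) powr \<alpha>"
      by (rule min_two_powr) (use False \<alpha> in auto)
    also have "\<dots> = 2 * (\<bar>angfreq i\<bar> powr \<alpha> * \<bar>x - y\<bar> powr \<alpha>)" by (simp add: powr_mult)
    also have "\<bar>angfreq i\<bar> powr \<alpha> \<le> \<bar>angfreq i\<bar> powr 1" using k1 \<alpha> by (intro powr_mono) auto
    finally have c: "\<bar>cos (angfreq i * x + \<phi>) - cos (angfreq i * y + \<phi>)\<bar> \<le> 2 * (\<bar>angfreq i\<bar> * \<bar>x - y\<bar> powr \<alpha>)"
      by (simp add: mult_right_mono)
    have "\<bar>?t i\<bar> = \<bar>angfreq i\<bar> ^ 2 * \<bar>b i\<bar> * \<bar>cos (angfreq i * x + \<phi>) - cos (angfreq i * y + \<phi>)\<bar>"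
      by (simp add: abs_mult flip: right_diff_distrib)
    also have "\<dots> \<le> \<bar>angfreq i\<bar> ^ 2 * \<bar>b i\<bar> * (2 * (\<bar>angfreq i\<bar> * \<bar>x - y\<bar> powr \<alpha>))"
      by (intro mult_left_mono c) auto
    also have "\<dots> = 2 * \<bar>x - y\<bar> powr \<alpha> * (\<bar>b i\<bar> * \<bar>angfreq i\<bar> ^ 3)"
      by (simp add: power3_eq_cube power2_eq_square)
    also have "\<dots> \<le> 2 * \<bar>x - y\<bar> powr \<alpha> * (\<bar>b i\<bar> * (1 + \<bar>angfreq i\<bar>) ^ 3)"
      by (intro mult_left_mono angfreq_pow_le) auto
    finally show ?thesis .
  qed auto
  from tr_bound(2)[OF b this]
  have 1: "\<bar>infsum ?t UNIV\<bar> \<le> 2 * \<bar>x - y\<bar> powr \<alpha> * wnorm b" .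
  have s: "(\<lambda>i. angfreq i ^ 2 * b i * cos (angfreq i * x + \<phi>)) summable_on UNIV" for x
    by (rule tr_term(1)[OF b]) simp
  show ?thesis using 1 unfolding trig_series_def infsum_diff(2)[OF s s] by (simp add: algebra_simps)
qed

text \<open>The suprema run over bounded nonempty sets. The constant is 5 = 1 + 1 + 1 + 2, the last
  summand from the Hoelder quotient.\<close>

lemma tr_C2:
  assumes b: "wsum b" and \<alpha>: "0 < \<alpha>" "\<alpha> < 1"
  shows "trig_series b 0 \<in> C2_circle \<alpha>" "0 \<le> C2_norm \<alpha> (trig_series b 0)" "C2_norm \<alpha> (trig_series b 0) \<le> 5 * wnorm b"
proof -
  have d1: "(trig_series b 0 has_real_derivative trig_series (\<lambda>i. angfreq i ^ 1 * b i) (pi/2) \<theta>) (at \<theta>)" for \<theta>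
    using tr_deriv[OF b, of 0 0 \<theta>] by simp
  then have e1: "deriv (trig_series b 0) = trig_series (\<lambda>i. angfreq i ^ 1 * b i) (pi/2)" by (auto intro: DERIV_imp_deriv)
  have d2: "(trig_series (\<lambda>i. angfreq i ^ 1 * b i) (pi/2) has_real_derivative trig_series (\<lambda>i. angfreq i ^ 2 * b i) (pi/2 + pi/2) \<theta>) (at \<theta>)" for \<theta>
    using tr_deriv[OF b, of 1 "pi/2" \<theta>] by (simp add: numeral_2_eq_2)
  then have e2: "deriv (deriv (trig_series b 0)) = trig_series (\<lambda>i. angfreq i ^ 2 * b i) (pi/2 + pi/2)"
    unfolding e1 by (auto intro: DERIV_imp_deriv)
  have per: "trig_series b 0 (\<theta> + 2 * pi) = trig_series b 0 \<theta>" for \<theta>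
    unfolding trig_series_def
  proof (intro infsum_cong)
    fix i
    have "angfreq i * (\<theta> + 2 * pi) + 0 = (angfreq i * \<theta> + 0) + 2 * pi * of_int (int (fst i) - int (snd i))"
      by (simp add: angfreq_def algebra_simps)
    then show "b i * cos (angfreq i * (\<theta> + 2 * pi) + 0) = b i * cos (angfreq i * \<theta> + 0)"
      by (metis cos_add cos_int_2pin mult.right_neutral mult_zero_right sin_int_2pin diff_zero)
  qed
  note hold = tr_second_holder[OF b \<alpha>, of "pi/2 + pi/2"]
  show "trig_series b 0 \<in> C2_circle \<alpha>"
    unfolding C2_circle_def holder_on_def mem_Collect_eq e2
  proof (intro conjI allI)
    show "trig_series b 0 differentiable at \<theta>" for \<theta> using d1 real_differentiable_def by blast
    show "deriv (trig_series b 0) differentiable at \<theta>" for \<theta> unfolding e1 using d2 real_differentiable_def by blast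
    show "\<exists>C. \<forall>x\<in>UNIV. \<forall>y\<in>UNIV. dist (trig_series (\<lambda>i. (angfreq i)\<^sup>2 * b i) (pi / 2 + pi / 2) x) (trig_series (\<lambda>i. (angfreq i)\<^sup>2 * b i) (pi / 2 + pi / 2) y)
        \<le> C * dist x y powr \<alpha>"
      using hold by (intro exI[of _ "2 * wnorm b"]) (auto simp: dist_real_def)
  qed (rule per)
  have t0: "\<bar>trig_series b 0 \<theta>\<bar> \<le> wnorm b" for \<theta> using tr_term(2)[OF b, of 0 0 \<theta>] by simp
  have t1: "\<bar>deriv (trig_series b 0) \<theta>\<bar> \<le> wnorm b" for \<theta> unfolding e1 by (rule tr_term(2)[OF b]) simp
  have t2: "\<bar>deriv (deriv (trig_series b 0)) \<theta>\<bar> \<le> wnorm b" for \<theta> unfolding e2 by (rule tr_term(2)[OF b]) simp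
  have t3: "\<bar>deriv (deriv (trig_series b 0)) \<theta> - deriv (deriv (trig_series b 0)) \<phi>\<bar> / \<bar>\<theta> - \<phi>\<bar> powr \<alpha> \<le> 2 * wnorm b" if "\<theta> \<noteq> \<phi>" for \<theta> \<phi>
    unfolding e2 using hold[of \<theta> \<phi>] that by (simp add: pos_divide_le_eq)
  let ?H = "{\<bar>deriv (deriv (trig_series b 0)) \<theta> - deriv (deriv (trig_series b 0)) \<phi>\<bar> / \<bar>\<theta> - \<phi>\<bar> powr \<alpha> | \<theta> \<phi>. \<theta> \<noteq> \<phi>}"
  have sup: "0 \<le> (SUP \<theta>. \<bar>f \<theta>\<bar>) \<and> (SUP \<theta>. \<bar>f \<theta>\<bar>) \<le> w" if "\<And>\<theta>. \<bar>f \<theta>\<bar> \<le> w" for f :: "real \<Rightarrow> real" and w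
  proof
    have "bdd_above (range (\<lambda>\<theta>. \<bar>f \<theta>\<bar>))" using that by (intro bdd_aboveI2) auto
    then have "\<bar>f 0\<bar> \<le> (SUP \<theta>. \<bar>f \<theta>\<bar>)" by (intro cSUP_upper) auto
    then show "0 \<le> (SUP \<theta>. \<bar>f \<theta>\<bar>)" by simp
    show "(SUP \<theta>. \<bar>f \<theta>\<bar>) \<le> w" by (intro cSUP_least that) auto
  qed
  have H: "0 \<le> Sup ?H" "Sup ?H \<le> 2 * wnorm b"
  proof -
    let ?x = "\<bar>deriv (deriv (trig_series b 0)) 0 - deriv (deriv (trig_series b 0)) 1\<bar> / \<bar>0 - 1\<bar> powr \<alpha>"
    have m: "?x \<in> ?H" by force
    have "bdd_above ?H" using t3 by (intro bdd_aboveI[of _ "2 * wnorm b"]) auto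
    from cSup_upper[OF m this] show "0 \<le> Sup ?H" by (rule order_trans[rotated]) simp
    show "Sup ?H \<le> 2 * wnorm b" using m t3 by (intro cSup_least) auto
  qed
  show "0 \<le> C2_norm \<alpha> (trig_series b 0)" "C2_norm \<alpha> (trig_series b 0) \<le> 5 * wnorm b"
    unfolding C2_norm_def
    using sup[of "trig_series b 0", OF t0] sup[of "deriv (trig_series b 0)", OF t1] sup[of "deriv (deriv (trig_series b 0))", OF t2] H
    by linarith+
qed

section \<open>Differentiability in the parameter\<close>

definition tdeg :: "nat \<times> nat \<Rightarrow> nat" where "tdeg i = fst i + snd i"

text \<open>For |s| <= 1/2 the geometric factor in the degree outweighs three derivatives in the
  angle and two in \<open>s\<close>, so the unweighted norm of a series controls the whole
  curve.\<close>

lemma weight_bounded: "\<exists>W>0. \<forall>i. (1 + \<bar>angfreq i\<bar>) ^ 3 * (real (tdeg i) ^ 2 + 1) * (1/2) ^ tdeg i \<le> W"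
proof -
  have "(\<lambda>n. (1 + real n) ^ 3 * (real n ^ 2 + 1) * (1/2) ^ n) \<longlonglongrightarrow> 0" by real_asymp
  then have "Bseq (\<lambda>n. (1 + real n) ^ 3 * (real n ^ 2 + 1) * (1/2) ^ n)"
    by (intro convergent_imp_Bseq) (auto simp: convergent_def)
  then obtain W where W: "W > 0" "\<And>n. norm ((1 + real n) ^ 3 * (real n ^ 2 + 1) * (1/2) ^ n) \<le> W"
    by (auto simp: Bseq_def)
  have "(1 + \<bar>angfreq i\<bar>) ^ 3 * (real (tdeg i) ^ 2 + 1) * (1/2) ^ tdeg i \<le> W" for i
  proof -
    have "\<bar>angfreq i\<bar> \<le> real (tdeg i)" by (auto simp: angfreq_def tdeg_def)
    then have "(1 + \<bar>angfreq i\<bar>) ^ 3 * (real (tdeg i) ^ 2 + 1) * (1/2) ^ tdeg i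
        \<le> (1 + real (tdeg i)) ^ 3 * (real (tdeg i) ^ 2 + 1) * (1/2) ^ tdeg i"
      by (intro mult_right_mono power_mono) auto
    also have "\<dots> \<le> W" using W(2)[of "tdeg i"] by (simp only: real_norm_def abs_le_iff)
    finally show ?thesis .
  qed
  then show ?thesis using W(1) by blast
qed

lemma dominated_wnorm:
  obtains W where "W > 0" 
    "\<And>a b C. 0 \<le> C \<Longrightarrow> (\<And>i. \<bar>b i\<bar> \<le> C * \<bar>dcoeff a i\<bar> * ((real (tdeg i) ^ 2 + 1) * (1/2) ^ tdeg i)) \<Longrightarrow> wsum b \<and> wnorm b \<le> C * W * norm a"
proof -
  obtain W where W: "W > 0" "\<And>i. (1 + \<bar>angfreq i\<bar>) ^ 3 * (real (tdeg i) ^ 2 + 1) * (1/2) ^ tdeg i \<le> W"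
    using weight_bounded by blast
  have "wsum b \<and> wnorm b \<le> C * W * norm a"
    if C: "0 \<le> C" and b: "\<And>i. \<bar>b i\<bar> \<le> C * \<bar>dcoeff a i\<bar> * ((real (tdeg i) ^ 2 + 1) * (1/2) ^ tdeg i)" for a b C
  proof -
    have s: "(\<lambda>i. C * W * \<bar>dcoeff a i\<bar>) summable_on UNIV" by (intro summable_on_cmult_right) simp
    have le: "norm (\<bar>b i\<bar> * (1 + \<bar>angfreq i\<bar>) ^ 3) \<le> C * W * \<bar>dcoeff a i\<bar>" for i
    proof -
      have "\<bar>b i\<bar> * (1 + \<bar>angfreq i\<bar>) ^ 3 \<le> C * \<bar>dcoeff a i\<bar> * ((real (tdeg i) ^ 2 + 1) * (1/2) ^ tdeg i) * (1 + \<bar>angfreq i\<bar>) ^ 3"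
        by (intro mult_right_mono b) auto
      also have "\<dots> = C * \<bar>dcoeff a i\<bar> * ((1 + \<bar>angfreq i\<bar>) ^ 3 * (real (tdeg i) ^ 2 + 1) * (1/2) ^ tdeg i)"
        by (simp only: ac_simps)
      also have "\<dots> \<le> C * \<bar>dcoeff a i\<bar> * W" using C by (intro mult_left_mono W) auto
      finally show ?thesis by (simp add: ac_simps)
    qed
    show ?thesis
      using summable_on_dominated(1)[OF s le] summable_on_dominated(3)[OF s le]
      by (simp add: wsum_def wnorm_def norm_dps_def infsum_cmult_right' del: abs_mult)
  qed
  then show thesis using W(1) that by blast
qed

definition curve :: "dps \<Rightarrow> real \<Rightarrow> nat \<times> nat \<Rightarrow> real" where "curve a s i = dcoeff a i * s ^ tdeg i"
text \<open>The termwise derivative in \<open>s\<close>. At degree 0 the truncated exponent is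
  harmless because the factor \<open>tdeg i\<close> vanishes.\<close>

definition curve' :: "dps \<Rightarrow> real \<Rightarrow> nat \<times> nat \<Rightarrow> real" where
  "curve' a s i = dcoeff a i * (real (tdeg i) * s ^ (tdeg i - 1))"

lemma power_half_diff:
  fixes x y :: real assumes "\<bar>x\<bar> \<le> 1/2" "\<bar>y\<bar> \<le> 1/2"
  shows "\<bar>x ^ j - y ^ j\<bar> \<le> 2 * real j * \<bar>x - y\<bar> * (1/2) ^ j"
proof (induction j)
  case (Suc j)
  have "x ^ Suc j - y ^ Suc j = x * (x ^ j - y ^ j) + (x - y) * y ^ j" by (simp add: algebra_simps)
  also have "\<bar>\<dots>\<bar> \<le> \<bar>x\<bar> * \<bar>x ^ j - y ^ j\<bar> + \<bar>x - y\<bar> * \<bar>y\<bar> ^ j"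
    by (rule order_trans[OF abs_triangle_ineq]) (simp add: abs_mult power_abs)
  also have "\<dots> \<le> 1/2 * (2 * real j * \<bar>x - y\<bar> * (1/2) ^ j) + \<bar>x - y\<bar> * (1/2) ^ j"
    by (intro add_mono mult_mono mult_left_mono power_mono Suc assms) auto
  also have "\<dots> = 2 * real (Suc j) * \<bar>x - y\<bar> * (1/2) ^ Suc j" by (simp add: algebra_simps)
  finally show ?case .
qed simp

text \<open>The remainders satisfy R(j+1) = x R(j) + j (x - y)^2 y^(j-1).\<close>

lemma power_half_Taylor:
  fixes x y :: real assumes "\<bar>x\<bar> \<le> 1/2" "\<bar>y\<bar> \<le> 1/2"
  shows "\<bar>x ^ j - y ^ j - (x - y) * (real j * y ^ (j - 1))\<bar> \<le> 4 * real j ^ 2 * (x - y)\<^sup>2 * (1/2) ^ j"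
proof (induction j)
  case (Suc j)
  have e: "x ^ Suc j - y ^ Suc j - (x - y) * (real (Suc j) * y ^ (Suc j - 1))
      = x * (x ^ j - y ^ j - (x - y) * (real j * y ^ (j - 1))) + real j * (x - y)\<^sup>2 * y ^ (j - 1)"
    by (cases j) (auto simp: algebra_simps power2_eq_square)
  have "real j * (x - y)\<^sup>2 * \<bar>y\<bar> ^ (j - 1) \<le> real j * (x - y)\<^sup>2 * (1/2) ^ (j - 1)"
    by (intro mult_left_mono power_mono assms) auto
  also have "\<dots> = 2 * real j * (x - y)\<^sup>2 * (1/2) ^ j" by (cases j) auto
  finally have 2: "real j * (x - y)\<^sup>2 * \<bar>y\<bar> ^ (j - 1) \<le> 2 * real j * (x - y)\<^sup>2 * (1/2) ^ j" .
  have "\<bar>x ^ Suc j - y ^ Suc j - (x - y) * (real (Suc j) * y ^ (Suc j - 1))\<bar>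
     \<le> \<bar>x\<bar> * \<bar>x ^ j - y ^ j - (x - y) * (real j * y ^ (j - 1))\<bar> + real j * (x - y)\<^sup>2 * \<bar>y\<bar> ^ (j - 1)"
    unfolding e by (rule order_trans[OF abs_triangle_ineq]) (simp add: abs_mult power_abs)
  also have "\<dots> \<le> 1/2 * (4 * real j ^ 2 * (x - y)\<^sup>2 * (1/2) ^ j) + 2 * real j * (x - y)\<^sup>2 * (1/2) ^ j"
    by (intro add_mono mult_mono Suc 2 assms) auto
  also have "\<dots> = 4 * (real j ^ 2 + real j) * (x - y)\<^sup>2 * (1/2) ^ Suc j" by (simp add: algebra_simps)
  also have "\<dots> \<le> 4 * real (Suc j) ^ 2 * (x - y)\<^sup>2 * (1/2) ^ Suc j"
  proof -
    have "real j ^ 2 + real j \<le> real (Suc j) ^ 2" by (simp add: power2_eq_square algebra_simps)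
    then show ?thesis by (intro mult_right_mono mult_left_mono) auto
  qed
  finally show ?case .
qed simp

lemma curve_bounds:
  assumes s: "\<bar>s\<bar> \<le> 1/2" and t: "\<bar>t\<bar> \<le> 1/2"
  shows "\<bar>curve a s i\<bar> \<le> 1 * \<bar>dcoeff a i\<bar> * ((real (tdeg i) ^ 2 + 1) * (1/2) ^ tdeg i)"
    "\<bar>curve' a s i\<bar> \<le> 2 * \<bar>dcoeff a i\<bar> * ((real (tdeg i) ^ 2 + 1) * (1/2) ^ tdeg i)"
    "\<bar>curve a s i - curve a t i - (s - t) * curve' a t i\<bar> \<le> 4 * (s - t)\<^sup>2 * \<bar>dcoeff a i\<bar> * ((real (tdeg i) ^ 2 + 1) * (1/2) ^ tdeg i)"
    "\<bar>curve' a s i - curve' a t i\<bar> \<le> 4 * \<bar>s - t\<bar> * \<bar>dcoeff a i\<bar> * ((real (tdeg i) ^ 2 + 1) * (1/2) ^ tdeg i)"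
proof -
  define j where "j = tdeg i"
  have sp: "\<bar>s\<bar> ^ n \<le> (1/2) ^ n" for n by (intro power_mono s) auto
  have j2: "real j \<le> real j ^ 2" by (cases j) (auto simp: power2_eq_square)
  have half: "real j * (1/2) ^ (j - 1) = 2 * real j * (1/2) ^ j" by (cases j) auto
  have w: "(1/2) ^ j \<le> (real j ^ 2 + 1) * (1/2 :: real) ^ j"
    using mult_right_mono[of 1 "real j ^ 2 + 1" "(1/2) ^ j"] by simp
  have m: "\<bar>dcoeff a i\<bar> * x \<le> \<bar>dcoeff a i\<bar> * y" if "x \<le> y" for x y by (intro mult_left_mono that) auto
  show "\<bar>curve a s i\<bar> \<le> 1 * \<bar>dcoeff a i\<bar> * ((real (tdeg i) ^ 2 + 1) * (1/2) ^ tdeg i)"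
    using m[OF order_trans[OF sp w]] by (simp add: curve_def abs_mult power_abs j_def)
  have "real j * \<bar>s\<bar> ^ (j - 1) \<le> real j * (1/2) ^ (j - 1)" by (intro mult_left_mono sp) auto
  also have "\<dots> \<le> 2 * ((real j ^ 2 + 1) * (1/2) ^ j)" unfolding half mult.assoc
  proof -
    have "real j \<le> real j ^ 2 + 1" using j2 by linarith
    then show "2 * (real j * (1/2) ^ j) \<le> 2 * ((real j ^ 2 + 1) * (1/2) ^ j)"
      by (intro mult_left_mono mult_right_mono) auto
  qed
  finally show "\<bar>curve' a s i\<bar> \<le> 2 * \<bar>dcoeff a i\<bar> * ((real (tdeg i) ^ 2 + 1) * (1/2) ^ tdeg i)"
    using m by (fastforce simp: curve'_def abs_mult power_abs j_def ac_simps)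
  have "curve a s i - curve a t i - (s - t) * curve' a t i = dcoeff a i * (s ^ j - t ^ j - (s - t) * (real j * t ^ (j - 1)))"
    by (simp add: curve_def curve'_def j_def algebra_simps)
  also have "\<bar>\<dots>\<bar> \<le> \<bar>dcoeff a i\<bar> * (4 * real j ^ 2 * (s - t)\<^sup>2 * (1/2) ^ j)"
    unfolding abs_mult by (intro m power_half_Taylor s t)
  also have "\<dots> \<le> \<bar>dcoeff a i\<bar> * (4 * (real j ^ 2 + 1) * (s - t)\<^sup>2 * (1/2) ^ j)"
    by (intro m mult_right_mono mult_left_mono) auto
  finally show "\<bar>curve a s i - curve a t i - (s - t) * curve' a t i\<bar> \<le> 4 * (s - t)\<^sup>2 * \<bar>dcoeff a i\<bar> * ((real (tdeg i) ^ 2 + 1) * (1/2) ^ tdeg i)"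
    by (simp only: j_def ac_simps)
  have "real j * \<bar>s ^ (j - 1) - t ^ (j - 1)\<bar> \<le> real j * (2 * real (j - 1) * \<bar>s - t\<bar> * (1/2) ^ (j - 1))"
    by (intro mult_left_mono power_half_diff s t) auto
  also have "\<dots> = (real j * (1/2) ^ (j - 1)) * (2 * real (j - 1) * \<bar>s - t\<bar>)" by (simp only: ac_simps)
  also have "\<dots> = (real j * real (j - 1)) * (4 * \<bar>s - t\<bar> * (1/2) ^ j)" unfolding half by (simp only: ac_simps)
  also have "\<dots> \<le> (real j ^ 2 + 1) * (4 * \<bar>s - t\<bar> * (1/2) ^ j)"
    by (intro mult_right_mono) (cases j, auto simp: power2_eq_square algebra_simps)
  finally have "\<bar>dcoeff a i\<bar> * (real j * \<bar>s ^ (j - 1) - t ^ (j - 1)\<bar>) \<le> \<bar>dcoeff a i\<bar> * ((real j ^ 2 + 1) * (4 * \<bar>s - t\<bar> * (1/2) ^ j))"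
    by (rule m)
  moreover have "curve' a s i - curve' a t i = dcoeff a i * (real j * (s ^ (j - 1) - t ^ (j - 1)))"
    by (simp add: curve'_def j_def algebra_simps)
  ultimately show "\<bar>curve' a s i - curve' a t i\<bar> \<le> 4 * \<bar>s - t\<bar> * \<bar>dcoeff a i\<bar> * ((real (tdeg i) ^ 2 + 1) * (1/2) ^ tdeg i)"
    by (simp only: abs_mult abs_of_nat j_def ac_simps)
qed

lemma tr_diff: "wsum b \<Longrightarrow> wsum b' \<Longrightarrow> trig_series (\<lambda>i. b i - b' i) \<phi> \<theta> = trig_series b \<phi> \<theta> - trig_series b' \<phi> \<theta>"
  using infsum_diff(2)[OF tr_term(1)[of b 0 \<theta> \<phi>] tr_term(1)[of b' 0 \<theta> \<phi>]]
  by (simp add: trig_series_def left_diff_distrib)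

lemma tr_cmult: "trig_series (\<lambda>i. c * b i) \<phi> \<theta> = c * trig_series b \<phi> \<theta>"
  by (simp add: trig_series_def mult.assoc infsum_cmult_right')

lemma curve_wsum:
  assumes "\<bar>s\<bar> \<le> 1/2" shows "wsum (curve a s)" "wsum (curve' a s)"
proof -
  obtain W where W: "\<And>a b C. 0 \<le> C \<Longrightarrow> (\<And>i. \<bar>b i\<bar> \<le> C * \<bar>dcoeff a i\<bar> * ((real (tdeg i) ^ 2 + 1) * (1/2) ^ tdeg i)) \<Longrightarrow> wsum b \<and> wnorm b \<le> C * W * norm a"
    using dominated_wnorm by metis
  show "wsum (curve a s)" using W[of 1, OF _ curve_bounds(1)[OF assms assms]] by simp
  show "wsum (curve' a s)" using W[of 2, OF _ curve_bounds(2)[OF assms assms]] by simp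
qed

lemma wsum_diff_cmult:
  assumes "wsum b" "wsum b'" shows "wsum (\<lambda>i. b i - b' i)" "wsum (\<lambda>i. c * b i)"
proof -
  have s: "(\<lambda>i. \<bar>b i\<bar> * (1 + \<bar>angfreq i\<bar>) ^ 3 + \<bar>b' i\<bar> * (1 + \<bar>angfreq i\<bar>) ^ 3) summable_on UNIV"
    by (intro summable_on_add) (use assms in \<open>auto simp: wsum_def\<close>)
  have "norm (\<bar>b i - b' i\<bar> * (1 + \<bar>angfreq i\<bar>) ^ 3) \<le> \<bar>b i\<bar> * (1 + \<bar>angfreq i\<bar>) ^ 3 + \<bar>b' i\<bar> * (1 + \<bar>angfreq i\<bar>) ^ 3" for i
    by (simp add: mult_right_mono flip: distrib_right)
  then show "wsum (\<lambda>i. b i - b' i)" unfolding wsum_def by (rule summable_on_dominated(1)[OF s])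
  show "wsum (\<lambda>i. c * b i)" using summable_on_cmult_right[OF assms(1)[unfolded wsum_def], of "\<bar>c\<bar>"]
    by (simp add: wsum_def abs_mult mult.assoc)
qed

text \<open>Each difference to be estimated is again a trigonometric series, so both limits reduce
  to the coefficient bounds \<open>curve_bounds\<close>.\<close>

lemma C1_curve_tr:
  assumes \<alpha>: "0 < \<alpha>" "\<alpha> < 1" and s0: "s0 \<le> 1/2"
  shows "C1_curve \<alpha> {-s0<..<s0} (\<lambda>s. trig_series (curve a s) 0)"
proof -
  obtain W where W: "W > 0" "\<And>a b C. 0 \<le> C \<Longrightarrow> (\<And>i. \<bar>b i\<bar> \<le> C * \<bar>dcoeff a i\<bar> * ((real (tdeg i) ^ 2 + 1) * (1/2) ^ tdeg i)) \<Longrightarrow> wsum b \<and> wnorm b \<le> C * W * norm a"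
    using dominated_wnorm by metis
  have C2: "wsum b \<Longrightarrow> trig_series b 0 \<in> C2_circle \<alpha>" for b by (rule tr_C2[OF _ \<alpha>])
  have ev_near: "\<forall>\<^sub>F t in at s. \<bar>t\<bar> \<le> 1/2" if "s \<in> {-s0<..<s0}" for s
  proof -
    have "\<forall>\<^sub>F t in at s. t \<in> {-s0<..<s0}" by (rule eventually_at_in_open') (use that in auto)
    then show ?thesis by eventually_elim (use s0 in auto)
  qed
  show ?thesis
    unfolding C1_curve_def
  proof (intro conjI ballI exI[of _ "\<lambda>s. trig_series (curve' a s) 0"])
    fix s assume S: "s \<in> {-s0<..<s0}"
    then have s: "\<bar>s\<bar> \<le> 1/2" using s0 by auto
    show "trig_series (curve a s) 0 \<in> C2_circle \<alpha>" "trig_series (curve' a s) 0 \<in> C2_circle \<alpha>"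
      using curve_wsum[OF s] C2 by auto
    show "((\<lambda>h. C2_norm \<alpha> (\<lambda>\<theta>. (trig_series (curve a (s + h)) 0 \<theta> - trig_series (curve a s) 0 \<theta>) / h - trig_series (curve' a s) 0 \<theta>)) \<longlongrightarrow> 0) (at 0)"
    proof (rule Lim_null_comparison)
      have "\<forall>\<^sub>F h in at 0. \<bar>s + h\<bar> \<le> 1/2 \<and> h \<noteq> 0"
        using ev_near[OF S] unfolding at_to_0[of s] eventually_filtermap
        by (auto simp: add.commute eventually_conj_iff eventually_neq_at_within)
      then show "\<forall>\<^sub>F h in at 0. norm (C2_norm \<alpha> (\<lambda>\<theta>. (trig_series (curve a (s + h)) 0 \<theta> - trig_series (curve a s) 0 \<theta>) / h - trig_series (curve' a s) 0 \<theta>))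
          \<le> 5 * (4 * \<bar>h\<bar> * W * norm a)"
      proof eventually_elim
        case (elim h)
        then have h: "\<bar>s + h\<bar> \<le> 1/2" "h \<noteq> 0" by auto
        define b where "b = (\<lambda>i. (1/h) * (curve a (s + h) i - curve a s i) - curve' a s i)"
        have eq: "(\<lambda>\<theta>. (trig_series (curve a (s + h)) 0 \<theta> - trig_series (curve a s) 0 \<theta>) / h - trig_series (curve' a s) 0 \<theta>) = trig_series b 0"
        proof -
          note w = curve_wsum(1)[OF h(1), of a] curve_wsum(1)[OF s, of a]
          note w' = wsum_diff_cmult(2)[OF wsum_diff_cmult(1)[OF w] w(1), of "1/h"]
          show ?thesis unfolding b_def
            by (simp only: fun_eq_iff tr_diff[OF w' curve_wsum(2)[OF s]] tr_cmult tr_diff[OF w]) simp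
        qed
        have "\<bar>b i\<bar> \<le> 4 * \<bar>h\<bar> * \<bar>dcoeff a i\<bar> * ((real (tdeg i) ^ 2 + 1) * (1/2) ^ tdeg i)" for i
        proof -
          have "\<bar>h\<bar> * \<bar>b i\<bar> = \<bar>curve a (s + h) i - curve a s i - (s + h - s) * curve' a s i\<bar>"
            using h by (simp add: b_def right_diff_distrib flip: abs_mult)
          also have "\<dots> \<le> 4 * (s + h - s)\<^sup>2 * \<bar>dcoeff a i\<bar> * ((real (tdeg i) ^ 2 + 1) * (1/2) ^ tdeg i)"
            by (rule curve_bounds(3)[OF h(1) s])
          also have "\<dots> = \<bar>h\<bar> * (4 * \<bar>h\<bar> * \<bar>dcoeff a i\<bar> * ((real (tdeg i) ^ 2 + 1) * (1/2) ^ tdeg i))"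
            by (simp add: power2_eq_square flip: abs_mult)
          finally show ?thesis by (rule mult_left_le_imp_le) (use h(2) in simp)
        qed
        from W(2)[OF _ this] have b: "wsum b" "wnorm b \<le> 4 * \<bar>h\<bar> * W * norm a" by auto
        show ?case unfolding eq using tr_C2(2,3)[OF b(1) \<alpha>] b(2) by simp
      qed
      show "((\<lambda>h. 5 * (4 * \<bar>h\<bar> * W * norm a)) \<longlongrightarrow> 0) (at 0)" by (auto intro!: tendsto_eq_intros)
    qed
    show "((\<lambda>t. C2_norm \<alpha> (\<lambda>\<theta>. trig_series (curve' a t) 0 \<theta> - trig_series (curve' a s) 0 \<theta>)) \<longlongrightarrow> 0) (at s)"
    proof (rule Lim_null_comparison)
      show "\<forall>\<^sub>F t in at s. norm (C2_norm \<alpha> (\<lambda>\<theta>. trig_series (curve' a t) 0 \<theta> - trig_series (curve' a s) 0 \<theta>)) \<le> 5 * (4 * \<bar>t - s\<bar> * W * norm a)"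
        using ev_near[OF S]
      proof eventually_elim
        case (elim t)
        define b where "b = (\<lambda>i. curve' a t i - curve' a s i)"
        have eq: "(\<lambda>\<theta>. trig_series (curve' a t) 0 \<theta> - trig_series (curve' a s) 0 \<theta>) = trig_series b 0"
          unfolding b_def by (simp only: fun_eq_iff tr_diff[OF curve_wsum(2)[OF elim] curve_wsum(2)[OF s]]) simp
        have "\<bar>b i\<bar> \<le> 4 * \<bar>t - s\<bar> * \<bar>dcoeff a i\<bar> * ((real (tdeg i) ^ 2 + 1) * (1/2) ^ tdeg i)" for i
          unfolding b_def by (rule curve_bounds(4)[OF elim s])
        from W(2)[OF _ this] have b: "wsum b" "wnorm b \<le> 4 * \<bar>t - s\<bar> * W * norm a" by auto
        show ?case unfolding eq using tr_C2(2,3)[OF b(1) \<alpha>] b(2) by simp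
      qed
      show "((\<lambda>t. 5 * (4 * \<bar>t - s\<bar> * W * norm a)) \<longlongrightarrow> 0) (at s)" by (auto intro!: tendsto_eq_intros)
    qed
  qed
qed

text \<open>The two coefficients of degree 1 combine to the cosine. Every other nonzero term has
  degree n at least 2, where |s|^n <= 4 s^2 (1/2)^n.\<close>

lemma curve_first_order:
  assumes \<alpha>: "0 < \<alpha>" "\<alpha> < 1" and a: "dcoeff a (0,0) = 0" "dcoeff a (Suc 0,0) = c" "dcoeff a (0,Suc 0) = c"
  obtains C where "\<And>s. \<bar>s\<bar> \<le> 1/2 \<Longrightarrow>
      0 \<le> C2_norm \<alpha> (\<lambda>\<theta>. trig_series (curve a s) 0 \<theta> - s * (2 * c) * cos \<theta>) \<and>
      C2_norm \<alpha> (\<lambda>\<theta>. trig_series (curve a s) 0 \<theta> - s * (2 * c) * cos \<theta>) \<le> C * s\<^sup>2"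
    "\<And>s \<theta>. \<bar>s\<bar> \<le> 1/2 \<Longrightarrow> \<bar>trig_series (curve a s) 0 \<theta> - s * (2 * c) * cos \<theta>\<bar> \<le> C * s\<^sup>2"
proof -
  obtain W where W: "W > 0" "\<And>a b C. 0 \<le> C \<Longrightarrow> (\<And>i. \<bar>b i\<bar> \<le> C * \<bar>dcoeff a i\<bar> * ((real (tdeg i) ^ 2 + 1) * (1/2) ^ tdeg i)) \<Longrightarrow> wsum b \<and> wnorm b \<le> C * W * norm a"
    using dominated_wnorm by metis
  define C where "C = 5 * (4 * W * norm a)"
  have "0 \<le> C2_norm \<alpha> (\<lambda>\<theta>. trig_series (curve a s) 0 \<theta> - s * (2 * c) * cos \<theta>) \<and>
      C2_norm \<alpha> (\<lambda>\<theta>. trig_series (curve a s) 0 \<theta> - s * (2 * c) * cos \<theta>) \<le> C * s\<^sup>2 \<and>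
      (\<forall>\<theta>. \<bar>trig_series (curve a s) 0 \<theta> - s * (2 * c) * cos \<theta>\<bar> \<le> C * s\<^sup>2)" if s: "\<bar>s\<bar> \<le> 1/2" for s
  proof -
    define F where "F = {(Suc 0,0),(0,Suc 0) :: nat \<times> nat}"
    define b where "b = (\<lambda>i. if i \<in> F then 0 else curve a s i)"
    have "\<bar>b i\<bar> \<le> 4 * s\<^sup>2 * \<bar>dcoeff a i\<bar> * ((real (tdeg i) ^ 2 + 1) * (1/2) ^ tdeg i)" for i
    proof (cases "2 \<le> tdeg i")
      case True
      then obtain n where n: "tdeg i = n + 2" by (metis add.commute le_Suc_ex)
      have "\<bar>s\<bar> ^ n \<le> (1/2) ^ n" by (intro power_mono s) auto
      then have "s\<^sup>2 * \<bar>s\<bar> ^ n \<le> s\<^sup>2 * (1/2) ^ n" by (intro mult_left_mono) auto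
      moreover have "\<bar>s\<bar> ^ tdeg i = s\<^sup>2 * \<bar>s\<bar> ^ n" unfolding n by (simp only: power_add power2_abs mult.commute)
      moreover have "4 * s\<^sup>2 * (1/2) ^ tdeg i = s\<^sup>2 * (1/2) ^ n" unfolding n by (simp add: power_add power2_eq_square)
      ultimately have "\<bar>s\<bar> ^ tdeg i \<le> 4 * s\<^sup>2 * (1/2) ^ tdeg i" by linarith
      also have "\<dots> \<le> 4 * s\<^sup>2 * ((real (tdeg i) ^ 2 + 1) * (1/2) ^ tdeg i)"
        using mult_right_mono[of 1 "real (tdeg i) ^ 2 + 1" "(1/2) ^ tdeg i"] by (intro mult_left_mono) auto
      finally have "\<bar>dcoeff a i\<bar> * \<bar>s\<bar> ^ tdeg i \<le> \<bar>dcoeff a i\<bar> * (4 * s\<^sup>2 * ((real (tdeg i) ^ 2 + 1) * (1/2) ^ tdeg i))"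
        by (rule mult_left_mono) simp
      moreover have "\<bar>b i\<bar> \<le> \<bar>dcoeff a i\<bar> * \<bar>s\<bar> ^ tdeg i" by (simp add: b_def curve_def abs_mult power_abs)
      ultimately show ?thesis by (simp add: ac_simps)
    next
      case False
      then have "i \<in> F \<or> i = (0,0)" by (cases i) (auto simp: F_def tdeg_def)
      then have "b i = 0" using a by (auto simp: b_def curve_def)
      then show ?thesis by simp
    qed
    from W(2)[OF _ this] have b: "wsum b" "wnorm b \<le> 4 * s\<^sup>2 * W * norm a" by auto
    have eq: "trig_series (curve a s) 0 \<theta> - s * (2 * c) * cos \<theta> = trig_series b 0 \<theta>" for \<theta>
    proof -
      let ?g = "\<lambda>i. curve a s i * cos (angfreq i * \<theta> + 0)"
      have g: "?g summable_on UNIV" using tr_term(1)[OF curve_wsum(1)[OF s], of 0 a \<theta> 0] by simp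
      have "infsum ?g UNIV = infsum ?g (F \<union> - F)" by simp
      also have "\<dots> = infsum ?g F + infsum ?g (- F)"
        by (intro infsum_Un_disjoint summable_on_subset_banach[OF g]) auto
      also have "infsum ?g F = s * (2 * c) * cos \<theta>"
        using a by (simp add: F_def curve_def tdeg_def angfreq_def)
      also have "infsum ?g (- F) = trig_series b 0 \<theta>"
        unfolding trig_series_def by (rule infsum_cong_neutral) (auto simp: b_def)
      finally show ?thesis by (simp add: trig_series_def)
    qed
    have t: "\<bar>trig_series b 0 \<theta>\<bar> \<le> wnorm b" for \<theta> using tr_term(2)[OF b(1), of 0 0] by simp
    have c: "5 * wnorm b \<le> C * s\<^sup>2" using b(2) by (simp add: C_def algebra_simps)
    have "\<bar>trig_series b 0 \<theta>\<bar> \<le> C * s\<^sup>2" for \<theta> using t[of \<theta>] c by linarith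
    then show ?thesis unfolding eq using tr_C2(2,3)[OF b(1) \<alpha>] c by auto
  qed
  then show thesis using that by blast
qed

lemma ev_real_curve: "ev s s a = infsum (curve a s) UNIV" for s :: real
  unfolding ev_def curve_def tdeg_def by (simp add: power_add)

text \<open>The scalar counterpart of the smoothness of the curve, used for the parameter
  \<open>\<gamma>\<close>.\<close>

lemma infsum_C1:
  assumes "s0 \<le> 1/2"
  shows "(\<lambda>s. ev s s a) C1_differentiable_on {-s0<..<(s0::real)}"
proof -
  obtain W where W: "W > 0" "\<And>a b C. 0 \<le> C \<Longrightarrow> (\<And>i. \<bar>b i\<bar> \<le> C * \<bar>dcoeff a i\<bar> * ((real (tdeg i) ^ 2 + 1) * (1/2) ^ tdeg i)) \<Longrightarrow> wsum b \<and> wnorm b \<le> C * W * norm a"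
    using dominated_wnorm by metis
  define D where "D = (\<lambda>s. infsum (curve' a s) UNIV)"
  have inf: "b summable_on UNIV" "\<bar>infsum b UNIV\<bar> \<le> wnorm b" if "wsum b" for b
  proof -
    have "\<bar>b i\<bar> \<le> 1 * (\<bar>b i\<bar> * (1 + \<bar>angfreq i\<bar>) ^ 3)" for i
      using mult_left_mono[OF one_le_power[of "1 + \<bar>angfreq i\<bar>" 3], of "\<bar>b i\<bar>"] by simp
    from tr_bound[OF that this] show "b summable_on UNIV" "\<bar>infsum b UNIV\<bar> \<le> wnorm b" by auto
  qed
  have ev_near: "\<forall>\<^sub>F t in at s. \<bar>t\<bar> \<le> 1/2" if "s \<in> {-s0<..<s0}" for s
  proof -
    have "\<forall>\<^sub>F t in at s. t \<in> {-s0<..<s0}" by (rule eventually_at_in_open') (use that in auto)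
    then show ?thesis by eventually_elim (use assms in auto)
  qed
  have est: "\<bar>ev t t a - ev s s a - (t - s) * D s\<bar> \<le> 4 * (t - s)\<^sup>2 * W * norm a" if s: "\<bar>s\<bar> \<le> 1/2" and t: "\<bar>t\<bar> \<le> 1/2" for s t
  proof -
    define b where "b = (\<lambda>i. curve a t i - curve a s i - (t - s) * curve' a s i)"
    have "wsum b \<and> wnorm b \<le> 4 * (t - s)\<^sup>2 * W * norm a"
      unfolding b_def by (rule W(2)[OF _ curve_bounds(3)[OF t s]]) simp
    moreover have "infsum b UNIV = ev t t a - ev s s a - (t - s) * D s"
    proof -
      note i = inf(1)[OF curve_wsum(1)[OF t, of a]] inf(1)[OF curve_wsum(1)[OF s, of a]]
      have i3: "(\<lambda>i. (t - s) * curve' a s i) summable_on UNIV"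
        by (intro summable_on_cmult_right inf(1) curve_wsum s)
      show ?thesis
        unfolding b_def ev_real_curve D_def infsum_diff(2)[OF infsum_diff(1)[OF i] i3] infsum_diff(2)[OF i]
          infsum_cmult_right' ..
    qed
    ultimately show ?thesis using inf(2)[of b] by auto
  qed
  have "((\<lambda>s. ev s s a) has_vector_derivative D s) (at s)" if S: "s \<in> {-s0<..<s0}" for s
  proof -
    have s: "\<bar>s\<bar> \<le> 1/2" using S assms by auto
    have "((\<lambda>t. (ev t t a - ev s s a) / (t - s) - D s) \<longlongrightarrow> 0) (at s)"
    proof (rule Lim_null_comparison)
      have "\<forall>\<^sub>F t in at s. \<bar>t\<bar> \<le> 1/2 \<and> t \<noteq> s"
        using ev_near[OF S] by (auto simp: eventually_conj_iff eventually_neq_at_within)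
      then show "\<forall>\<^sub>F t in at s. norm ((ev t t a - ev s s a) / (t - s) - D s) \<le> 4 * \<bar>t - s\<bar> * W * norm a"
      proof eventually_elim
        case (elim t)
        have sq: "(t - s)\<^sup>2 = \<bar>t - s\<bar> * \<bar>t - s\<bar>" by (simp add: power2_eq_square flip: abs_mult)
        have "\<bar>ev t t a - ev s s a - (t - s) * D s\<bar> \<le> \<bar>t - s\<bar> * (4 * \<bar>t - s\<bar> * W * norm a)"
          using est[OF s, of t] elim unfolding sq by (simp only: ac_simps)
        then show ?case by (rule quotient_bound[rotated]) (use elim in simp)
      qed
      show "((\<lambda>t. 4 * \<bar>t - s\<bar> * W * norm a) \<longlongrightarrow> 0) (at s)" by (auto intro!: tendsto_eq_intros)
    qed
    then have "((\<lambda>t. (ev t t a - ev s s a) / (t - s)) \<longlongrightarrow> D s) (at s)" by (rule LIM_zero_cancel)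
    then have "((\<lambda>s. ev s s a) has_field_derivative D s) (at s)" by (simp add: has_field_derivative_iff)
    then show ?thesis by (simp add: has_real_derivative_iff_has_vector_derivative)
  qed
  moreover have "continuous_on {-s0<..<s0} D"
  proof (rule continuous_at_imp_continuous_on, rule ballI)
    fix s assume S: "s \<in> {-s0<..<s0}"
    then have s: "\<bar>s\<bar> \<le> 1/2" using assms by auto
    have "((\<lambda>t. D t - D s) \<longlongrightarrow> 0) (at s)"
    proof (rule Lim_null_comparison)
      show "\<forall>\<^sub>F t in at s. norm (D t - D s) \<le> 4 * \<bar>t - s\<bar> * W * norm a"
        using ev_near[OF S]
      proof eventually_elim
        case (elim t)
        define b where "b = (\<lambda>i. curve' a t i - curve' a s i)"
        have "wsum b \<and> wnorm b \<le> 4 * \<bar>t - s\<bar> * W * norm a"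
          unfolding b_def by (rule W(2)[OF _ curve_bounds(4)[OF elim s]]) simp
        moreover have "infsum b UNIV = D t - D s"
          unfolding b_def D_def by (intro infsum_diff(2) inf(1) curve_wsum s elim)
        ultimately show ?case using inf(2)[of b] by auto
      qed
      show "((\<lambda>t. 4 * \<bar>t - s\<bar> * W * norm a) \<longlongrightarrow> 0) (at s)" by (auto intro!: tendsto_eq_intros)
    qed
    then show "isCont D s" unfolding isCont_def by (rule LIM_zero_cancel)
  qed
  ultimately show ?thesis unfolding C1_differentiable_on_def by blast
qed

section \<open>Star-shaped domains in the plane\<close>

definition sdir :: "real^2 \<Rightarrow> real^2" where "sdir x = x /\<^sub>R norm x"

lemma norm_sdir: "x \<noteq> 0 \<Longrightarrow> norm (sdir x) = 1"
  by (simp add: sdir_def)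

lemma sdir_scale: "norm u = 1 \<Longrightarrow> t > 0 \<Longrightarrow> sdir (t *\<^sub>R u) = u"
  by (simp add: sdir_def)

lemma polar: "x = norm x *\<^sub>R sdir x"
  by (cases "x = 0") (simp_all add: sdir_def)

locale star_domain =
  fixes r :: "real^2 \<Rightarrow> real"
  assumes cont: "continuous_on (sphere 0 1) r" and pos: "\<And>u. norm u = 1 \<Longrightarrow> 0 < r u"
begin

text \<open>The origin is listed apart because it has no direction: \<open>sdir 0\<close> is 0,
  where nothing is known about \<open>r\<close>.\<close>

definition In where "In = {x. x = 0 \<or> norm x < r (sdir x)}"
definition Out where "Out = {x. x \<noteq> 0 \<and> r (sdir x) < norm x}"
definition Ga where "Ga = {r u *\<^sub>R u | u. norm u = 1}"

lemma cont_sdir: "continuous_on (- {0}) (\<lambda>x. r (sdir x))"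
proof (rule continuous_on_compose2[OF cont])
  show "continuous_on (- {0}) sdir" unfolding sdir_def by (intro continuous_intros) auto
  show "sdir ` (- {0}) \<subseteq> sphere 0 1"
  proof
    fix y assume "y \<in> sdir ` (- {0})"
    then obtain x where "x \<noteq> 0" "y = sdir x" by blast
    then show "y \<in> sphere 0 1" using norm_sdir[of x] by simp
  qed
qed

lemma sphere_ne: "sphere (0::real^2) 1 \<noteq> {}" by simp

lemma rmin: obtains m where "0 < m" "\<And>u. norm u = 1 \<Longrightarrow> m \<le> r u"
proof -
  obtain u where "u \<in> sphere 0 1" "\<forall>v\<in>sphere 0 1. r u \<le> r v"
    using continuous_attains_inf[OF compact_sphere sphere_ne cont] by blast
  then show thesis using that[of "r u"] pos by auto
qed

lemma rmax: obtains m where "\<And>u. norm u = 1 \<Longrightarrow> r u \<le> m"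
proof -
  obtain u where "u \<in> sphere 0 1" "\<forall>v\<in>sphere 0 1. r v \<le> r u"
    using continuous_attains_sup[OF compact_sphere sphere_ne cont] by blast
  then show thesis using that[of "r u"] by auto
qed

lemma scale_mem:
  assumes "norm u = 1" "0 < t"
  shows "t *\<^sub>R u \<in> In \<longleftrightarrow> t < r u" "t *\<^sub>R u \<in> Out \<longleftrightarrow> r u < t" "t *\<^sub>R u \<in> Ga \<longleftrightarrow> t = r u"
proof -
  have n: "norm (t *\<^sub>R u) = t" "t *\<^sub>R u \<noteq> 0" using assms by auto
  show "t *\<^sub>R u \<in> In \<longleftrightarrow> t < r u" "t *\<^sub>R u \<in> Out \<longleftrightarrow> r u < t"
    using n by (simp_all add: In_def Out_def sdir_scale[OF assms])
  show "t *\<^sub>R u \<in> Ga \<longleftrightarrow> t = r u"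
  proof
    assume "t *\<^sub>R u \<in> Ga"
    then obtain v where v: "norm v = 1" "t *\<^sub>R u = r v *\<^sub>R v" by (auto simp: Ga_def)
    then have "u = v" using sdir_scale[OF assms] sdir_scale[OF v(1) pos[OF v(1)]] by simp
    then show "t = r u" using v assms by auto
  qed (use assms in \<open>auto simp: Ga_def\<close>)
qed

lemma cases_polar:
  fixes x :: "real^2"
  obtains "x = 0" | u t where "norm u = 1" "0 < t" "x = t *\<^sub>R u"
  using polar[of x] norm_sdir[of x] zero_less_norm_iff[of x] by blast

lemma partition: "UNIV = In \<union> Ga \<union> Out" "In \<inter> Ga = {}" "In \<inter> Out = {}" "Ga \<inter> Out = {}" "0 \<notin> Ga" "0 \<in> In" "0 \<notin> Out"
proof -
  show z: "0 \<in> In" "0 \<notin> Out" by (simp_all add: In_def Out_def)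
  show g: "0 \<notin> Ga" using pos by (force simp: Ga_def)
  have "x \<in> In \<union> Ga \<union> Out \<and> \<not> (x \<in> In \<and> x \<in> Ga) \<and> \<not> (x \<in> In \<and> x \<in> Out) \<and> \<not> (x \<in> Ga \<and> x \<in> Out)" for x
    by (cases x rule: cases_polar) (use z g scale_mem in auto)
  then show "UNIV = In \<union> Ga \<union> Out" "In \<inter> Ga = {}" "In \<inter> Out = {}" "Ga \<inter> Out = {}" by blast+
qed

lemma ball_subset_In:
  assumes "\<And>u. norm u = 1 \<Longrightarrow> m \<le> r u" shows "ball 0 m \<subseteq> In"
proof
  fix x :: "real^2" assume "x \<in> ball 0 m"
  then have "norm x < m" by simp
  then show "x \<in> In" using assms[OF norm_sdir[of x]] by (cases "x = 0") (simp_all add: In_def)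
qed

text \<open>The direction is discontinuous at the origin; there openness comes from a ball whose
  radius bounds \<open>r\<close> from below.\<close>

lemma open_In: "open In"
proof -
  obtain m where m: "0 < m" "\<And>u. norm u = 1 \<Longrightarrow> m \<le> r u" using rmin by blast
  have "In = ball 0 m \<union> {x \<in> - {0}. norm x - r (sdir x) < 0}"
    using ball_subset_In[OF m(2)] m(1) by (auto simp: In_def)
  moreover have "{x \<in> - {0}. norm x - r (sdir x) < 0} = - {0} \<inter> (\<lambda>x. norm x - r (sdir x)) -` {..<0}" by auto
  moreover have "open (- {0} \<inter> (\<lambda>x. norm x - r (sdir x)) -` {..<0})"
    by (intro continuous_open_preimage continuous_on_diff continuous_on_norm_id cont_sdir open_Compl
        finite_imp_closed open_lessThan open_greaterThan finite.intros)
  ultimately show ?thesis by auto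
qed

lemma open_Out: "open Out"
proof -
  have "Out = - {0} \<inter> (\<lambda>x. norm x - r (sdir x)) -` {0<..}" by (auto simp: Out_def)
  moreover have "open (- {0} \<inter> (\<lambda>x. norm x - r (sdir x)) -` {0<..})"
    by (intro continuous_open_preimage continuous_on_diff continuous_on_norm_id cont_sdir open_Compl
        finite_imp_closed open_lessThan open_greaterThan finite.intros)
  ultimately show ?thesis by simp
qed

lemma connected_In: "connected In"
proof (rule starlike_imp_connected, unfold starlike_def, intro bexI ballI)
  show "0 \<in> In" by (rule partition)
  fix x assume x: "x \<in> In"
  show "closed_segment 0 x \<subseteq> In"
  proof
    fix y assume "y \<in> closed_segment 0 x"
    then obtain a where a: "0 \<le> a" "a \<le> 1" "y = a *\<^sub>R x" by (auto simp: in_segment)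
    show "y \<in> In"
    proof (cases x rule: cases_polar)
      case 1
      then show ?thesis using a partition(6) by simp
    next
      case (2 u t)
      have "a * t \<le> t" using a 2 by (simp add: mult_le_cancel_right1)
      moreover have "t < r u" using x scale_mem(1)[OF 2(1,2)] 2 by simp
      ultimately have at: "a * t < r u" by simp
      show ?thesis
      proof (cases "a = 0")
        case False
        then have "0 < a * t" using a 2 by simp
        then show ?thesis using scale_mem(1)[OF 2(1), of "a * t"] at a 2 by simp
      qed (use a partition(6) in simp)
    qed
  qed
qed

lemma connected_Out: "connected Out"
proof -
  define h where "h = (\<lambda>(u, t). (t * r u) *\<^sub>R u)"
  define S where "S = sphere (0::real^2) 1 \<times> {1::real<..}"
  have "continuous_on S h" unfolding h_def S_def case_prod_unfold
    by (intro continuous_intros continuous_on_compose2[OF cont]) auto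
  moreover have "connected S" unfolding S_def
    by (intro connected_Times connected_sphere) auto
  ultimately have "connected (h ` S)" by (rule connected_continuous_image)
  moreover have "h ` S = Out"
  proof
    show "h ` S \<subseteq> Out"
    proof
      fix x assume "x \<in> h ` S"
      then obtain u t where u: "norm u = 1" "1 < t" "x = (t * r u) *\<^sub>R u" by (auto simp: S_def h_def)
      then have "r u < t * r u" using pos[OF u(1)] by simp
      then show "x \<in> Out" using scale_mem(2)[OF u(1), of "t * r u"] pos[OF u(1)] u by auto
    qed
    show "Out \<subseteq> h ` S"
    proof
      fix x assume x: "x \<in> Out"
      show "x \<in> h ` S"
      proof (cases x rule: cases_polar)
        case 1
        then show ?thesis using x partition by simp
      next
        case (2 u t)
        then have "r u < t" using scale_mem(2)[OF 2(1,2)] x by simp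
        then have "(u, t / r u) \<in> S" using pos[OF 2(1)] 2 by (simp add: S_def)
        moreover have "h (u, t / r u) = x" using pos[OF 2(1)] 2 by (simp add: h_def)
        ultimately show ?thesis by force
      qed
    qed
  qed
  ultimately show ?thesis by simp
qed

lemma bounded_In: "bounded In"
proof -
  obtain m where m: "\<And>u. norm u = 1 \<Longrightarrow> r u \<le> m" using rmax by blast
  have "norm x \<le> max m 0" if "x \<in> In" for x
    using that m[OF norm_sdir[of x]] by (cases "x = 0") (auto simp: In_def)
  then show ?thesis by (auto simp: bounded_iff)
qed

lemma unbounded_Out: "\<not> bounded Out"
proof
  assume "bounded Out"
  then obtain B where B: "\<And>x. x \<in> Out \<Longrightarrow> norm x \<le> B" by (auto simp: bounded_iff)
  obtain u :: "real^2" where u: "norm u = 1" using vector_choose_size[of 1] by auto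
  define t where "t = max (r u) B + 1"
  have t: "0 < t" "r u < t" "B < t" using pos[OF u] by (auto simp: t_def)
  then have "t *\<^sub>R u \<in> Out" using scale_mem(2)[OF u] by simp
  from B[OF this] show False using t u by simp
qed

lemma Ga_in_closure:
  assumes x: "x \<in> Ga" and e: "e > 0" and lam: "\<And>u. norm u = 1 \<Longrightarrow> lam < r u"
  obtains y where "y \<in> In" "dist y x < e" "lam < norm y"
proof -
  obtain u where u: "norm u = 1" "x = r u *\<^sub>R u" using x by (auto simp: Ga_def)
  define d where "d = min (e/2) (min ((r u - lam) / 2) (r u / 2))"
  have "0 < d" using e lam[OF u(1)] pos[OF u(1)] by (simp add: d_def)
  moreover have "d \<le> e / 2" "d \<le> (r u - lam) / 2" "d \<le> r u / 2" by (auto simp: d_def min_def)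
  moreover from calculation have "d < e" "d < r u - lam" "d < r u"
    using e lam[OF u(1)] pos[OF u(1)] by (simp_all add: field_simps)
  ultimately have d: "0 < d" "d < e" "d < r u - lam" "d < r u" by blast+
  show thesis
  proof (rule that[of "(r u - d) *\<^sub>R u"])
    show "(r u - d) *\<^sub>R u \<in> In" using scale_mem(1)[OF u(1), of "r u - d"] d by simp
    have "(r u - d) *\<^sub>R u - x = (- d) *\<^sub>R u" by (simp add: u algebra_simps)
    then show "dist ((r u - d) *\<^sub>R u) x < e" using d u by (simp add: dist_norm)
    show "lam < norm ((r u - d) *\<^sub>R u)" using d u by simp
  qed
qed

lemma frontier_In: "frontier In = Ga"
proof -
  have "closure In = In \<union> Ga"
  proof
    have "closed (In \<union> Ga)"
    proof -
      have "In \<union> Ga = - Out" using partition by blast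
      then show ?thesis using open_Out by (simp only: open_closed)
    qed
    then show "closure In \<subseteq> In \<union> Ga" by (intro closure_minimal) auto
    show "In \<union> Ga \<subseteq> closure In"
    proof
      fix x assume "x \<in> In \<union> Ga"
      then show "x \<in> closure In"
      proof
        assume x: "x \<in> Ga"
        show ?thesis unfolding closure_approachable
        proof (intro allI impI)
          fix e :: real assume "e > 0"
          then show "\<exists>y\<in>In. dist y x < e" using Ga_in_closure[OF x _ pos] by metis
        qed
      qed (simp add: closure_def)
    qed
  qed
  then show ?thesis unfolding frontier_def interior_open[OF open_In] using partition(2) by blast
qed

text \<open>A connected set avoiding the frontier lies inside \<open>\<Omega>\<close> as soon as it
  meets it. The unbounded \<open>Out\<close> can therefore not meet the bounded
  \<open>\<Omega>\<close>, which leaves \<open>In\<close>.\<close>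

lemma domain_unique: "bounded_domain_with_boundary Ga \<Omega> \<longleftrightarrow> \<Omega> = In"
proof
  assume "\<Omega> = In"
  then show "bounded_domain_with_boundary Ga \<Omega>"
    using open_In connected_In bounded_In frontier_In partition(6) by (auto simp: bounded_domain_with_boundary_def)
next
  assume "bounded_domain_with_boundary Ga \<Omega>"
  then have O: "open \<Omega>" "connected \<Omega>" "bounded \<Omega>" "\<Omega> \<noteq> {}" "frontier \<Omega> = Ga"
    by (auto simp: bounded_domain_with_boundary_def)
  have disj: "\<Omega> \<inter> Ga = {}" using O(1,5) by (auto simp: frontier_def interior_open)
  have sub: "S \<subseteq> \<Omega>" if "connected S" "S \<inter> \<Omega> \<noteq> {}" "S \<inter> Ga = {}" for S
    using connected_Int_frontier[OF that(1,2)] that(3) O(5) by blast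
  have "\<not> Out \<subseteq> \<Omega>" using unbounded_Out bounded_subset[OF O(3)] by blast
  then have "Out \<inter> \<Omega> = {}" using sub[OF connected_Out] partition(4) by blast
  then have "\<Omega> \<subseteq> In" using disj partition(1) by blast
  moreover have "In \<subseteq> \<Omega>" using sub[OF connected_In] partition(2) O(4) \<open>\<Omega> \<subseteq> In\<close> by blast
  ultimately show "\<Omega> = In" by blast
qed

text \<open>The point is moved radially by a fraction \<open>\<delta>\<close> of the way to the
  middle circle of radius (\<rho> + R) / 2.\<close>

lemma closed_annulus_closure:
  fixes c :: "real^2" assumes "0 < \<rho>" "\<rho> < R" "\<rho> \<le> dist c x" "dist c x \<le> R" "0 < e"
  obtains y where "\<rho> < dist c y" "dist c y < R" "dist y x < e"
proof -
  define d where "d = dist c x"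
  define \<delta> where "\<delta> = min (1/2) (e / (2 * R))"
  have \<delta>: "0 < \<delta>" "\<delta> \<le> 1/2" "\<delta> * R < e" using assms by (auto simp: \<delta>_def min_def field_simps)
  define m where "m = (\<rho> + R) / 2"
  define y where "y = c + ((1 - \<delta>) + \<delta> * (m / d)) *\<^sub>R (x - c)"
  have d: "0 < d" "\<rho> \<le> d" "d \<le> R" using assms by (auto simp: d_def)
  have nx: "norm (x - c) = d" by (simp add: d_def dist_norm norm_minus_commute)
  have "0 \<le> (1 - \<delta>) + \<delta> * (m / d)" using \<delta> assms d by (intro add_nonneg_nonneg mult_nonneg_nonneg) (auto simp: m_def)
  moreover have "y - c = ((1 - \<delta>) + \<delta> * (m / d)) *\<^sub>R (x - c)" by (simp add: y_def)
  ultimately have "dist c y = ((1 - \<delta>) + \<delta> * (m / d)) * d"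
    unfolding dist_commute[of c y] by (simp only: dist_norm norm_scaleR nx abs_of_nonneg)
  then have dy: "dist c y = (1 - \<delta>) * d + \<delta> * m" using d by (simp add: distrib_right)
  have "y - x = (\<delta> * (m / d - 1)) *\<^sub>R (x - c)" by (simp add: y_def algebra_simps)
  then have "dist y x = \<bar>\<delta> * (m / d - 1)\<bar> * d" by (simp add: dist_norm nx)
  also have "\<dots> = \<delta> * \<bar>(m / d - 1) * d\<bar>" using \<delta> d by (simp add: abs_mult)
  also have "(m / d - 1) * d = m - d" using d by (simp add: field_simps)
  also have "\<delta> * \<bar>m - d\<bar> \<le> \<delta> * R"
    using \<delta> d assms by (intro mult_left_mono abs_leI) (auto simp: m_def field_simps)
  finally have 3: "dist y x < e" using \<delta> by simp
  have mm: "\<rho> < m" "m < R" using assms by (auto simp: m_def)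
  have "(1 - \<delta>) * \<rho> + \<delta> * \<rho> < (1 - \<delta>) * d + \<delta> * m"
    using \<delta> d mm by (intro add_le_less_mono mult_left_mono mult_strict_left_mono) auto
  then have 1: "\<rho> < dist c y" by (simp add: dy algebra_simps)
  have "(1 - \<delta>) * d + \<delta> * m < (1 - \<delta>) * R + \<delta> * R"
    using \<delta> d mm by (intro add_le_less_mono mult_left_mono mult_strict_left_mono) auto
  then have 2: "dist c y < R" by (simp add: dy algebra_simps)
  show thesis using that 1 2 3 by blast
qed

text \<open>The exterior of the domain has one bounded and one unbounded component, and so has the
  exterior of an annulus. Comparing the bounded components, the annulus is centred at the origin.\<close>

lemma annulus_imp_constant:
  assumes lam: "0 < lam" "\<And>u. norm u = 1 \<Longrightarrow> lam < r u" and A: "annulus (In - ball 0 lam)"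
  obtains R where "\<And>u. norm u = 1 \<Longrightarrow> r u = R"
proof -
  obtain c \<rho> R where R: "0 < \<rho>" "\<rho> < R" "{x. \<rho> < dist c x \<and> dist c x < R} \<subseteq> In - ball 0 lam"
    "In - ball 0 lam \<subseteq> {x. \<rho> \<le> dist c x \<and> dist c x \<le> R}"
    using A by (auto simp: annulus_def)
  define Ext where "Ext = - cball c R"
  have oE: "open Ext" by (simp add: Ext_def open_Compl)
  have disj: "ball c \<rho> \<inter> Ext = {}" using R by (auto simp: Ext_def)
  have disj2: "ball 0 lam \<inter> Out = {}"
  proof -
    have "ball 0 lam \<subseteq> In" by (rule ball_subset_In) (use lam in force)
    then show ?thesis using partition(3) by blast
  qed
  \<comment> \<open>Each side is the largest open set disjoint from the region, so the freedom in
    which boundary points an annulus contains disappears.\<close>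
  have eq: "ball c \<rho> \<union> Ext = ball 0 lam \<union> Out"
  proof
    have "open S \<Longrightarrow> S \<inter> (In - ball 0 lam) = {} \<Longrightarrow> S \<subseteq> ball 0 lam \<union> Out" for S
    proof
      fix x assume S: "open S" "S \<inter> (In - ball 0 lam) = {}" and x: "x \<in> S"
      have "x \<notin> Ga"
      proof
        assume g: "x \<in> Ga"
        obtain e where e: "e > 0" "ball x e \<subseteq> S" using S(1) x open_contains_ball by blast
        obtain y where "y \<in> In" "dist y x < e" "lam < norm y"
          using Ga_in_closure[OF g e(1) lam(2)] by blast
        then have "y \<in> S" "y \<in> In - ball 0 lam" using e(2) by (auto simp: dist_commute)
        then show False using S(2) by blast
      qed
      then show "x \<in> ball 0 lam \<union> Out" using S x partition(1) by blast
    qed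
    from this[of "ball c \<rho> \<union> Ext"] R(4) oE show "ball c \<rho> \<union> Ext \<subseteq> ball 0 lam \<union> Out"
      unfolding Ext_def by force
    have "open S \<Longrightarrow> S \<inter> (In - ball 0 lam) = {} \<Longrightarrow> S \<subseteq> ball c \<rho> \<union> Ext" for S
    proof
      fix x assume S: "open S" "S \<inter> (In - ball 0 lam) = {}" and x: "x \<in> S"
      show "x \<in> ball c \<rho> \<union> Ext"
      proof (rule ccontr)
        assume "x \<notin> ball c \<rho> \<union> Ext"
        then have x2: "\<rho> \<le> dist c x" "dist c x \<le> R" by (auto simp: Ext_def)
        obtain e where e: "e > 0" "ball x e \<subseteq> S" using S(1) x open_contains_ball by blast
        obtain y where "\<rho> < dist c y" "dist c y < R" "dist y x < e"
          using closed_annulus_closure[OF R(1,2) x2 e(1)] by blast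
        then have "y \<in> S" "y \<in> In - ball 0 lam" using e(2) R(3) by (auto simp: dist_commute)
        then show False using S(2) by blast
      qed
    qed
    from this[of "ball 0 lam \<union> Out"] open_Out partition(3) show "ball 0 lam \<union> Out \<subseteq> ball c \<rho> \<union> Ext" by blast
  qed
  have split: "S \<subseteq> X \<or> S \<subseteq> Y" if "connected S" "open X" "open Y" "X \<inter> Y = {}" "S \<subseteq> X \<union> Y" for S X Y :: "(real^2) set"
    using connectedD[OF that(1), of X Y] that by blast
  have "Out \<subseteq> ball c \<rho> \<or> Out \<subseteq> Ext" by (rule split[OF connected_Out _ oE disj]) (use eq in auto)
  then have OE: "Out \<subseteq> Ext" using unbounded_Out bounded_subset[OF bounded_ball] by blast
  have ne: "c \<in> ball c \<rho>" "0 \<in> ball 0 lam" using R lam by auto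
  have "ball c \<rho> \<subseteq> ball 0 lam \<or> ball c \<rho> \<subseteq> Out" by (rule split[OF _ _ open_Out disj2]) (use eq in auto)
  then have 1: "ball c \<rho> \<subseteq> ball 0 lam" using OE disj ne by blast
  have "ball 0 lam \<subseteq> ball c \<rho> \<or> ball 0 lam \<subseteq> Ext" by (rule split[OF _ _ oE disj]) (use eq in auto)
  then have 2: "ball 0 lam \<subseteq> ball c \<rho>" using 1 disj ne by blast
  have "c = 0" "\<rho> = lam" using 1 2 R(1) lam(1) ball_eq_ball_iff[of c \<rho> 0 lam] by auto
  then have OE': "Out = Ext" using eq disj disj2 by blast
  show thesis
  proof (rule that[of R])
    fix u :: "real^2" assume u: "norm u = 1"
    have *: "r u < t \<longleftrightarrow> R < t" if "0 < t" for t
    proof -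
      have "t *\<^sub>R u \<in> Out \<longleftrightarrow> t *\<^sub>R u \<in> Ext" using OE' by simp
      then show ?thesis using scale_mem(2)[OF u that] u that \<open>c = 0\<close> by (simp add: Ext_def not_le)
    qed
    show "r u = R" using *[of "r u"] *[of R] *[of "(r u + R) / 2"] pos[OF u] R by (cases "r u" R rule: linorder_cases) auto
  qed
qed

end

section \<open>Transfer to the real plane\<close>

definition toC :: "real^2 \<Rightarrow> complex" where "toC x = Complex (x $ 1) (x $ 2)"
definition ofC :: "complex \<Rightarrow> real^2" where "ofC z = vector [Re z, Im z]"

lemma toC_simps [simp]: "toC (ofC z) = z" "ofC (toC x) = x" "Re (toC x) = x $ 1" "Im (toC x) = x $ 2"
  "ofC z $ 1 = Re z" "ofC z $ 2 = Im z"
  by (auto simp: toC_def ofC_def vec_eq_iff forall_2)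

lemma norm_toC [simp]: "norm (toC x) = norm x" "norm (ofC z) = norm z"
proof -
  show 1: "norm (toC x) = norm x" for x by (simp add: norm_vec_def L2_set_def sum_2 cmod_def)
  show "norm (ofC z) = norm z" using 1[of "ofC z"] by simp
qed

lemma linear_toC: "toC (a + b) = toC a + toC b" "toC (a - b) = toC a - toC b" "toC (c *\<^sub>R a) = c *\<^sub>R toC a"
  "ofC (w + z) = ofC w + ofC z" "ofC (c *\<^sub>R z) = c *\<^sub>R ofC z" "ofC (w - z) = ofC w - ofC z"
  by (auto simp: complex_eq_iff vec_eq_iff forall_2)

lemma bounded_linear_toC: "bounded_linear toC" "bounded_linear ofC"
  by (rule bounded_linear_intro[where K = 1]; simp add: linear_toC)+

lemma toC_unit_vec: "toC (unit_vec \<theta>) = cis \<theta>" "norm (unit_vec \<theta>) = 1"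
proof -
  show 1: "toC (unit_vec \<theta>) = cis \<theta>" by (simp add: complex_eq_iff unit_vec_def)
  show "norm (unit_vec \<theta>) = 1" using norm_toC(1)[of "unit_vec \<theta>"] 1 by simp
qed

text \<open>\<open>K\<close> may fail to be convex. Nearby points are joined inside a disc contained
  in \<open>U\<close>; for points further apart than \<open>\<delta>\<close> the bound on |F| is
  enough.\<close>

lemma holomorphic_Lipschitz_compact:
  assumes F: "F holomorphic_on U" and U: "open U" and K: "compact K" "K \<subseteq> U"
  obtains L where "0 \<le> L" "\<And>x y. x \<in> K \<Longrightarrow> y \<in> K \<Longrightarrow> norm (F x - F y) \<le> L * norm (x - y)"
proof -
  obtain \<delta> where \<delta>: "0 < \<delta>" "(\<Union>x\<in>K. cball x \<delta>) \<subseteq> U"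
    using compact_subset_open_imp_cball_epsilon_subset[OF K(1) U K(2)] by blast
  define K' where "K' = {x + y | x y. x \<in> K \<and> y \<in> cball 0 \<delta>}"
  have cK': "compact K'" unfolding K'_def by (intro compact_sums K compact_cball)
  have sub: "cball x \<delta> \<subseteq> K'" if "x \<in> K" for x
  proof
    fix z assume "z \<in> cball x \<delta>"
    then have "z = x + (z - x)" "z - x \<in> cball 0 \<delta>" by (auto simp: dist_norm norm_minus_commute)
    then show "z \<in> K'" unfolding K'_def using that by blast
  qed
  have K'U: "K' \<subseteq> U"
  proof
    fix z assume "z \<in> K'"
    then obtain x y where "z = x + y" "x \<in> K" "y \<in> cball 0 \<delta>" by (auto simp: K'_def)
    then have "z \<in> cball x \<delta>" by (simp add: dist_norm)
    then show "z \<in> U" using \<delta>(2) \<open>x \<in> K\<close> by blast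
  qed
  have "continuous_on K' (deriv F)"
    using holomorphic_on_imp_continuous_on[OF holomorphic_deriv[OF F U]] K'U continuous_on_subset by blast
  from compact_imp_bounded[OF compact_continuous_image[OF this cK']]
  obtain B where B: "\<And>z. z \<in> K' \<Longrightarrow> norm (deriv F z) \<le> B" by (auto simp: bounded_iff)
  have "continuous_on K F" using holomorphic_on_imp_continuous_on[OF F] K(2) continuous_on_subset by blast
  from compact_imp_bounded[OF compact_continuous_image[OF this K(1)]]
  obtain M where M: "\<And>z. z \<in> K \<Longrightarrow> norm (F z) \<le> M" by (auto simp: bounded_iff)
  define L where "L = max \<bar>B\<bar> (2 * \<bar>M\<bar> / \<delta>)"
  have "norm (F x - F y) \<le> L * norm (x - y)" if xy: "x \<in> K" "y \<in> K" for x y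
  proof (cases "norm (x - y) \<le> \<delta>")
    case True
    have "norm (F x - F y) \<le> \<bar>B\<bar> * norm (x - y)"
    proof (rule field_differentiable_bound[where S = "cball x \<delta>" and f' = "deriv F"])
      fix z assume z: "z \<in> cball x \<delta>"
      then have "z \<in> U" using sub[OF xy(1)] K'U by blast
      then show "(F has_field_derivative deriv F z) (at z within cball x \<delta>)"
        using holomorphic_derivI[OF F U] has_field_derivative_at_within by blast
      show "norm (deriv F z) \<le> \<bar>B\<bar>" using B sub[OF xy(1)] z by force
    qed (use True \<delta> in \<open>auto simp: dist_norm\<close>)
    also have "\<dots> \<le> L * norm (x - y)" by (intro mult_right_mono) (auto simp: L_def)
    finally show ?thesis .
  next
    case False
    have "norm (F x - F y) \<le> norm (F x) + norm (F y)" by (rule norm_triangle_ineq4)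
    also have "\<dots> \<le> 2 * \<bar>M\<bar>" using M[OF xy(1)] M[OF xy(2)] by linarith
    also have "\<dots> = 2 * \<bar>M\<bar> / \<delta> * \<delta>" using \<delta> by simp
    also have "\<dots> \<le> L * norm (x - y)" using False \<delta> by (intro mult_mono) (auto simp: L_def)
    finally show ?thesis .
  qed
  then show thesis using that[of L] by (auto simp: L_def)
qed

text \<open>The matrix of the real linear map h -> (\<gamma> / 2) h + cnj (w h). With w the complex
  derivative of \<open>F\<close> this is the derivative of the gradient, and the part from
  \<open>F\<close> is trace free.\<close>

definition hess :: "real \<Rightarrow> complex \<Rightarrow> real^2^2" where
  "hess \<gamma> w = vector [vector [\<gamma> / 2 + Re w, - Im w], vector [- Im w, \<gamma> / 2 - Re w]]"

lemma hess_simps: "hess \<gamma> w $ 1 $ 1 = \<gamma> / 2 + Re w" "hess \<gamma> w $ 1 $ 2 = - Im w"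
  "hess \<gamma> w $ 2 $ 1 = - Im w" "hess \<gamma> w $ 2 $ 2 = \<gamma> / 2 - Re w"
  by (simp_all add: hess_def)

lemma hess_apply: "hess \<gamma> w *v h = ofC (of_real (\<gamma> / 2) * toC h + cnj (w * toC h))"
  by (simp add: vec_eq_iff forall_2 matrix_vector_mult_def sum_2 hess_simps algebra_simps)

lemma trace_hess: "trace (hess \<gamma> w) = \<gamma>"
  by (simp add: trace_def sum_2 hess_simps)

lemma dist_hess: "dist (hess \<gamma> w) (hess \<gamma> w') \<le> 4 * norm (w - w')"
proof -
  have c: "\<bar>Re w - Re w'\<bar> \<le> norm (w - w')" "\<bar>Im w - Im w'\<bar> \<le> norm (w - w')"
    using abs_Re_le_cmod[of "w - w'"] abs_Im_le_cmod[of "w - w'"] by auto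
  have row: "norm (x :: real^2) \<le> \<bar>x $ 1\<bar> + \<bar>x $ 2\<bar>" for x
    using norm_le_l1_cart[of x] by (simp add: sum_2)
  have "norm (X :: real^2^2) \<le> norm (X $ 1) + norm (X $ 2)" for X
  proof -
    have "norm X \<le> (\<Sum>i\<in>UNIV. norm (X $ i))" unfolding norm_vec_def[of X] by (rule L2_set_le_sum) simp
    then show ?thesis by (simp add: sum_2)
  qed
  from this[of "hess \<gamma> w - hess \<gamma> w'"] row[of "(hess \<gamma> w - hess \<gamma> w') $ 1"] row[of "(hess \<gamma> w - hess \<gamma> w') $ 2"] c
  show ?thesis by (simp add: dist_norm hess_simps)
qed

lemma overdetermined_transfer:
  fixes \<eta> :: "real^2 \<Rightarrow> real" and \<gamma> Q lam \<alpha> :: real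
  assumes lam: "0 < lam" "lam < 1" and \<alpha>: "0 < \<alpha>" "\<alpha> < 1" and Q: "0 < Q"
    and \<eta>: "angular \<eta> \<in> C2_circle \<alpha>" "continuous_on (sphere 0 1) \<eta>" "\<And>x. norm x = 1 \<Longrightarrow> \<bar>\<eta> x\<bar> \<le> (1 - lam) / 4"
    and U: "open U" "compact K" "K \<subseteq> U" "F holomorphic_on U"
      "{z. lam < norm z \<and> norm z < 1 + \<eta> (ofC (z / of_real (norm z)))} \<subseteq> K"
    and \<psi>: "\<And>z. z \<in> U \<Longrightarrow> (\<psi> has_derivative (\<lambda>d. Re ((of_real (\<gamma> / 2) * cnj z + F z) * d))) (at z)"
      "\<And>z. norm z = lam \<Longrightarrow> \<psi> z = 1" 
      "\<And>u. norm u = 1 \<Longrightarrow> \<psi> (u * of_real (1 + \<eta> (ofC u))) = 0"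
      "\<And>u. norm u = 1 \<Longrightarrow> (norm (of_real (\<gamma> / 2) * cnj (u * of_real (1 + \<eta> (ofC u))) + F (u * of_real (1 + \<eta> (ofC u)))))\<^sup>2 = Q"
  shows "overdetermined_solution lam \<alpha> \<gamma> \<eta>"
    "Omega \<eta> = {x. x = 0 \<or> norm x < 1 + \<eta> (x /\<^sub>R norm x)}"
    "Omega \<eta> - cball 0 lam = {x. lam < norm x \<and> norm x < 1 + \<eta> (x /\<^sub>R norm x)}"
    "annulus (admissible_domain lam \<eta>) \<Longrightarrow> \<exists>R. \<forall>u. norm u = 1 \<longrightarrow> \<eta> u = R"
proof -
  define r where "r = (\<lambda>x. 1 + \<eta> x)"
  have rl: "lam < r u" if "norm u = 1" for u using \<eta>(3)[OF that] lam by (simp add: r_def abs_le_iff field_simps)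
  interpret star_domain r
    by unfold_locales (use \<eta>(2) rl lam in \<open>force simp: r_def intro!: continuous_intros\<close>)+
  have pc: "perturbed_circle \<eta> = Ga"
    unfolding perturbed_circle_def Ga_def by (auto simp: r_def scaleR_add_left)
  have Om: "Omega \<eta> = In" unfolding Omega_def pc domain_unique by simp
  show "Omega \<eta> = {x. x = 0 \<or> norm x < 1 + \<eta> (x /\<^sub>R norm x)}" 
    unfolding Om In_def by (simp add: r_def sdir_def)
  define D where "D = Omega \<eta> - cball 0 lam"
  have D: "D = {x. lam < norm x \<and> norm x < 1 + \<eta> (x /\<^sub>R norm x)}"
    unfolding D_def Om In_def unfolding r_def sdir_def using lam by auto
  then show "Omega \<eta> - cball 0 lam = {x. lam < norm x \<and> norm x < 1 + \<eta> (x /\<^sub>R norm x)}" by (simp add: D_def)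
  show "\<exists>R. \<forall>u. norm u = 1 \<longrightarrow> \<eta> u = R" if "annulus (admissible_domain lam \<eta>)"
  proof -
    obtain R where "\<And>u. norm u = 1 \<Longrightarrow> r u = R"
      using annulus_imp_constant[OF lam(1) rl] \<open>annulus (admissible_domain lam \<eta>)\<close> unfolding admissible_domain_def Om by blast
    then show ?thesis by (intro exI[of _ "R - 1"]) (simp add: r_def, metis add_diff_cancel_left')
  qed
  have cb: "cball 0 lam \<subseteq> In"
  proof
    fix x :: "real^2" assume "x \<in> cball 0 lam"
    then show "x \<in> In" using rl[OF norm_sdir[of x]] by (cases "x = 0") (auto simp: In_def)
  qed
  have adm: "admissible_perturbation lam \<alpha> \<eta>"
    unfolding admissible_perturbation_def pc Om
  proof (intro conjI ballI cb \<eta>(1))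
    show "- 1 < \<eta> x" if "x \<in> sphere 0 1" for x using rl[of x] that lam by (simp add: r_def)
    show "\<exists>!\<Omega>. bounded_domain_with_boundary Ga \<Omega>" by (simp add: domain_unique)
  qed
  define W where "W = (\<lambda>z. of_real (\<gamma> / 2) * cnj z + F z)"
  define \<Psi> where "\<Psi> = (\<lambda>x. \<psi> (toC x))"
  \<comment> \<open>The differential is d -> Re (W d), which is the inner product of d with the
    conjugate of \<open>W\<close>.\<close>
  define G where "G = (\<lambda>x. ofC (cnj (W (toC x))))"
  define H where "H = (\<lambda>x. hess \<gamma> (deriv F (toC x)))"
  have DK: "toC x \<in> K" if "x \<in> D" for x
  proof -
    have "ofC (toC x / of_real (norm x)) = x /\<^sub>R norm x"
    proof -
      have "toC x / of_real (norm x) = toC (x /\<^sub>R norm x)" unfolding linear_toC by (simp add: scaleR_conv_of_real divide_inverse mult.commute)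
      then show ?thesis by simp
    qed
    then show ?thesis using that U(5) unfolding D by auto
  qed
  have cont_toC: "continuous_on S toC" "continuous_on S' ofC" for S S'
    by (rule linear_continuous_on, rule bounded_linear_toC)+
  have "toC ` closure D \<subseteq> K"
  proof (rule image_closure_subset[OF cont_toC(1) compact_imp_closed[OF U(2)]])
    show "toC ` D \<subseteq> K" using DK by auto
  qed
  then have closU: "toC ` closure D \<subseteq> U" using U(3) by blast
  have cF: "continuous_on (closure D) (\<lambda>x. F (toC x))" "continuous_on (closure D) (\<lambda>x. deriv F (toC x))"
    by (rule continuous_on_compose2[OF holomorphic_on_imp_continuous_on cont_toC(1) closU];
        intro U(1,4) holomorphic_deriv)+
  obtain L where L: "0 \<le> L" "\<And>x y. x \<in> K \<Longrightarrow> y \<in> K \<Longrightarrow> norm (deriv F x - deriv F y) \<le> L * norm (x - y)"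
    using holomorphic_Lipschitz_compact[OF holomorphic_deriv[OF U(4,1)] U(1-3)] by blast
  have dF: "(F has_derivative (\<lambda>h. deriv F z * h)) (at z)" if "z \<in> U" for z
    using holomorphic_derivI[OF U(4,1) that] by (simp add: has_field_derivative_def)
  have toC_der: "(toC has_derivative toC) (at x)" for x
    by (rule bounded_linear_imp_has_derivative[OF bounded_linear_toC(1)])
  have c2: "C2_up_to_boundary \<alpha> D \<Psi> G H"
    unfolding C2_up_to_boundary_def
  proof (intro conjI ballI)
    show "continuous_on (closure D) \<Psi>" unfolding \<Psi>_def
    proof (rule continuous_on_compose2[OF _ cont_toC(1) closU])
      show "continuous_on U \<psi>"
        by (rule has_derivative_continuous_on) (rule has_derivative_at_withinI[OF \<psi>(1)])
    qed
    show "continuous_on (closure D) G" unfolding G_def W_def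
      by (intro continuous_on_compose2[OF cont_toC(2)[of UNIV]] continuous_intros cF cont_toC) auto
    show "continuous_on (closure D) H" unfolding H_def hess_def
    proof (rule continuous_on_cong[THEN iffD1, OF refl])
      let ?f = "\<lambda>x. (\<chi> i j. if i = j then \<gamma> / 2 + (if i = 1 then 1 else - 1) * Re (deriv F (toC x)) else - Im (deriv F (toC x))) :: real^2^2"
      show "continuous_on (closure D) ?f"
      proof (intro continuous_on_vec_lambda)
        fix i j :: 2
        show "continuous_on (closure D) (\<lambda>x. if i = j then \<gamma> / 2 + (if i = 1 then 1 else - 1) * Re (deriv F (toC x)) else - Im (deriv F (toC x)))"
          by (cases "i = j") (auto intro!: continuous_intros cF)
      qed
      show "?f x = vector [vector [\<gamma> / 2 + Re (deriv F (toC x)), - Im (deriv F (toC x))],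
            vector [- Im (deriv F (toC x)), \<gamma> / 2 - Re (deriv F (toC x))]]" for x
        by (simp add: vec_eq_iff forall_2)
    qed
    fix x assume x: "x \<in> D"
    then have xU: "toC x \<in> U" using DK U(3) by blast
    show "GDERIV \<Psi> x :> G x"
      unfolding gderiv_def \<Psi>_def
    proof (rule has_derivative_eq_rhs[OF has_derivative_compose[OF toC_der \<psi>(1)[OF xU]]])
      show "(\<lambda>d. Re ((of_real (\<gamma> / 2) * cnj (toC x) + F (toC x)) * toC d)) = (\<lambda>h. h \<bullet> G x)"
        by (simp add: fun_eq_iff G_def W_def inner_vec_def sum_2 algebra_simps)
    qed
    show "(G has_derivative (\<lambda>h. H x *v h)) (at x)"
    proof -
      have eq: "G = (\<lambda>x. ofC (of_real (\<gamma> / 2) * toC x + cnj (F (toC x))))" by (simp add: G_def W_def fun_eq_iff)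
      have "((\<lambda>x. of_real (\<gamma> / 2) * toC x + cnj (F (toC x))) has_derivative
          (\<lambda>h. of_real (\<gamma> / 2) * toC h + cnj (deriv F (toC x) * toC h))) (at x)"
        by (intro has_derivative_add has_derivative_mult_right toC_der has_derivative_cnj
            has_derivative_compose[OF toC_der dF[OF xU]])
      then have "(G has_derivative (\<lambda>h. ofC (of_real (\<gamma> / 2) * toC h + cnj (deriv F (toC x) * toC h)))) (at x)"
        unfolding eq by (rule bounded_linear.has_derivative[OF bounded_linear_toC(2)])
      then show ?thesis by (simp add: H_def hess_apply)
    qed
  next
    show "holder_on \<alpha> D H"
      unfolding holder_on_def
    \<comment> \<open>Two points of \<open>D\<close> are at distance d <= 4, so d <= 4^(1 -
      \<alpha>) d^\<alpha> turns the Lipschitz constant 4 L of the Hessian into a Hoelder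
      constant.\<close>
    proof (intro exI[of _ "4 * L * 4 powr (1 - \<alpha>)"] ballI)
      fix x y assume xy: "x \<in> D" "y \<in> D"
      have le: "norm x \<le> 2" if "x \<in> D" for x
      proof -
        have *: "lam < norm x" "norm x < 1 + \<eta> (sdir x)" using that by (auto simp: D sdir_def)
        then have "x \<noteq> 0" using lam by auto
        from \<eta>(3)[OF norm_sdir[OF this]] * lam show ?thesis by (simp add: abs_le_iff)
      qed
      have dd: "norm (toC x - toC y) = dist x y" by (metis dist_norm linear_toC(2) norm_toC(1))
      have "dist x y = dist x y powr (1 - \<alpha>) * dist x y powr \<alpha>"
        by (simp flip: powr_add)
      also have "\<dots> \<le> 4 powr (1 - \<alpha>) * dist x y powr \<alpha>"
      proof (intro mult_right_mono powr_mono2)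
        show "dist x y \<le> 4" using le[OF xy(1)] le[OF xy(2)] norm_triangle_ineq4[of x y] by (simp add: dist_norm)
      qed (use \<alpha> in auto)
      finally have "4 * (L * dist x y) \<le> 4 * (L * (4 powr (1 - \<alpha>) * dist x y powr \<alpha>))"
        by (intro mult_left_mono L(1)) auto
      moreover have "dist (H x) (H y) \<le> 4 * (L * dist x y)"
        unfolding H_def by (rule order_trans[OF dist_hess]) (use L(2)[OF DK[OF xy(1)] DK[OF xy(2)]] dd in simp)
      ultimately show "dist (H x) (H y) \<le> 4 * L * 4 powr (1 - \<alpha>) * dist x y powr \<alpha>"
        by (simp only: mult.assoc)
    qed
  qed
  have bd: "\<exists>u. norm u = 1 \<and> toC x = u * of_real (1 + \<eta> (ofC u))" if xG: "x \<in> Ga" for x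
  proof -
    obtain u where u: "norm u = 1" "x = r u *\<^sub>R u" using xG by (auto simp: Ga_def)
    have "toC x = r u *\<^sub>R toC u" by (simp only: u(2) linear_toC)
    then show ?thesis using u(1) by (intro exI[of _ "toC u"]) (simp add: r_def scaleR_conv_of_real mult.commute)
  qed
  show "overdetermined_solution lam \<alpha> \<gamma> \<eta>"
    unfolding overdetermined_solution_def
  proof (intro conjI adm exI ballI)
    show "Q > 0" by fact
    show "C2_up_to_boundary \<alpha> (Omega \<eta> - cball 0 lam) \<Psi> G H" using c2 by (simp add: D_def)
    show "trace (H x) = \<gamma>" for x by (simp add: H_def trace_hess)
    show "\<Psi> x = 1" if "x \<in> frontier (ball 0 lam)" for x
      using that lam \<psi>(2)[of "toC x"] by (simp add: \<Psi>_def)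
    fix x assume "x \<in> frontier (Omega \<eta>)"
    then have "x \<in> Ga" by (simp add: Om frontier_In)
    then obtain u where u: "norm u = 1" "toC x = u * of_real (1 + \<eta> (ofC u))" using bd by blast
    show "\<Psi> x = 0" unfolding \<Psi>_def u(2) by (rule \<psi>(3)[OF u(1)])
    show "(norm (G x))\<^sup>2 = Q" using \<psi>(4)[OF u(1)] unfolding G_def W_def u(2) norm_toC complex_mod_cnj .
  qed
qed

section \<open>The bifurcating curve\<close>

lemma norm_ev_small:
  fixes P M :: "'b::{real_normed_algebra_1,banach,comm_ring_1}"
  assumes "norm P \<le> 1/2" "norm M \<le> 1/2"
  shows "norm (ev P M a - of_real (dcoeff a (0,0))) \<le> norm a * (norm P + norm M)"
  using ev_Lipschitz[of P M 0 0 a] assms by (simp add: ev_zero_zero)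

lemma continuous_on_ev: "continuous_on (cball 0 (1/2)) (\<lambda>z::complex. ev z (cnj z) a)"
proof (rule lipschitz_on_continuous_on[where L = "2 * norm a"], rule lipschitz_onI)
  fix x y :: complex assume "x \<in> cball 0 (1/2)" "y \<in> cball 0 (1/2)"
  then have "norm (ev x (cnj x) a - ev y (cnj y) a) \<le> norm a * (norm (x - y) + norm (cnj x - cnj y))"
    by (intro ev_Lipschitz) auto
  also have "norm (cnj x - cnj y) = norm (x - y)" by (metis complex_cnj_diff complex_mod_cnj)
  finally show "dist (ev x (cnj x) a) (ev y (cnj y) a) \<le> 2 * norm a * dist x y"
    by (simp add: dist_norm algebra_simps)
qed simp

text \<open>In a diagonal term the powers of zeta and its conjugate cancel, so the value is the same
  at all points of the circle.\<close>

lemma ev_diag: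
  assumes "\<And>m n. m \<noteq> n \<Longrightarrow> dcoeff a (m,n) = 0" and z: "norm \<zeta> = 1" and \<sigma>: "\<bar>\<sigma>\<bar> \<le> 1"
  shows "ev (of_real \<sigma> * \<zeta>) (cnj (of_real \<sigma> * \<zeta>)) a = of_real (ev \<sigma> \<sigma> a)"
proof -
  have zz: "\<zeta> ^ n * cnj \<zeta> ^ n = 1" for n
    using z by (simp add: power_mult_distrib[symmetric] complex_norm_square[symmetric])
  have "dcoeff a i *\<^sub>R ((of_real \<sigma> * \<zeta>) ^ fst i * (cnj (of_real \<sigma> * \<zeta>)) ^ snd i)
      = of_real (dcoeff a i *\<^sub>R (\<sigma> ^ fst i * \<sigma> ^ snd i))" for i
  proof (cases "fst i = snd i")
    case True
    then obtain n where i: "i = (n,n)" by (metis prod.collapse)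
    have "(of_real \<sigma> * \<zeta>) ^ n * (cnj (of_real \<sigma> * \<zeta>)) ^ n = of_real (\<sigma> ^ n * \<sigma> ^ n) * (\<zeta> ^ n * cnj \<zeta> ^ n)"
      by (simp add: power_mult_distrib)
    then show ?thesis unfolding i by (simp only: zz fst_conv snd_conv) (simp add: scaleR_conv_of_real)
  next
    case False
    then have "dcoeff a i = 0" using assms(1)[of "fst i" "snd i"] by simp
    then show ?thesis by simp
  qed
  moreover have "norm \<sigma> \<le> 1" using \<sigma> by simp
  ultimately show ?thesis unfolding ev_def
    using infsumI[OF has_sum_of_real[OF has_sum_infsum[OF summable_ev[of \<sigma> \<sigma> a]]]] by simp
qed

text \<open>It makes the mean over the circle the value of a series, hence a smooth function of
  \<open>\<sigma>\<close>.\<close>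

lemma mode_0_conv_ev:
  shows "mode a \<sigma> 0 = ev \<sigma> \<sigma> (dmul diag a)"
proof -
  have d: "\<bar>diag i\<bar> \<le> 1" for i by (simp add: diag_def)
  have inj: "inj (\<lambda>n::nat. (n,n))" by (auto simp: inj_on_def)
  have "ev \<sigma> \<sigma> (dmul diag a) = (\<Sum>\<^sub>\<infinity>i\<in>range (\<lambda>n. (n,n)). dcoeff a i * (\<sigma> ^ fst i * \<sigma> ^ snd i))"
    unfolding ev_def by (rule infsum_cong_neutral) (auto simp: dcoeff_dmul[OF d] diag_def)
  also have "\<dots> = (\<Sum>\<^sub>\<infinity>n. dcoeff a (n,n) * (\<sigma> ^ n * \<sigma> ^ n))"
    by (subst infsum_reindex[OF inj]) (simp add: o_def)
  finally show ?thesis by (simp add: mode_def mult_2 power_add)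
qed

text \<open>The series used below is symmetric, so its value at conjugate arguments is already real
  and \<open>Re\<close> only changes the type.\<close>

definition profile :: "dps \<Rightarrow> real \<Rightarrow> real^2 \<Rightarrow> real" where
  "profile N s x = Re (ev (of_real s * toC x) (cnj (of_real s * toC x)) N)"

lemma angular_profile:
  assumes "\<bar>s\<bar> \<le> 1" shows "angular (profile N s) = trig_series (curve N s) 0"
proof
  fix \<theta>
  let ?z = "of_real s * cis \<theta>"
  have n: "norm ?z \<le> 1" "norm (cnj ?z) \<le> 1" using assms by (simp_all add: norm_mult)
  have "?z ^ m * cnj ?z ^ n = of_real (s ^ (m + n)) * cis (real m * \<theta> - real n * \<theta>)" for m n
  proof -
    have "cis \<theta> ^ m * cis (- \<theta>) ^ n = cis (real m * \<theta> - real n * \<theta>)"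
      unfolding Complex.DeMoivre cis_mult by (simp only: mult_minus_right add_uminus_conv_diff)
    then show ?thesis by (simp add: power_mult_distrib power_add cis_cnj mult.assoc mult.left_commute)
  qed
  then have t: "Re (dcoeff N i *\<^sub>R (?z ^ fst i * cnj ?z ^ snd i)) = curve N s i * cos (angfreq i * \<theta> + 0)" for i
    by (simp add: curve_def tdeg_def angfreq_def left_diff_distrib)
  have "angular (profile N s) \<theta> = Re (ev ?z (cnj ?z) N)" by (simp add: angular_def profile_def toC_unit_vec)
  also have "\<dots> = (\<Sum>\<^sub>\<infinity>i. Re (dcoeff N i *\<^sub>R (?z ^ fst i * cnj ?z ^ snd i)))"
    unfolding ev_def by (rule infsum_Re[symmetric]) (rule summable_ev[OF n])
  finally show "angular (profile N s) \<theta> = trig_series (curve N s) 0 \<theta>" by (simp only: t trig_series_def)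
qed

text \<open>The factor \<open>c\<close> relates two parameters: the boundary graph at
  \<open>s\<close> belongs to the conformal map at \<sigma> = c s.\<close>

locale bifurcation = annular "lam\<^sup>2" for lam +
  fixes e c :: real and T B w \<nu> Y :: dps
  assumes lam: "0 < lam" "lam < 1" and e: "e > 0" and c: "0 < c" "c \<le> 1"
    and T: "dswap T = T" "\<And>n. dcoeff T (n,n) = 0" "dcoeff T (Suc 0, 0) = e" and B: "has_angular_deriv T B"
    and w: "dcoeff w (0,0) = 0" "\<And>m n. m \<noteq> n \<Longrightarrow> dcoeff w (m,n) = 0"
    and \<nu>: "dcoeff \<nu> (0,0) = 0" "\<And>m n. m \<noteq> n \<Longrightarrow> dcoeff \<nu> (m,n) = 0"
    and boundary: "(exp (2 * T) + exp (2 * T) * M B - M (exp (2 * T) * B) - 1 + (of_real (1 - lam\<^sup>2) + w))\<^sup>2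
      = ((of_real (1 - lam\<^sup>2) + w)\<^sup>2 + \<nu>) * (exp (2 * T) * ((1 + M B)\<^sup>2 - B\<^sup>2))"
    and Y: "dswap Y = - Y" "dcoeff Y (0,0) = 0"
    and PQ: "norm (c *\<^sub>R (dmono (Suc 0,0) * exp Y)) \<le> 1/2" "norm (c *\<^sub>R (dmono (0,Suc 0) * exp (- Y))) \<le> 1/2"
    and Y_eq: "Y = - ev (c *\<^sub>R (dmono (Suc 0,0) * exp Y)) (c *\<^sub>R (dmono (0,Suc 0) * exp (- Y))) (M T)"
begin

text \<open>Evaluated at s u and its conjugate, \<open>P\<close> and \<open>Q\<close> are c s zeta
  and its conjugate, where zeta is the point of the unit circle that the conformal map sends to the
  boundary point in direction u.\<close>

definition P where "P = c *\<^sub>R (dmono (Suc 0,0) * exp Y)"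
definition Q where "Q = c *\<^sub>R (dmono (0,Suc 0) * exp (- Y))"
definition N where "N = exp (ev P Q T) - 1"
definition E where "E = exp (2 * T)"
definition omg where "omg = of_real (1 - lam\<^sup>2) + w"
text \<open>The series of 4 / \<gamma>. The Dirichlet data give c0 = \<gamma> (e0 - lam^2) / 4 + 1
  with e0 the mean of \<open>E\<close>, while \<open>\<omega>\<close> is defined by c0 = - \<gamma>
  (1 - \<omega>) ln lam / 2; elimination of c0 leaves this expression.\<close>

definition Dn where "Dn = (- 2 * ln lam) *\<^sub>R (1 - omg) - dmul diag E + of_real (lam\<^sup>2)"

definition gam where "gam s = 4 / ev (c * s) (c * s) Dn"

lemma PQ1: "norm P \<le> 1" "norm Q \<le> 1" using PQ by (simp_all add: P_def Q_def)

lemma N_coeffs: "dswap N = N" "dcoeff N (0,0) = 0" "dcoeff N (Suc 0,0) = c * e" "dcoeff N (0,Suc 0) = c * e"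
proof -
  note p = profile_coefficients[OF PQ1 P_def Q_def Y T(1) T(2) T(3), folded N_def]
  show "dswap N = N" "dcoeff N (0,0) = 0" "dcoeff N (Suc 0,0) = c * e" by (rule p)+
  then show "dcoeff N (0,Suc 0) = c * e" using dcoeff_dswap[of N "Suc 0" 0] by simp
qed

lemma E_props: "dswap E = E" "has_angular_deriv E (E * (2 * B))" "dcoeff E (0,0) = 1"
proof -
  have t2: "2 * T = 2 *\<^sub>R T" "2 * B = 2 *\<^sub>R B" by (simp_all add: scaleR_conv_of_real)
  show "dswap E = E" using T(1) by (simp add: E_def dswap_exp t2)
  have "has_angular_deriv (2 * T) (2 * B)" using B by (simp add: has_angular_deriv_def t2)
  then show "has_angular_deriv E (E * (2 * B))" unfolding E_def by (rule has_angular_deriv_exp)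
  show "dcoeff E (0,0) = 1" using T(2) by (simp add: E_def t2 dcoeff_exp_00)
qed

lemma B_antisym: "dswap B = - B"
proof (rule dps_eqI2)
  fix m n
  have "dcoeff T (n,m) = dcoeff T (m,n)" using dcoeff_dswap[of T m n] T(1) by simp
  moreover have "dcoeff B (i,j) = (real i - real j) * dcoeff T (i,j)" for i j
    using B by (simp add: has_angular_deriv_def)
  ultimately show "dcoeff (dswap B) (m,n) = dcoeff (- B) (m,n)"
    unfolding dcoeff_dswap dcoeff_uminus by (simp add: left_diff_distrib)
qed

text \<open>Negativity is the strict inequality ln x < x - 1 at x = 1 / lam^2. It keeps
  \<open>gam\<close> finite near s = 0.\<close>

lemma Dn_00: "dcoeff Dn (0,0) = lam\<^sup>2 - 2 * lam\<^sup>2 * ln lam - 1" "dcoeff Dn (0,0) < 0"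
proof -
  show eq: "dcoeff Dn (0,0) = lam\<^sup>2 - 2 * lam\<^sup>2 * ln lam - 1"
    using E_props(3) w(1) by (simp add: Dn_def omg_def dcoeff_ops diag_def of_real_def dcoeff_one algebra_simps)
  define x where "x = 1 / lam\<^sup>2"
  have x: "x > 0" "x \<noteq> 1" using lam q by (auto simp: x_def)
  have "ln x < x - 1" using ln_le_minus_one[OF x(1)] ln_eq_minus_one[OF x(1)] x(2) by force
  moreover have "ln x = - 2 * ln lam" using lam by (simp add: x_def ln_div ln_realpow)
  ultimately have "lam\<^sup>2 * (- 2 * ln lam) < lam\<^sup>2 * (x - 1)" using lam by (intro mult_strict_left_mono) auto
  then show "dcoeff Dn (0,0) < 0" unfolding eq using lam by (simp add: x_def algebra_simps)
qed

lemma gam_C1: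
  assumes s0: "s0 \<le> 1/2" and nz: "\<And>s. \<bar>s\<bar> < s0 \<Longrightarrow> ev (c * s) (c * s) Dn \<noteq> 0"
  shows "gam C1_differentiable_on {-s0<..<s0}"
proof -
  \<comment> \<open>Scaling the coefficients by powers of \<open>c\<close> substitutes c s for s in
    the series.\<close>
  define a where "a = dmul (\<lambda>i. c ^ tdeg i) Dn"
  have b: "\<bar>c ^ tdeg i\<bar> \<le> 1" for i using c by (simp add: power_le_one)
  have eq: "ev s s a = ev (c * s) (c * s) Dn" for s
    unfolding ev_def a_def dcoeff_dmul[OF b] by (simp add: tdeg_def power_mult_distrib power_add ac_simps)
  obtain D where D: "\<And>x. x \<in> {-s0<..<s0} \<Longrightarrow> ((\<lambda>s. ev s s a) has_vector_derivative D x) (at x)"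
    "continuous_on {-s0<..<s0} D"
    using infsum_C1[OF s0, of a] unfolding C1_differentiable_on_def by blast
  have cf: "continuous_on {-s0<..<s0} (\<lambda>s. ev s s a)"
    by (intro continuous_at_imp_continuous_on ballI) (rule has_vector_derivative_continuous[OF D(1)])
  have nz': "ev s s a \<noteq> 0" if "s \<in> {-s0<..<s0}" for s unfolding eq by (rule nz) (use that in auto)
  show ?thesis unfolding C1_differentiable_on_def
  proof (intro exI[of _ "\<lambda>s. - (4 * D s) / (ev s s a)\<^sup>2"] conjI ballI)
    fix x assume x: "x \<in> {-s0<..<s0}"
    have "((\<lambda>s. ev s s a) has_field_derivative D x) (at x)"
      using D(1)[OF x] by (simp add: has_real_derivative_iff_has_vector_derivative)
    then have "((\<lambda>s. 4 / ev s s a) has_field_derivative - (4 * D x) / (ev x x a)\<^sup>2) (at x)"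
      using nz'[OF x] by (auto intro!: derivative_eq_intros simp: power2_eq_square)
    then show "(gam has_vector_derivative - (4 * D x) / (ev x x a)\<^sup>2) (at x)"
      by (simp add: has_real_derivative_iff_has_vector_derivative[symmetric] eq gam_def[abs_def])
  qed (use nz' in \<open>auto intro!: continuous_intros D(2) cf\<close>)
qed

lemma small_parameter:
  obtains s0 where "0 < s0" "s0 \<le> 1/16" 
    "\<And>s. \<bar>s\<bar> < s0 \<Longrightarrow> 4 * (2 / (1 - lam\<^sup>2) * norm T) * \<bar>c * s\<bar> \<le> (1 - lam) / 64"
    "\<And>s. \<bar>s\<bar> < s0 \<Longrightarrow> 2 * norm N * \<bar>s\<bar> \<le> (1 - lam) / 4"
    "\<And>s. \<bar>s\<bar> < s0 \<Longrightarrow> ev (c * s) (c * s) Dn \<noteq> 0"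
    "\<And>s. \<bar>s\<bar> < s0 \<Longrightarrow> 0 < ev (c * s) (c * s) (omg\<^sup>2 + \<nu>)"
proof -
  have small: "\<forall>\<^sub>F s0 in at_right 0. a * s0 < r" if "r > 0" for a r :: real
  proof -
    have "((\<lambda>s. a * s) \<longlongrightarrow> a * 0) (at_right 0)" by (intro tendsto_intros)
    then show ?thesis using order_tendstoD(2)[of "\<lambda>s. a * s" "a * 0" "at_right 0" r] that by simp
  qed
  have o00: "0 < dcoeff (omg\<^sup>2 + \<nu>) (0,0)"
    using w(1) \<nu>(1) q by (simp add: omg_def power2_eq_square dcoeff_mult of_real_def dcoeff_one)
  have l: "0 < (1 - lam) / 64" "0 < (1 - lam) / 4" "0 < - dcoeff Dn (0,0)" "(0::real) < 1/16" using lam Dn_00 by auto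
  have "\<forall>\<^sub>F s0 in at_right 0. 0 < s0 \<and> 1 * s0 < 1/16 \<and> (4 * (2 / (1 - lam\<^sup>2) * norm T)) * s0 < (1 - lam) / 64
      \<and> (2 * norm N) * s0 < (1 - lam) / 4 \<and> (2 * norm Dn) * s0 < - dcoeff Dn (0,0)
      \<and> (2 * norm (omg\<^sup>2 + \<nu>)) * s0 < dcoeff (omg\<^sup>2 + \<nu>) (0,0)"
    by (intro eventually_conj eventually_at_right_less small l o00)
  from eventually_happens'[OF _ this] obtain s0 where s0: "0 < s0" "s0 < 1/16"
    "(4 * (2 / (1 - lam\<^sup>2) * norm T)) * s0 < (1 - lam) / 64" "(2 * norm N) * s0 < (1 - lam) / 4"
    "(2 * norm Dn) * s0 < - dcoeff Dn (0,0)" "(2 * norm (omg\<^sup>2 + \<nu>)) * s0 < dcoeff (omg\<^sup>2 + \<nu>) (0,0)" by auto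
  have cs: "\<bar>c * s\<bar> \<le> \<bar>s\<bar>" for s using c by (simp add: abs_mult mult_left_le_one_le)
  have near: "\<bar>ev (c * s) (c * s) a - dcoeff a (0,0)\<bar> \<le> (2 * norm a) * s0" if "\<bar>s\<bar> < s0" for s a
  proof -
    have "\<bar>c * s\<bar> \<le> 1/2" using cs[of s] that s0 by linarith
    then have "\<bar>ev (c * s) (c * s) a - dcoeff a (0,0)\<bar> \<le> norm a * (\<bar>c * s\<bar> + \<bar>c * s\<bar>)"
      using norm_ev_small[of "c * s" "c * s" a] by simp
    also have "\<dots> \<le> norm a * (s0 + s0)" using cs[of s] that by (intro mult_left_mono add_mono) auto
    finally show ?thesis by (simp add: algebra_simps)
  qed
  show thesis
  proof (rule that[OF s0(1)])
    show "s0 \<le> 1/16" using s0 by simp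
    fix s assume s: "\<bar>s\<bar> < s0"
    have "4 * (2 / (1 - lam\<^sup>2) * norm T) * \<bar>c * s\<bar> \<le> 4 * (2 / (1 - lam\<^sup>2) * norm T) * s0"
      using cs[of s] s q by (intro mult_left_mono) auto
    then show "4 * (2 / (1 - lam\<^sup>2) * norm T) * \<bar>c * s\<bar> \<le> (1 - lam) / 64" using s0(3) by linarith
    have "2 * norm N * \<bar>s\<bar> \<le> 2 * norm N * s0" using s by (intro mult_left_mono) auto
    then show "2 * norm N * \<bar>s\<bar> \<le> (1 - lam) / 4" using s0(4) by linarith
    show "ev (c * s) (c * s) Dn \<noteq> 0" using near[OF s, of Dn] s0(5) by linarith
    show "0 < ev (c * s) (c * s) (omg\<^sup>2 + \<nu>)" using near[OF s, of "omg\<^sup>2 + \<nu>"] s0(6) by linarith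
  qed
qed

lemma overdetermined_at:
  assumes \<alpha>: "0 < \<alpha>" "\<alpha> < 1" and s: "\<bar>s\<bar> \<le> 1/16"
    and small1: "4 * (2 / (1 - lam\<^sup>2) * norm T) * \<bar>c * s\<bar> \<le> (1 - lam) / 64"
    and small2: "2 * norm N * \<bar>s\<bar> \<le> (1 - lam) / 4"
    and Dn0: "ev (c * s) (c * s) Dn \<noteq> 0" and \<mu>: "0 < ev (c * s) (c * s) (omg\<^sup>2 + \<nu>)"
  defines "\<eta> \<equiv> profile N s"
  shows "overdetermined_solution lam \<alpha> (gam s) \<eta>"
    "Omega \<eta> = {x. x = 0 \<or> norm x < 1 + \<eta> (x /\<^sub>R norm x)}"
    "Omega \<eta> - cball 0 lam = {x. lam < norm x \<and> norm x < 1 + \<eta> (x /\<^sub>R norm x)}"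
    "annulus (admissible_domain lam \<eta>) \<Longrightarrow> \<exists>R. \<forall>u. norm u = 1 \<longrightarrow> \<eta> u = R"
proof -
  define \<sigma> where "\<sigma> = c * s"
  have "\<bar>\<sigma>\<bar> \<le> 1 * (1/16)" unfolding \<sigma>_def abs_mult by (intro mult_mono s) (use c in auto)
  then have \<sigma>: "\<bar>\<sigma>\<bar> \<le> 1/16" by simp
  define \<gamma> where "\<gamma> = gam s"
  define \<omega> where "\<omega> = ev \<sigma> \<sigma> omg"
  define e0 where "e0 = mode E \<sigma> 0"
  define c0 where "c0 = \<gamma> * (e0 - lam\<^sup>2) / 4 + 1"
  have \<sigma>n: "norm \<sigma> \<le> 1" and \<sigma>1: "\<bar>\<sigma>\<bar> \<le> 1" using \<sigma> by simp_all
  have ll: "ln lam < 0" using lam by (simp add: ln_less_zero)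
  have \<gamma>0: "\<gamma> \<noteq> 0" using Dn0 by (simp add: \<gamma>_def gam_def)
  have Dne: "ev \<sigma> \<sigma> Dn = - 2 * ln lam * (1 - \<omega>) - e0 + lam\<^sup>2"
    unfolding Dn_def \<omega>_def e0_def mode_0_conv_ev ev_scaleR_etc[OF \<sigma>n \<sigma>n] ev_one[OF \<sigma>n \<sigma>n] by simp
  have "\<gamma> * (- 2 * ln lam * (1 - \<omega>) - e0 + lam\<^sup>2) = 4"
    using Dn0 unfolding \<gamma>_def gam_def Dne[symmetric] \<sigma>_def by simp
  then have "\<gamma> * (e0 - lam\<^sup>2) = - 2 * (\<gamma> * ln lam * (1 - \<omega>)) - 4" by (simp add: algebra_simps)
  then have "c0 = - \<gamma> * ln lam * (1 - \<omega>) / 2" unfolding c0_def by (simp add: field_simps)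
  then have c0l: "c0 / ln lam = - (\<gamma> / 2 * (1 - \<omega>))" using ll by simp
  define nuu where "nuu = (\<lambda>u. \<eta> (ofC u))"
  have nuu: "nuu u = Re (ev (of_real s * u) (cnj (of_real s * u)) N)" for u
    by (simp add: nuu_def \<eta>_def profile_def)
  have su: "norm (of_real s * u) \<le> 1/2" "norm (cnj (of_real s * u)) \<le> 1/2"
    "norm (of_real s * u) \<le> 1" "norm (cnj (of_real s * u)) \<le> 1" if "norm u = 1" for u :: complex
    using s that by (simp_all add: norm_mult)
  have nuu_small: "\<bar>nuu u\<bar> \<le> (1 - lam) / 4" if u: "norm u = 1" for u
  proof -
    have "\<bar>nuu u\<bar> \<le> norm (ev (of_real s * u) (cnj (of_real s * u)) N)" unfolding nuu by (rule abs_Re_le_cmod)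
    also have "\<dots> \<le> norm N * (norm (of_real s * u) + norm (cnj (of_real s * u)))"
      using norm_ev_small[OF su(1,2)[OF u], of N] by (simp add: N_coeffs)
    also have "\<dots> = 2 * norm N * \<bar>s\<bar>" using u by (simp add: norm_mult)
    finally show ?thesis using small2 by linarith
  qed
  have cont_sph: "continuous_on (sphere 0 1) (\<lambda>u. ev (of_real s * u) (cnj (of_real s * u)) a)" for a
    by (rule continuous_on_compose2[OF continuous_on_ev, of _ "\<lambda>u. of_real s * u"])
       (use s in \<open>auto intro!: continuous_intros simp: norm_mult\<close>)
  have nuu_cont: "continuous_on (sphere 0 1) nuu"
    unfolding nuu by (intro continuous_intros cont_sph)
  interpret annular_map "ext_coeff (lam\<^sup>2) T \<sigma>" "2 / (1 - lam\<^sup>2) * norm T" \<sigma> "ext_coeff (lam\<^sup>2) E \<sigma>" "2 / (1 - lam\<^sup>2) * norm E" lam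
    by (intro annular_map.intro annular_map_axioms.intro ext_decreasing \<sigma> lam)
       (use small1 in \<open>simp_all add: ext_coeff_def \<sigma>_def\<close>)
  define evp where "evp = (\<lambda>\<zeta> a. ev (of_real \<sigma> * \<zeta>) (cnj (of_real \<sigma> * \<zeta>)) a)"
  have pn: "norm (of_real \<sigma> * \<zeta>) \<le> 1" "norm (cnj (of_real \<sigma> * \<zeta>)) \<le> 1" if "norm \<zeta> = 1" for \<zeta>
    using \<sigma> that by (simp_all add: norm_mult)
  have T0: "mode T \<sigma> 0 = 0" by (simp add: mode_def T)
  have g_circle: "g \<zeta> = evp \<zeta> T + evp \<zeta> (M T)" and g'_circle: "\<zeta> * g' \<zeta> = evp \<zeta> (M B) + evp \<zeta> B"
    and k_circle: "k \<zeta> = evp \<zeta> E + evp \<zeta> (M E) - of_real e0"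
    and k'_circle: "\<zeta> * k' \<zeta> = evp \<zeta> (M (E * (2 * B))) + evp \<zeta> (E * (2 * B))" if z: "norm \<zeta> = 1" for \<zeta>
  proof -
    have z0: "\<zeta> \<noteq> 0" using z by auto
    note bT = ext_boundary[OF \<sigma> z T(1) B] and bE = ext_boundary[OF \<sigma> z E_props(1,2)]
    show "g \<zeta> = evp \<zeta> T + evp \<zeta> (M T)" using bT(1) by (simp add: g_def refl_def evp_def T0)
    show "k \<zeta> = evp \<zeta> E + evp \<zeta> (M E) - of_real e0" using bE(1) by (simp add: k_def refl_def evp_def e0_def)
    have r: "\<zeta> * (a + of_real (lam\<^sup>2) / \<zeta>\<^sup>2 * b) = \<zeta> * a + of_real (lam\<^sup>2) / \<zeta> * b" for a b
      using z0 by (simp add: power2_eq_square distrib_left)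
    show "\<zeta> * g' \<zeta> = evp \<zeta> (M B) + evp \<zeta> B" unfolding g'_def r using bT(2) by (simp add: refl_def evp_def)
    show "\<zeta> * k' \<zeta> = evp \<zeta> (M (E * (2 * B))) + evp \<zeta> (E * (2 * B))"
      unfolding k'_def r using bE(2) by (simp add: refl_def evp_def)
  qed
  have real: "evp \<zeta> a \<in> \<real>" if "dswap a = a" for \<zeta> a unfolding evp_def by (rule ev_real_if_sym[OF that])
  have imag: "Re (evp \<zeta> a) = 0" if "dswap a = - a" "norm \<zeta> = 1" for \<zeta> a
    unfolding evp_def by (rule ev_imag_if_antisym[OF that(1) pn(1)[OF that(2)]])
  have MT: "dswap (M T) = - M T" and ME: "dswap (M E) = - M E" and MB: "dswap (M B) = M B"
    using T(1) E_props(1) B_antisym by (simp_all add: dswap_ops linear_simps[OF blin(1)])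
  have evE: "evp \<zeta> E = exp (2 * evp \<zeta> T)" if z: "norm \<zeta> = 1" for \<zeta>
  proof -
    have "2 * T = 2 *\<^sub>R T" by (simp add: scaleR_conv_of_real)
    then show ?thesis unfolding E_def evp_def using ev_exp[OF pn[OF z], of "2 * T"] ev_scaleR_etc(4)[OF pn[OF z], of 2 T]
      by (simp add: scaleR_conv_of_real)
  qed
  have f_norm: "of_real ((norm (f \<zeta>))\<^sup>2) = evp \<zeta> E" if z: "norm \<zeta> = 1" for \<zeta>
  proof -
    obtain t where t: "evp \<zeta> T = of_real t" using real[OF T(1), of \<zeta>] by (auto elim: Reals_cases)
    have "norm (f \<zeta>) = exp t" using z imag[OF MT z] t by (simp add: f_def norm_mult norm_exp_eq_Re g_circle[OF z])
    then show ?thesis unfolding evE[OF z] t by (simp add: exp_double[symmetric] exp_of_real[symmetric] power2_eq_square exp_add[symmetric])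
  qed
  \<comment> \<open>Imaginary valued: u exp (\<open>rot u\<close>) is the point of the unit circle
    whose image under \<open>f\<close> has direction u.\<close>
  define rot where "rot = (\<lambda>u. ev (of_real s * u) (cnj (of_real s * u)) Y)"
  have rot: "f (u * exp (rot u)) = u * of_real (1 + nuu u)" "norm (u * exp (rot u)) = 1" "Re (rot u) = 0" if u: "norm u = 1" for u
  proof -
    define z where "z = of_real s * u"
    have zn: "norm z \<le> 1" "norm (cnj z) \<le> 1" using su(3,4)[OF u] by (simp_all add: z_def)
    show Re0: "Re (rot u) = 0" unfolding rot_def by (rule ev_imag_if_antisym[OF Y(1) su(3)[OF u]])
    then show \<zeta>1: "norm (u * exp (rot u)) = 1" using u by (simp add: norm_mult norm_exp_eq_Re)
    define \<zeta> where "\<zeta> = u * exp (rot u)"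
    have cr: "cnj (rot u) = - rot u" using Re0 by (simp add: complex_eq_iff)
    have evP: "ev z (cnj z) P = of_real \<sigma> * \<zeta>"
      unfolding P_def ev_scaleR_etc(4)[OF zn] ev_mult[OF zn] ev_dmono ev_exp[OF zn]
      by (simp add: \<zeta>_def \<sigma>_def rot_def z_def scaleR_conv_of_real ac_simps)
    have evQ: "ev z (cnj z) Q = cnj (of_real \<sigma> * \<zeta>)"
      unfolding Q_def ev_scaleR_etc(3,4)[OF zn] ev_mult[OF zn] ev_dmono ev_exp[OF zn]
    proof -
      have "exp (- rot u) = cnj (exp (rot u))" unfolding cr[symmetric] by (simp add: exp_cnj)
      then show "c *\<^sub>R (cnj z * exp (- ev z (cnj z) Y)) = cnj (of_real \<sigma> * \<zeta>)"
        by (simp add: \<zeta>_def \<sigma>_def rot_def z_def scaleR_conv_of_real ac_simps)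
    qed
    have comp: "ev z (cnj z) (ev P Q a) = evp \<zeta> a" for a
    proof -
      have "ev z (cnj z) (ev P Q a) = ev (ev z (cnj z) P) (ev z (cnj z) Q) a"
        by (rule ev_hom_commute[OF bounded_linear_ev ev_mult ev_one PQ1]) (use zn in auto)
      then show ?thesis unfolding evP evQ evp_def .
    qed
    have "rot u = ev z (cnj z) (- ev P Q (M T))" using Y_eq by (simp add: rot_def z_def P_def Q_def)
    then have r: "rot u = - evp \<zeta> (M T)" unfolding ev_scaleR_etc(3)[OF zn] comp .
    obtain t where t: "evp \<zeta> T = of_real t" using real[OF T(1), of \<zeta>] by (auto elim: Reals_cases)
    have "ev z (cnj z) N = exp (evp \<zeta> T) - 1"
      unfolding N_def ev_scaleR_etc(2)[OF zn] ev_exp[OF zn] comp ev_one[OF zn] ..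
    then have nu: "1 + nuu u = exp t" by (simp add: nuu z_def t exp_of_real)
    have r': "evp \<zeta> (M T) = - rot u" using r by simp
    \<comment> \<open>The equation defining \<open>Y\<close> says that this rotation cancels the
      angle \<open>M T\<close> of f at zeta, so only the modulus exp t remains.\<close>
    have "f \<zeta> = u * exp (rot u) * exp (of_real t - rot u)"
      unfolding f_def g_circle[OF \<zeta>1[folded \<zeta>_def]] t r' by (simp add: \<zeta>_def)
    also have "\<dots> = u * exp (of_real t)" by (simp add: mult.assoc flip: exp_add)
    finally show "f (u * exp (rot u)) = u * of_real (1 + nuu u)" unfolding nu \<zeta>_def[symmetric] by (simp add: exp_of_real)
  qed
  interpret annular_domain "ext_coeff (lam\<^sup>2) T \<sigma>" "2 / (1 - lam\<^sup>2) * norm T" \<sigma> "ext_coeff (lam\<^sup>2) E \<sigma>" "2 / (1 - lam\<^sup>2) * norm E" lam nuu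
  proof
    show "continuous_on (sphere 0 1) nuu" by (rule nuu_cont)
    show "\<bar>nuu u\<bar> \<le> (1 - lam) / 4" if "norm u = 1" for u by (rule nuu_small[OF that])
    show "\<exists>\<zeta>. norm \<zeta> = 1 \<and> f \<zeta> = u * of_real (1 + nuu u)" if "norm u = 1" for u
      using rot[OF that] by blast
    show "\<exists>u. norm u = 1 \<and> f \<zeta> = u * of_real (1 + nuu u)" if z: "norm \<zeta> = 1" for \<zeta>
    proof -
      have "continuous_on (sphere 0 1) (\<lambda>u. Im (rot u))" unfolding rot_def by (intro continuous_intros cont_sph)
      then obtain u where u: "norm u = 1" "u * cis (Im (rot u)) = \<zeta>"
        using circle_rotation_surj[of 1 "\<lambda>u. Im (rot u)" \<zeta>] z by (metis zero_less_one)
      have "exp (rot u) = cis (Im (rot u))" using rot(3)[OF u(1)] by (simp add: exp_eq_polar)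
      then show ?thesis using rot(1)[OF u(1)] u by metis
    qed
  qed
  define \<mu>' where "\<mu>' = ev \<sigma> \<sigma> (omg\<^sup>2 + \<nu>)"
  define QQ where "QQ = (\<gamma> / 2)\<^sup>2 * \<mu>'"
  have QQ: "0 < QQ" using \<mu> \<gamma>0 by (simp add: QQ_def \<mu>'_def \<sigma>_def)
  have kb: "Re (k \<zeta>) = (norm (f \<zeta>))\<^sup>2 - e0" if z: "norm \<zeta> = 1" for \<zeta>
    unfolding k_circle[OF z] f_norm[OF z, symmetric] using imag[OF ME z] by simp
  have Qb: "(norm (of_real (\<gamma> / 2 * (norm (f \<zeta>))\<^sup>2) * (1 + \<zeta> * g' \<zeta>)
        + \<zeta> * (- of_real (\<gamma> / 4) * k' \<zeta> + of_real (c0 / ln lam) / \<zeta>)))\<^sup>2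
      = QQ * (norm (f \<zeta> * (1 + \<zeta> * g' \<zeta>)))\<^sup>2" if z: "norm \<zeta> = 1" for \<zeta>
  proof -
    note p = pn[OF z]
    note hom = ev_scaleR_etc[OF p] ev_mult[OF p] ev_one[OF p]
    have z0: "\<zeta> \<noteq> 0" using z by auto
    define x where "x = evp \<zeta> E"
    define m where "m = evp \<zeta> (M B)"
    define b where "b = evp \<zeta> B"
    define eb where "eb = evp \<zeta> (M (E * B))"
    \<comment> \<open>Up to the factor \<gamma> / 2 this is the conjugate of the gradient multiplied
      by zeta f'. The imaginary terms \<open>E B\<close> from |f|^2 and from k' cancel, so it is
      real.\<close>
    define pp where "pp = x + x * m - eb - 1 + of_real \<omega>"
    have two: "E * (2 * B) = 2 *\<^sub>R (E * B)" by (simp add: scaleR_conv_of_real)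
    have k': "\<zeta> * k' \<zeta> = 2 * eb + 2 * (x * b)"
      unfolding k'_circle[OF z] two linear_simps[OF blin(1)] eb_def x_def b_def evp_def hom
      by (simp add: scaleR_conv_of_real)
    have g': "1 + \<zeta> * g' \<zeta> = 1 + m + b" unfolding g'_circle[OF z] by (simp add: m_def b_def)
    have "of_real (\<gamma> / 2 * (norm (f \<zeta>))\<^sup>2) * (1 + \<zeta> * g' \<zeta>)
        + \<zeta> * (- of_real (\<gamma> / 4) * k' \<zeta> + of_real (c0 / ln lam) / \<zeta>)
      = of_real (\<gamma> / 2) * x * (1 + m + b) - of_real (\<gamma> / 4) * (\<zeta> * k' \<zeta>) + of_real (c0 / ln lam)"
    proof -
      have r: "\<zeta> * (a * kk + d / \<zeta>) = a * (\<zeta> * kk) + d" for a kk d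
        using z0 by (simp add: distrib_left mult.left_commute)
      show ?thesis
        unfolding r g' of_real_mult[of "\<gamma> / 2"] f_norm[OF z] x_def[symmetric] by simp
    qed
    also have "\<dots> = of_real (\<gamma> / 2) * pp"
      unfolding k' c0l pp_def by (simp add: field_simps)
    finally have lhs: "of_real (\<gamma> / 2 * (norm (f \<zeta>))\<^sup>2) * (1 + \<zeta> * g' \<zeta>)
        + \<zeta> * (- of_real (\<gamma> / 4) * k' \<zeta> + of_real (c0 / ln lam) / \<zeta>) = of_real (\<gamma> / 2) * pp" .
    have dom: "dcoeff omg (m,n) = 0" if "m \<noteq> n" for m n
      using w(2)[OF that] that by (simp add: omg_def of_real_def dcoeff_one)
    have evom: "evp \<zeta> omg = of_real \<omega>" unfolding evp_def \<omega>_def by (rule ev_diag[OF dom z \<sigma>1])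
    have ev\<nu>: "evp \<zeta> \<nu> = of_real (ev \<sigma> \<sigma> \<nu>)" unfolding evp_def by (rule ev_diag[OF \<nu>(2) z \<sigma>1])
    have mu: "(of_real \<omega>)\<^sup>2 + of_real (ev \<sigma> \<sigma> \<nu>) = (of_real \<mu>' :: complex)"
      unfolding \<mu>'_def \<omega>_def by (simp add: ev_scaleR_etc[OF \<sigma>n \<sigma>n])
    from arg_cong[OF boundary[folded E_def omg_def], of "evp \<zeta>"]
    have "pp\<^sup>2 = ((of_real \<omega>)\<^sup>2 + of_real (ev \<sigma> \<sigma> \<nu>)) * (x * ((1 + m)\<^sup>2 - b\<^sup>2))"
      unfolding evom[symmetric] ev\<nu>[symmetric] pp_def x_def m_def b_def eb_def evp_def hom by simp
    then have pp2: "pp\<^sup>2 = of_real \<mu>' * (x * ((1 + m)\<^sup>2 - b\<^sup>2))" unfolding mu .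
    have mr: "Im m = 0" using real[OF MB, of \<zeta>] by (simp add: m_def complex_is_Real_iff)
    have br: "Re b = 0" unfolding b_def by (rule imag[OF B_antisym z])
    have EB: "dswap (E * B) = - (E * B)" by (simp add: dswap_mult E_props(1) B_antisym)
    have ppr: "Im pp = 0"
    proof -
      have "dswap (M (E * B)) = M (E * B)" by (simp add: dswap_ops EB linear_simps[OF blin(1)])
      then have "Im eb = 0" using real[of "M (E * B)" \<zeta>] by (simp add: eb_def complex_is_Real_iff)
      moreover have "Im x = 0" using real[OF E_props(1), of \<zeta>] by (simp add: x_def complex_is_Real_iff)
      ultimately show ?thesis using mr by (simp add: pp_def)
    qed
    \<comment> \<open>m is real and b imaginary, so the difference of squares is the squared modulus
      of 1 + m + b.\<close>
    have bb: "(1 + m)\<^sup>2 - b\<^sup>2 = of_real ((norm (1 + m + b))\<^sup>2)"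
    proof -
      have n: "(norm (1 + m + b))\<^sup>2 = (1 + Re m)\<^sup>2 + (Im b)\<^sup>2" by (simp add: cmod_power2 mr br)
      show ?thesis unfolding n by (simp add: complex_eq_iff power2_eq_square mr br)
    qed
    have "of_real ((norm pp)\<^sup>2) = pp\<^sup>2"
      unfolding cmod_power2 ppr by (simp add: complex_eq_iff power2_eq_square ppr)
    also have "\<dots> = of_real (\<mu>' * ((norm (f \<zeta>))\<^sup>2 * (norm (1 + m + b))\<^sup>2))"
      unfolding pp2 bb x_def f_norm[OF z, symmetric] by simp
    finally have "(norm pp)\<^sup>2 = \<mu>' * ((norm (f \<zeta>))\<^sup>2 * (norm (1 + m + b))\<^sup>2)" by (simp only: of_real_eq_iff)
    then show ?thesis
      unfolding lhs unfolding g' norm_mult power_mult_distrib QQ_def norm_of_real power2_abs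
      by (simp only: mult.assoc)
  qed
  obtain U K F \<psi> where U: "open U" "compact K" "K \<subseteq> U" "dom \<subseteq> K" "F holomorphic_on U"
    "\<And>z. z \<in> U \<Longrightarrow> (\<psi> has_derivative (\<lambda>d. Re ((of_real (\<gamma> / 2) * cnj z + F z) * d))) (at z)"
    "\<And>z. norm z = lam \<Longrightarrow> \<psi> z = 1" 
    "\<And>u. norm u = 1 \<Longrightarrow> \<psi> (u * of_real (1 + nuu u)) = 0"
    "\<And>u. norm u = 1 \<Longrightarrow> (norm (of_real (\<gamma> / 2) * cnj (u * of_real (1 + nuu u)) + F (u * of_real (1 + nuu u))))\<^sup>2 = QQ"
    using overdetermined_complex[OF c0_def kb Qb] by blast
  have angfreq: "angular \<eta> \<in> C2_circle \<alpha>"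
    unfolding \<eta>_def using angular_profile[of s N] tr_C2(1)[OF curve_wsum(1)[of s N] \<alpha>] s by simp
  have \<eta>c: "continuous_on (sphere 0 1) \<eta>"
  proof -
    have "continuous_on (sphere 0 1) (\<lambda>x. nuu (toC x))"
      by (rule continuous_on_compose2[OF nuu_cont linear_continuous_on[OF bounded_linear_toC(1)]]) auto
    then show ?thesis by (simp add: nuu_def)
  qed
  have \<eta>s: "\<bar>\<eta> x\<bar> \<le> (1 - lam) / 4" if "norm x = 1" for x using nuu_small[of "toC x"] that by (simp add: nuu_def)
  have sub: "{z. lam < norm z \<and> norm z < 1 + \<eta> (ofC (z / of_real (norm z)))} \<subseteq> K"
    using U(4) unfolding dom_def unfolding nuu_def .
  note res = overdetermined_transfer[OF lam \<alpha> QQ angfreq \<eta>c \<eta>s U(1,2,3,5) sub U(6,7) U(8,9)[unfolded nuu_def]]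
  show "overdetermined_solution lam \<alpha> (gam s) \<eta>" using res(1) by (simp add: \<gamma>_def)
  show "Omega \<eta> = {x. x = 0 \<or> norm x < 1 + \<eta> (x /\<^sub>R norm x)}" by (rule res(2))
  show "Omega \<eta> - cball 0 lam = {x. lam < norm x \<and> norm x < 1 + \<eta> (x /\<^sub>R norm x)}" by (rule res(3))
  show "annulus (admissible_domain lam \<eta>) \<Longrightarrow> \<exists>R. \<forall>u. norm u = 1 \<longrightarrow> \<eta> u = R" by (rule res(4))
qed

end

theorem theorem1p1:
  fixes lam \<alpha> :: real
  assumes "0 < lam" "lam < 1" and "0 < \<alpha>" "\<alpha> < 1"
  shows "\<exists>s0>0. \<exists>(\<gamma> :: real \<Rightarrow> real) (\<eta> :: real \<Rightarrow> real^2 \<Rightarrow> real).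
    \<gamma> C1_differentiable_on {-s0<..<s0} \<and>
    C1_curve \<alpha> {-s0<..<s0} (\<lambda>s. angular (\<eta> s)) \<and>
    (\<forall>s\<in>{-s0<..<s0}. overdetermined_solution lam \<alpha> (\<gamma> s) (\<eta> s)) \<and>
    \<gamma> 0 = 4 / (lam\<^sup>2 - 2 * lam\<^sup>2 * ln lam - 1) \<and>
    (\<forall>x\<in>sphere 0 1. \<eta> 0 x = 0) \<and>
    admissible_domain lam (\<eta> 0) = ball 0 1 - ball 0 lam \<and>
    (\<forall>\<^sub>F s in at 0. \<not> annulus (admissible_domain lam (\<eta> s)) \<and>
       Omega (\<eta> s) - cball 0 lam =
         {x. lam < norm x \<and> norm x < 1 + \<eta> s (x /\<^sub>R norm x)}) \<and>
    (\<exists>\<alpha>1. \<alpha>1 \<noteq> 0 \<and>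
       (\<lambda>s. C2_norm \<alpha> (\<lambda>\<theta>. angular (\<eta> s) \<theta> - s * \<alpha>1 * cos \<theta>)) \<in> o[at 0](\<lambda>s. s))"
proof -
  note lam = assms(1,2) and \<alpha> = assms(3,4)
  interpret ann: annular "lam\<^sup>2" by unfold_locales (use lam in \<open>auto simp: power_less_one_iff\<close>)
  obtain e T B w \<nu> where T: "e > 0" "dswap T = T" "\<And>n. dcoeff T (n,n) = 0" "dcoeff T (Suc 0, 0) = e"
    "has_angular_deriv T B"
    "dcoeff w (0,0) = 0" "\<And>m n. m \<noteq> n \<Longrightarrow> dcoeff w (m,n) = 0"
    "dcoeff \<nu> (0,0) = 0" "\<And>m n. m \<noteq> n \<Longrightarrow> dcoeff \<nu> (m,n) = 0"
    "(exp (2 * T) + exp (2 * T) * ann.M B - ann.M (exp (2 * T) * B) - 1 + (of_real (1 - lam\<^sup>2) + w))\<^sup>2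
      = ((of_real (1 - lam\<^sup>2) + w)\<^sup>2 + \<nu>) * (exp (2 * T) * ((1 + ann.M B)\<^sup>2 - B\<^sup>2))"
    using ann.bifurcating_coefficients by blast
  have "dswap (ann.M T) = - ann.M T" by (simp add: ann.dswap_ops T)
  then obtain c Y where Y: "0 < c" "c \<le> 1" "dswap Y = - Y" "dcoeff Y (0,0) = 0"
    "norm (c *\<^sub>R (dmono (Suc 0,0) * exp Y)) \<le> 1/2" "norm (c *\<^sub>R (dmono (0,Suc 0) * exp (- Y))) \<le> 1/2"
    "Y = - ev (c *\<^sub>R (dmono (Suc 0,0) * exp Y)) (c *\<^sub>R (dmono (0,Suc 0) * exp (- Y))) (ann.M T)"
    by (rule angular_inversion)
  interpret bifurcation lam e c T B w \<nu> Y
    by unfold_locales (fact lam T Y)+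
  obtain s0 where s0: "0 < s0" "s0 \<le> 1/16" 
    "\<And>s. \<bar>s\<bar> < s0 \<Longrightarrow> 4 * (2 / (1 - lam\<^sup>2) * norm T) * \<bar>c * s\<bar> \<le> (1 - lam) / 64"
    "\<And>s. \<bar>s\<bar> < s0 \<Longrightarrow> 2 * norm N * \<bar>s\<bar> \<le> (1 - lam) / 4"
    "\<And>s. \<bar>s\<bar> < s0 \<Longrightarrow> ev (c * s) (c * s) Dn \<noteq> 0"
    "\<And>s. \<bar>s\<bar> < s0 \<Longrightarrow> 0 < ev (c * s) (c * s) (omg\<^sup>2 + \<nu>)"
    using small_parameter by blast
  have at: "overdetermined_solution lam \<alpha> (gam s) (profile N s)"
    "Omega (profile N s) = {x. x = 0 \<or> norm x < 1 + profile N s (x /\<^sub>R norm x)}"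
    "Omega (profile N s) - cball 0 lam = {x. lam < norm x \<and> norm x < 1 + profile N s (x /\<^sub>R norm x)}"
    "annulus (admissible_domain lam (profile N s)) \<Longrightarrow> \<exists>R. \<forall>u. norm u = 1 \<longrightarrow> profile N s u = R" if "\<bar>s\<bar> < s0" for s
  proof -
    have "\<bar>s\<bar> \<le> 1/16" using that s0(2) by linarith
    note o = overdetermined_at[OF \<alpha> this s0(3-6)[OF that]]
    show "overdetermined_solution lam \<alpha> (gam s) (profile N s)"
      "Omega (profile N s) = {x. x = 0 \<or> norm x < 1 + profile N s (x /\<^sub>R norm x)}"
      "Omega (profile N s) - cball 0 lam = {x. lam < norm x \<and> norm x < 1 + profile N s (x /\<^sub>R norm x)}"
      "annulus (admissible_domain lam (profile N s)) \<Longrightarrow> \<exists>R. \<forall>u. norm u = 1 \<longrightarrow> profile N s u = R"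
      by (rule o, assumption?)+
  qed
  have s12: "s0 \<le> 1/2" using s0(2) by simp
  have p0: "profile N 0 x = 0" for x by (simp add: profile_def ev_zero_zero N_coeffs)
  have ce: "0 < c * e" using e c(1) by simp
  obtain C where C: "\<And>s. \<bar>s\<bar> \<le> 1/2 \<Longrightarrow>
      0 \<le> C2_norm \<alpha> (\<lambda>\<theta>. trig_series (curve N s) 0 \<theta> - s * (2 * (c * e)) * cos \<theta>) \<and>
      C2_norm \<alpha> (\<lambda>\<theta>. trig_series (curve N s) 0 \<theta> - s * (2 * (c * e)) * cos \<theta>) \<le> C * s\<^sup>2"
    "\<And>s \<theta>. \<bar>s\<bar> \<le> 1/2 \<Longrightarrow> \<bar>trig_series (curve N s) 0 \<theta> - s * (2 * (c * e)) * cos \<theta>\<bar> \<le> C * s\<^sup>2"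
    using curve_first_order[OF \<alpha> N_coeffs(2-4)] by blast
  have small: "\<forall>\<^sub>F s in at 0. \<bar>s\<bar> < r" if "r > 0" for r :: real
    using that by (auto simp: eventually_at intro!: exI[of _ r])
  have Csmall: "\<forall>\<^sub>F s in at 0. C * \<bar>s\<bar> < r" if "r > 0" for r :: real
  proof -
    have "((\<lambda>s. C * \<bar>s\<bar>) \<longlongrightarrow> C * \<bar>0\<bar>) (at 0)" by (intro tendsto_intros)
    then show ?thesis using order_tendstoD(2)[of "\<lambda>s. C * \<bar>s\<bar>" "C * \<bar>0\<bar>" "at 0" r] that by simp
  qed
  show ?thesis
  proof (rule exI[of _ s0], rule conjI[OF s0(1)], rule exI[of _ gam], rule exI[of _ "profile N"], intro conjI)
    show "gam C1_differentiable_on {-s0<..<s0}" by (rule gam_C1[OF s12 s0(5)])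
    show "C1_curve \<alpha> {-s0<..<s0} (\<lambda>s. angular (profile N s))"
    proof -
      have cc: "C1_curve \<alpha> {-s0<..<s0} (\<lambda>s. trig_series (curve N s) 0)" by (rule C1_curve_tr[OF \<alpha> s12])
      have eq: "angular (profile N s) = trig_series (curve N s) 0" if "\<bar>s\<bar> < s0" for s
        by (rule angular_profile) (use that s0(2) in linarith)
      \<comment> \<open>The profile is identified with the trigonometric curve on the parameter
        interval, so the difference quotients agree only for h near 0.\<close>
      obtain v where v: "\<And>s. s \<in> {-s0<..<s0} \<Longrightarrow> trig_series (curve N s) 0 \<in> C2_circle \<alpha> \<and> v s \<in> C2_circle \<alpha> \<and>
        ((\<lambda>h. C2_norm \<alpha> (\<lambda>\<theta>. (trig_series (curve N (s + h)) 0 \<theta> - trig_series (curve N s) 0 \<theta>) / h - v s \<theta>)) \<longlongrightarrow> 0) (at 0) \<and>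
        ((\<lambda>t. C2_norm \<alpha> (\<lambda>\<theta>. v t \<theta> - v s \<theta>)) \<longlongrightarrow> 0) (at s)"
        using cc unfolding C1_curve_def by blast
      show ?thesis unfolding C1_curve_def
      proof (intro conjI ballI exI[of _ v])
        fix s assume S: "s \<in> {-s0<..<s0}"
        then have s: "\<bar>s\<bar> < s0" by auto
        show "angular (profile N s) \<in> C2_circle \<alpha>" using v[OF S] eq[OF s] by simp
        have "\<forall>\<^sub>F h in at 0. \<bar>h\<bar> < s0 - \<bar>s\<bar>" by (rule small) (use s in simp)
        then have "\<forall>\<^sub>F h in at 0. C2_norm \<alpha> (\<lambda>\<theta>. (trig_series (curve N (s + h)) 0 \<theta> - trig_series (curve N s) 0 \<theta>) / h - v s \<theta>)
            = C2_norm \<alpha> (\<lambda>\<theta>. (angular (profile N (s + h)) \<theta> - angular (profile N s) \<theta>) / h - v s \<theta>)"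
        proof eventually_elim
          case (elim h)
          then have "\<bar>s + h\<bar> < s0" by linarith
          then show ?case by (simp add: eq s)
        qed
        from tendsto_cong[OF this] v[OF S]
        show "((\<lambda>h. C2_norm \<alpha> (\<lambda>\<theta>. (angular (profile N (s + h)) \<theta> - angular (profile N s) \<theta>) / h - v s \<theta>)) \<longlongrightarrow> 0) (at 0)"
          by blast
      qed (use v in blast)+
    qed
    show "\<forall>s\<in>{-s0<..<s0}. overdetermined_solution lam \<alpha> (gam s) (profile N s)" using at(1) by auto
    show "gam 0 = 4 / (lam\<^sup>2 - 2 * lam\<^sup>2 * ln lam - 1)" by (simp add: gam_def ev_zero_zero Dn_00(1))
    show "\<forall>x\<in>sphere 0 1. profile N 0 x = 0" by (simp add: p0)
    have "\<bar>0::real\<bar> < s0" using s0(1) by simp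
    moreover have "{x. x = 0 \<or> norm x < 1 + (0::real)} = ball (0 :: real^2) 1"
    proof (rule set_eqI)
      show "x \<in> {x. x = 0 \<or> norm x < 1 + (0::real)} \<longleftrightarrow> x \<in> ball 0 1" for x :: "real^2"
        by (cases "x = 0") simp_all
    qed
    ultimately have "Omega (profile N 0) = ball 0 1" using at(2)[of 0] by (simp only: p0)
    then show "admissible_domain lam (profile N 0) = ball 0 1 - ball 0 lam" by (simp add: admissible_domain_def)
    show "\<forall>\<^sub>F s in at 0. \<not> annulus (admissible_domain lam (profile N s)) \<and>
       Omega (profile N s) - cball 0 lam = {x. lam < norm x \<and> norm x < 1 + profile N s (x /\<^sub>R norm x)}"
      using small[OF s0(1)] Csmall[OF ce] eventually_neq_at_within[of 0]
    proof eventually_elim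
      case (elim s)
      have s2: "\<bar>s\<bar> \<le> 1/2" "\<bar>s\<bar> \<le> 1" using elim(1) s12 by auto
      have "\<not> annulus (admissible_domain lam (profile N s))"
      proof
        assume "annulus (admissible_domain lam (profile N s))"
        then obtain R where R: "\<And>u. norm u = 1 \<Longrightarrow> profile N s u = R" using at(4)[OF elim(1)] by blast
        have "trig_series (curve N s) 0 \<theta> = R" for \<theta>
          using R[OF toC_unit_vec(2)[of \<theta>]] angular_profile[OF s2(2), of N] by (simp add: angular_def fun_eq_iff)
        \<comment> \<open>A constant profile has the same value at the angles 0 and
          \<open>pi\<close>, where the leading cosine term has opposite signs.\<close>
        then have "\<bar>R - s * (2 * (c * e))\<bar> \<le> C * s\<^sup>2" "\<bar>R + s * (2 * (c * e))\<bar> \<le> C * s\<^sup>2"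
          using C(2)[OF s2(1), of 0] C(2)[OF s2(1), of pi] by simp_all
        then have "\<bar>s * (2 * (c * e))\<bar> \<le> C * s\<^sup>2" by linarith
        moreover have "\<bar>s * (2 * (c * e))\<bar> = \<bar>s\<bar> * (2 * (c * e))"
          using e c(1) by (simp add: abs_mult)
        moreover have "C * s\<^sup>2 = \<bar>s\<bar> * (C * \<bar>s\<bar>)" by (simp add: power2_eq_square)
        ultimately have "\<bar>s\<bar> * (2 * (c * e)) \<le> \<bar>s\<bar> * (C * \<bar>s\<bar>)" by simp
        then have "2 * (c * e) \<le> C * \<bar>s\<bar>" using elim(3) by simp
        then show False using elim(2) ce by linarith
      qed
      then show ?case using at(3)[OF elim(1)] by blast
    qed
    have "2 * (c * e) \<noteq> 0" using e c(1) by simp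
    moreover have "(\<lambda>s. C2_norm \<alpha> (\<lambda>\<theta>. angular (profile N s) \<theta> - s * (2 * (c * e)) * cos \<theta>)) \<in> o[at 0](\<lambda>s. s)"
    proof (rule landau_o.smallI)
      fix r :: real assume r: "r > 0"
      show "\<forall>\<^sub>F s in at 0. norm (C2_norm \<alpha> (\<lambda>\<theta>. angular (profile N s) \<theta> - s * (2 * (c * e)) * cos \<theta>)) \<le> r * norm s"
        using small[OF s0(1)] Csmall[OF r]
      proof eventually_elim
        case (elim s)
        have s2: "\<bar>s\<bar> \<le> 1/2" "\<bar>s\<bar> \<le> 1" using elim(1) s12 by auto
        have "C * s\<^sup>2 = (C * \<bar>s\<bar>) * \<bar>s\<bar>" by (simp add: power2_eq_square mult.assoc)
        also have "\<dots> \<le> r * \<bar>s\<bar>" using elim(2) by (intro mult_right_mono) auto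
        finally show ?case using C(1)[OF s2(1)] unfolding angular_profile[OF s2(2)] by simp
      qed
    qed
    ultimately show "\<exists>\<alpha>1. \<alpha>1 \<noteq> 0 \<and>
       (\<lambda>s. C2_norm \<alpha> (\<lambda>\<theta>. angular (profile N s) \<theta> - s * \<alpha>1 * cos \<theta>)) \<in> o[at 0](\<lambda>s. s)"
      by blast
  qed
qed

end
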